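(* Let $\varGamma$ be an oriented modular graph and $g:\varGamma\to\mathbf{R}\cup\{\infty\}$ an L-convex function, and assume that $\varGamma$ is locally finite or the image of $g$ is discrete (there is $\epsilon>0$ such that $[g(x)-\epsilon,g(x)+\epsilon]\cap g(\varGamma)=\{g(x)\}$ for every $x\in\varGamma$). Then a vertex $x\in\operatorname{dom}g$ is a minimizer of $g$ over $\varGamma$ if and only if $x$ is a minimizer of $g$ over $\mathcal{F}'_x\cup\mathcal{I}'_x$.
   Context: All graphs are connected, simple, undirected, possibly infinite; $d$ is the shortest-path metric, $I(x,y)=\{z:d(x,z)+d(z,y)=d(x,y)\}$. A graph is modular if $I(x,y)\cap I(y,z)\cap I(z,x)\ne\emptyset$ for all $x,y,z$. An orientation is admissible if for every 4-cycle $(x_1,x_2,x_3,x_4)$, $x_1\to x_2$ implies $x_4\to x_3$. An oriented modular graph is a modular graph with an admissible orientation; $p\preceq q$ means there is a directed path from $q$ to $p$. For $p\preceq q$, $[p,q]$ is a modular lattice; $p\sqsubseteq q$ means $p\preceq q$ and $[p,q]$ is a complemented modular lattice (every element a join of elements covering $p$). $\mathcal{F}'_x=\{y:x\sqsubseteq y\}$, $\mathcal{I}'_x=\{y:y\sqsubseteq x\}$. $\operatorname{dom}g=\{x:g(x)<\infty\}$. A $\varDelta'$-path is $x_0,\dots,x_m$ with $x_i\sqsubseteq x_{i+1}$ or $x_{i+1}\sqsubseteq x_i$; a set is $\varDelta'$-connected if any two distinct members are joined by a $\varDelta'$-path inside it. $\varGamma^*$ is the set of intervals $[x,y]$ with $x\sqsubseteq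 y$; $\mathcal{I}^*_x$ is the set of $[y,z]\in\varGamma^*$ with $y\preceq x\preceq z$ ordered by inclusion (a modular semilattice). $g^*([x,y])=(g(x)+g(y))/2$. $g$ is L-convex if $\operatorname{dom}g$ is $\varDelta'$-connected and for every vertex $x$ the restriction of $g^*$ to $\mathcal{I}^*_x$ is submodular. Submodularity on a modular semilattice $\mathcal{L}$ (meet-semilattice of finite rank, rank $r$, principal ideals modular lattices, $x\vee y\vee z$ exists when pairwise joins exist): $I(p,q)$ = elements on shortest $p$–$q$ paths of the covering graph; $r(u;p,q)=(r(u\wedge p)-r(p\wedge q),r(u\wedge q)-r(p\wedge q))$; $\mathcal{E}(p,q)$ = the $u\in I(p,q)$ with $r(u;p,q)$ a componentwise-maximal extreme point of the convex hull $\mathrm{Conv}I(p,q)$; $C(u;p,q)=\{w\in\mathbf{R}^2_{\ge0}:\langle w,r(u;p,q)\rangle=\max_{z\in\mathrm{Conv}I(p,q)}\langle w,z\rangle\}=\{(x,y)\ge0:y\cos\alpha\le x\sin\alpha,\ y\cos\beta\ge x\sin\beta\}$ ($0\le\beta\le\alpha\le\pi/2$), $[C]=\frac{\sin\alpha}{\sin\alpha+\cos\alpha}-\frac{\sin\beta}{\sin\beta+\cos\beta}$. $f$ is submodular if $f(p)+f(q)\ge f(p\wedge q)+\sum_{u\in\mathcal{E}(p,q)}[C(u;p,q)]f(u)$ for all $p,q$ (zero-coefficient terms omitted; $a+\infty=\infty$). *)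

theory Defs
  imports "HOL-Analysis.Analysis" "HOL-Library.Extended_Real"
begin

section \<open>Graphs\<close>

text \<open>A graph is given by a vertex set V and an adjacency predicate E
 (simple, undirected, connected, possibly infinite).\<close>

definition edges :: "('a \<Rightarrow> 'a \<Rightarrow> bool) \<Rightarrow> ('a \<times> 'a) set" where
  "edges E = {(u, v). E u v}"

definition graph :: "'a set \<Rightarrow> ('a \<Rightarrow> 'a \<Rightarrow> bool) \<Rightarrow> bool" where
  "graph V E \<longleftrightarrow>
     (\<forall>x y. E x y \<longrightarrow> x \<in> V \<and> y \<in> V) \<and>
     (\<forall>x. \<not> E x x) \<and>
     (\<forall>x y. E x y \<longrightarrow> E y x) \<and>
     (\<forall>x\<in>V. \<forall>y\<in>V. (x, y) \<in> (edges E)\<^sup>*)"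

text \<open>shortest-path metric\<close>
definition gdist :: "('a \<Rightarrow> 'a \<Rightarrow> bool) \<Rightarrow> 'a \<Rightarrow> 'a \<Rightarrow> nat" where
  "gdist E x y = (LEAST n. (x, y) \<in> edges E ^^ n)"

definition gint :: "'a set \<Rightarrow> ('a \<Rightarrow> 'a \<Rightarrow> bool) \<Rightarrow> 'a \<Rightarrow> 'a \<Rightarrow> 'a set" where
  "gint V E x y = {z \<in> V. gdist E x z + gdist E z y = gdist E x y}"

definition modular_graph :: "'a set \<Rightarrow> ('a \<Rightarrow> 'a \<Rightarrow> bool) \<Rightarrow> bool" where
  "modular_graph V E \<longleftrightarrow> graph V E \<and>
     (\<forall>x\<in>V. \<forall>y\<in>V. \<forall>z\<in>V. gint V E x y \<inter> gint V E y z \<inter> gint V E z x \<noteq> {})"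

text \<open>An orientation: \<open>Or x y\<close> means the edge xy is oriented x \<rightarrow> y.\<close>
definition orientation :: "('a \<Rightarrow> 'a \<Rightarrow> bool) \<Rightarrow> ('a \<Rightarrow> 'a \<Rightarrow> bool) \<Rightarrow> bool" where
  "orientation E Or \<longleftrightarrow>
     (\<forall>x y. Or x y \<longrightarrow> E x y) \<and>
     (\<forall>x y. E x y \<longrightarrow> Or x y \<or> Or y x) \<and>
     (\<forall>x y. Or x y \<longrightarrow> \<not> Or y x)"

definition four_cycle :: "('a \<Rightarrow> 'a \<Rightarrow> bool) \<Rightarrow> 'a \<Rightarrow> 'a \<Rightarrow> 'a \<Rightarrow> 'a \<Rightarrow> bool" where
  "four_cycle E x1 x2 x3 x4 \<longleftrightarrow> distinct [x1, x2, x3, x4] \<and>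
     E x1 x2 \<and> E x2 x3 \<and> E x3 x4 \<and> E x4 x1"

definition admissible :: "('a \<Rightarrow> 'a \<Rightarrow> bool) \<Rightarrow> ('a \<Rightarrow> 'a \<Rightarrow> bool) \<Rightarrow> bool" where
  "admissible E Or \<longleftrightarrow> orientation E Or \<and>
     (\<forall>x1 x2 x3 x4. four_cycle E x1 x2 x3 x4 \<longrightarrow> Or x1 x2 \<longrightarrow> Or x4 x3)"

definition oriented_modular_graph ::
  "'a set \<Rightarrow> ('a \<Rightarrow> 'a \<Rightarrow> bool) \<Rightarrow> ('a \<Rightarrow> 'a \<Rightarrow> bool) \<Rightarrow> bool" where
  "oriented_modular_graph V E Or \<longleftrightarrow> modular_graph V E \<and> admissible E Or"

text \<open>\<open>opreceq Or p q\<close>: p \<preceq> q, i.e. there is a directed path from q to p.\<close>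
definition opreceq :: "('a \<Rightarrow> 'a \<Rightarrow> bool) \<Rightarrow> 'a \<Rightarrow> 'a \<Rightarrow> bool" where
  "opreceq Or p q \<longleftrightarrow> (q, p) \<in> (edges Or)\<^sup>*"

definition ointerval :: "('a \<Rightarrow> 'a \<Rightarrow> bool) \<Rightarrow> 'a \<Rightarrow> 'a \<Rightarrow> 'a set" where
  "ointerval Or p q = {z. opreceq Or p z \<and> opreceq Or z q}"

text \<open>elements of [p,q] covering p\<close>
definition atoms_of :: "('a \<Rightarrow> 'a \<Rightarrow> bool) \<Rightarrow> 'a \<Rightarrow> 'a \<Rightarrow> 'a set" where
  "atoms_of Or p q = {a \<in> ointerval Or p q. a \<noteq> p \<and>
      \<not> (\<exists>w \<in> ointerval Or p q. w \<noteq> p \<and> w \<noteq> a \<and> opreceq Or w a)}"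

text \<open>z is the join in the lattice [p,q] of the set A\<close>
definition is_join_in :: "('a \<Rightarrow> 'a \<Rightarrow> bool) \<Rightarrow> 'a \<Rightarrow> 'a \<Rightarrow> 'a set \<Rightarrow> 'a \<Rightarrow> bool" where
  "is_join_in Or p q A z \<longleftrightarrow> z \<in> ointerval Or p q \<and> (\<forall>a\<in>A. opreceq Or a z) \<and>
     (\<forall>w \<in> ointerval Or p q. (\<forall>a\<in>A. opreceq Or a w) \<longrightarrow> opreceq Or z w)"

text \<open>p \<sqsubseteq> q : p \<preceq> q and [p,q] is a complemented modular lattice, i.e. every
 element of [p,q] is a join of elements covering p.\<close>
definition osqsub :: "('a \<Rightarrow> 'a \<Rightarrow> bool) \<Rightarrow> 'a \<Rightarrow> 'a \<Rightarrow> bool" where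
  "osqsub Or p q \<longleftrightarrow> opreceq Or p q \<and>
     (\<forall>z \<in> ointerval Or p q. \<exists>A \<subseteq> atoms_of Or p q. is_join_in Or p q A z)"

definition Fprime :: "'a set \<Rightarrow> ('a \<Rightarrow> 'a \<Rightarrow> bool) \<Rightarrow> 'a \<Rightarrow> 'a set" where
  "Fprime V Or x = {y \<in> V. osqsub Or x y}"

definition Iprime :: "'a set \<Rightarrow> ('a \<Rightarrow> 'a \<Rightarrow> bool) \<Rightarrow> 'a \<Rightarrow> 'a set" where
  "Iprime V Or x = {y \<in> V. osqsub Or y x}"

definition gdom :: "'a set \<Rightarrow> ('a \<Rightarrow> ereal) \<Rightarrow> 'a set" where
  "gdom V g = {x \<in> V. g x < \<infinity>}"

text \<open>\<Delta>'-connectedness: any two distinct members are joined by a \<Delta>'-path inside the set.\<close>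
definition delta_path :: "('a \<Rightarrow> 'a \<Rightarrow> bool) \<Rightarrow> 'a set \<Rightarrow> 'a list \<Rightarrow> bool" where
  "delta_path Or S xs \<longleftrightarrow> xs \<noteq> [] \<and> set xs \<subseteq> S \<and>
     (\<forall>i < length xs - 1. osqsub Or (xs ! i) (xs ! Suc i) \<or> osqsub Or (xs ! Suc i) (xs ! i))"

definition delta_connected :: "('a \<Rightarrow> 'a \<Rightarrow> bool) \<Rightarrow> 'a set \<Rightarrow> bool" where
  "delta_connected Or S \<longleftrightarrow> (\<forall>x\<in>S. \<forall>y\<in>S. x \<noteq> y \<longrightarrow>
     (\<exists>xs. delta_path Or S xs \<and> hd xs = x \<and> last xs = y))"

section \<open>Submodularity on a modular semilattice (S, le)\<close>

definition slt :: "('b \<Rightarrow> 'b \<Rightarrow> bool) \<Rightarrow> 'b \<Rightarrow> 'b \<Rightarrow> bool" where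
  "slt le a b \<longleftrightarrow> le a b \<and> a \<noteq> b"

definition scover :: "'b set \<Rightarrow> ('b \<Rightarrow> 'b \<Rightarrow> bool) \<Rightarrow> 'b \<Rightarrow> 'b \<Rightarrow> bool" where
  "scover S le a b \<longleftrightarrow> a \<in> S \<and> b \<in> S \<and> slt le a b \<and>
     \<not> (\<exists>c\<in>S. slt le a c \<and> slt le c b)"

text \<open>distance in the covering graph (Hasse diagram)\<close>
definition cdist :: "'b set \<Rightarrow> ('b \<Rightarrow> 'b \<Rightarrow> bool) \<Rightarrow> 'b \<Rightarrow> 'b \<Rightarrow> nat" where
  "cdist S le p q = (LEAST n. (p, q) \<in> {(a, b). scover S le a b \<or> scover S le b a} ^^ n)"

definition cint :: "'b set \<Rightarrow> ('b \<Rightarrow> 'b \<Rightarrow> bool) \<Rightarrow> 'b \<Rightarrow> 'b \<Rightarrow> 'b set" where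
  "cint S le p q = {u \<in> S. cdist S le p u + cdist S le u q = cdist S le p q}"

definition smeet :: "'b set \<Rightarrow> ('b \<Rightarrow> 'b \<Rightarrow> bool) \<Rightarrow> 'b \<Rightarrow> 'b \<Rightarrow> 'b" where
  "smeet S le p q = (THE m. m \<in> S \<and> le m p \<and> le m q \<and>
      (\<forall>w\<in>S. le w p \<and> le w q \<longrightarrow> le w m))"

text \<open>rank: length of a longest strictly increasing chain in S ending at p\<close>
definition srank :: "'b set \<Rightarrow> ('b \<Rightarrow> 'b \<Rightarrow> bool) \<Rightarrow> 'b \<Rightarrow> nat" where
  "srank S le p = Sup {n. \<exists>c :: nat \<Rightarrow> 'b. (\<forall>i\<le>n. c i \<in> S) \<and>
      (\<forall>i<n. slt le (c i) (c (Suc i))) \<and> c n = p}"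

definition rvec :: "'b set \<Rightarrow> ('b \<Rightarrow> 'b \<Rightarrow> bool) \<Rightarrow> 'b \<Rightarrow> 'b \<Rightarrow> 'b \<Rightarrow> real \<times> real" where
  "rvec S le u p q =
     (real (srank S le (smeet S le u p)) - real (srank S le (smeet S le p q)),
      real (srank S le (smeet S le u q)) - real (srank S le (smeet S le p q)))"

definition convI :: "'b set \<Rightarrow> ('b \<Rightarrow> 'b \<Rightarrow> bool) \<Rightarrow> 'b \<Rightarrow> 'b \<Rightarrow> (real \<times> real) set" where
  "convI S le p q = convex hull ((\<lambda>u. rvec S le u p q) ` cint S le p q)"

definition Eset :: "'b set \<Rightarrow> ('b \<Rightarrow> 'b \<Rightarrow> bool) \<Rightarrow> 'b \<Rightarrow> 'b \<Rightarrow> 'b set" where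
  "Eset S le p q = {u \<in> cint S le p q.
      rvec S le u p q extreme_point_of convI S le p q \<and>
      \<not> (\<exists>z \<in> convI S le p q. z \<noteq> rvec S le u p q \<and>
            fst (rvec S le u p q) \<le> fst z \<and> snd (rvec S le u p q) \<le> snd z)}"

definition Ccone :: "'b set \<Rightarrow> ('b \<Rightarrow> 'b \<Rightarrow> bool) \<Rightarrow> 'b \<Rightarrow> 'b \<Rightarrow> 'b \<Rightarrow> (real \<times> real) set" where
  "Ccone S le u p q = {w. 0 \<le> fst w \<and> 0 \<le> snd w \<and>
      inner w (rvec S le u p q) = (SUP z \<in> convI S le p q. inner w z)}"

text \<open>[C] for a cone C = {(x,y) \<ge> 0 : y cos \<alpha> \<le> x sin \<alpha>, y cos \<beta> \<ge> x sin \<beta>}\<close>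
definition cone_measure :: "(real \<times> real) set \<Rightarrow> real" where
  "cone_measure C = (THE v. \<exists>\<alpha> \<beta>. 0 \<le> \<beta> \<and> \<beta> \<le> \<alpha> \<and> \<alpha> \<le> pi / 2 \<and>
      C = {(x, y). 0 \<le> x \<and> 0 \<le> y \<and> y * cos \<alpha> \<le> x * sin \<alpha> \<and> y * cos \<beta> \<ge> x * sin \<beta>} \<and>
      v = sin \<alpha> / (sin \<alpha> + cos \<alpha>) - sin \<beta> / (sin \<beta> + cos \<beta>))"

definition submodular_on :: "'b set \<Rightarrow> ('b \<Rightarrow> 'b \<Rightarrow> bool) \<Rightarrow> ('b \<Rightarrow> ereal) \<Rightarrow> bool" where
  "submodular_on S le f \<longleftrightarrow> (\<forall>p\<in>S. \<forall>q\<in>S.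
     f p + f q \<ge> f (smeet S le p q) +
       (\<Sum>u \<in> {u \<in> Eset S le p q. cone_measure (Ccone S le u p q) \<noteq> 0}.
           ereal (cone_measure (Ccone S le u p q)) * f u))"

section \<open>L-convexity\<close>

text \<open>\<Gamma>* restricted to x: intervals [y,z] with y \<sqsubseteq> z and y \<preceq> x \<preceq> z, ordered by inclusion\<close>
definition Istar :: "('a \<Rightarrow> 'a \<Rightarrow> bool) \<Rightarrow> 'a \<Rightarrow> 'a set set" where
  "Istar Or x = {ointerval Or y z | y z. osqsub Or y z \<and> opreceq Or y x \<and> opreceq Or x z}"

definition gstar :: "('a \<Rightarrow> 'a \<Rightarrow> bool) \<Rightarrow> ('a \<Rightarrow> ereal) \<Rightarrow> 'a set \<Rightarrow> ereal" where
  "gstar Or g J = (THE v. \<exists>y z. osqsub Or y z \<and> J = ointerval Or y z \<and> v = (g y + g z) / 2)"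

definition L_convex :: "'a set \<Rightarrow> ('a \<Rightarrow> 'a \<Rightarrow> bool) \<Rightarrow> ('a \<Rightarrow> ereal) \<Rightarrow> bool" where
  "L_convex V Or g \<longleftrightarrow> delta_connected Or (gdom V g) \<and>
     (\<forall>x\<in>V. submodular_on (Istar Or x) (\<subseteq>) (gstar Or g))"

end

theory Submission
  imports Defs
begin

text \<open>A vertex that minimises \<open>g\<close> locally but not globally is joined to a lower vertex by a
  \<open>\<Delta>'\<close>-path in the domain. Suppose that \<open>A\<close>, \<open>X\<close>, \<open>B\<close> are consecutive on such a path and \<open>X\<close>
  attains its maximum \<open>c\<close>, with \<open>g A \<le> c\<close> and \<open>g B < c\<close>. Submodularity at \<open>X\<close>, applied to the
  intervals spanned by \<open>A, X\<close> and \<open>X, B\<close>, averages \<open>g\<close> with weights of sum one and forces some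
  vertex on a geodesic from \<open>A\<close> to \<open>B\<close> below \<open>c\<close>; induction on the distance of \<open>A\<close> and \<open>B\<close>
  replaces \<open>X\<close> by a \<open>\<Delta>'\<close>-path below \<open>c\<close>. The metric length of the whole path does not grow, so
  under either finiteness assumption only finitely many maxima are possible and the path can be
  pushed down to level \<open>g x\<close>, where its second vertex contradicts local minimality.\<close>

section \<open>Weights of a finite planar point set\<close>

text \<open>The coefficients [C] belong to elements of the semilattice, while interval lengths
  belong to points of the plane, and several elements could share one vector r(u;p,q). Total weight
  one therefore rests on excluding this for the elements that carry weight, which is the main use of
  the semilattice axioms. Verifying these axioms for the intervals around X is where the geometry of
  the graph enters: medians as meets and joins, the triple condition, complemented intervals.

  Plain averaging is not enough, since an interval in the sum may itself end in A or B, whose low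
  values could account for the whole average. Each interval is compared with the value that such
  ends alone would explain; the strict deficit must then come from a new vertex. If A and B lie on
  the same side of X, the two intervals meet in more than {X}, and the value there may be small; in
  that case the meet (or join) of A and B is itself the detour.

  A detour may have more vertices than the piece it replaces, so metric length is what is
  controlled. It keeps all later paths inside one ball around the initial vertex.\<close>

definition phi :: "real \<Rightarrow> real \<times> real \<Rightarrow> real" where
  "phi t z = (1 - t) * fst z + t * snd z"

text \<open>Writing nonnegative weight vectors up to scaling as \<open>(1 - t, t)\<close>, the coefficient \<open>[C]\<close> of a
  cone is the length of the corresponding interval of \<open>t\<close>, because the ray of angle \<open>\<alpha>\<close> has
  \<open>t = sin \<alpha> / (sin \<alpha> + cos \<alpha>)\<close>.\<close>
definition opt_weights :: "(real \<times> real) set \<Rightarrow> real \<times> real \<Rightarrow> real set" where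
  "opt_weights P e = {t \<in> {0..1}. \<forall>z\<in>P. phi t z \<le> phi t e}"

lemma phi_inner: "phi t z = inner (1 - t, t) z"
  by (cases z) (simp add: phi_def)

text \<open>The weight vectors (1 - s, s) and (1 - t, t) are linearly independent. This turns
  optimality on an interval of positive length into uniqueness.\<close>

lemma phi_eq_twice:
  assumes "phi s a = phi s b" "phi t a = phi t b" "s \<noteq> t"
  shows "a = b"
proof -
  let ?x = "fst a - fst b" and ?y = "snd a - snd b"
  have 1: "(1 - s) * ?x + s * ?y = 0" and 2: "(1 - t) * ?x + t * ?y = 0"
    using assms(1,2) by (simp_all add: phi_def algebra_simps)
  have "(t - s) * (?x) = t * ((1 - s) * ?x + s * ?y) - s * ((1 - t) * ?x + t * ?y)"
    by (simp add: algebra_simps)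
  then have "?x = 0" using 1 2 assms(3) by simp
  moreover have "(t - s) * (?y) = (1 - s) * ((1 - t) * ?x + t * ?y) - (1 - t) * ((1 - s) * ?x + s * ?y)"
    by (simp add: algebra_simps)
  then have "?y = 0" using 1 2 assms(3) by simp
  ultimately show ?thesis by (simp add: prod_eq_iff)
qed

text \<open>Each constraint is affine in t, so a closed convex part of [0, 1] remains; the empty set
  is covered by a > b.\<close>

lemma opt_weights_interval:
  assumes "finite P"
  shows "\<exists>a b. opt_weights P e = {a..b}"
proof -
  have *: "opt_weights P e = {0..1} \<inter> (\<Inter>z\<in>P. {t. phi t z \<le> phi t e})"
    by (auto simp: opt_weights_def)
  have "closed {t. phi t z \<le> phi t e}" for z
    unfolding phi_def by (intro closed_Collect_le continuous_intros)
  then have "compact (opt_weights P e)"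
    unfolding * by (intro compact_Int_closed closed_INT) auto
  moreover have "convex {t. phi t z \<le> phi t e}" for z
  proof -
    have "{t. phi t z \<le> phi t e} = {t. inner (snd z - fst z - (snd e - fst e)) t \<le> fst e - fst z}"
      by (auto simp: phi_def algebra_simps)
    then show ?thesis by (simp only: convex_halfspace_le)
  qed
  then have "convex (opt_weights P e)"
    unfolding * by (intro convex_Int convex_INT) auto
  ultimately show ?thesis
    using connected_compact_interval_1[of "opt_weights P e"] convex_connected by blast
qed

text \<open>The default 0 lets a point that is optimal for no weight contribute nothing.\<close>

definition interval_length :: "real set \<Rightarrow> real" where
  "interval_length A = (if A = {} then 0 else Sup A - Inf A)"

lemma interval_length_interval: "interval_length {a..b} = (if a \<le> b then b - a else 0)"
  by (auto simp: interval_length_def)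

lemma opt_weights_exists:
  assumes "finite P" "P \<noteq> {}" "t \<in> {0..1}"
  shows "\<exists>e\<in>P. t \<in> opt_weights P e"
proof -
  have "Max (phi t ` P) \<in> phi t ` P" using assms by (intro Max_in) auto
  then obtain e where "e \<in> P" "phi t e = Max (phi t ` P)" by auto
  then show ?thesis using assms by (auto simp: opt_weights_def intro!: bexI[of _ e])
qed

text \<open>Away from finitely many ties exactly one point of P is optimal, so the indicator
  functions sum to 1 there; integration over [0, 1] gives the claim.\<close>

lemma sum_interval_length_opt_weights:
  assumes "finite P" "P \<noteq> {}"
  shows "(\<Sum>e\<in>P. interval_length (opt_weights P e)) = 1"
proof -
  have sub: "opt_weights P e \<subseteq> {0..1}" for e by (auto simp: opt_weights_def)
  have one: "((indicat_real (opt_weights P e)) has_integral interval_length (opt_weights P e)) {0..1}" for e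
  proof -
    obtain a b where ab: "opt_weights P e = {a..b}" using opt_weights_interval[OF assms(1)] by blast
    have "((\<lambda>x. 1::real) has_integral interval_length {a..b}) {a..b}"
      using has_integral_const_real[of "1::real" a b] by (auto simp: interval_length_interval)
    then show ?thesis
      using sub[of e] unfolding ab indicator_def of_bool_def
      by (subst has_integral_restrict) auto
  qed
  define N where "N = (\<Union>e\<in>P. \<Union>e'\<in>P - {e}. {t. phi t e = phi t e'})"
  have tie: "finite {t. phi t e = phi t e'}" if "e \<noteq> e'" for e e'
  proof (rule ccontr)
    assume inf: "infinite {t. phi t e = phi t e'}"
    then obtain s where s: "phi s e = phi s e'" using not_finite_existsD by blast
    have "infinite ({t. phi t e = phi t e'} - {s})" using inf by simp
    then obtain t where "t \<in> {t. phi t e = phi t e'} - {s}"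
      using infinite_imp_nonempty by blast
    then show False using phi_eq_twice[OF s] that by auto
  qed
  have finN: "finite N" unfolding N_def using assms(1) by (intro finite_UN_I finite_Diff tie) auto
  have int: "((\<lambda>t. \<Sum>e\<in>P. indicat_real (opt_weights P e) t) has_integral (\<Sum>e\<in>P. interval_length (opt_weights P e))) {0..1::real}"
    by (intro has_integral_sum assms one)
  have "(\<Sum>e\<in>P. indicat_real (opt_weights P e) t) = 1" if t: "t \<in> {0..1} - N" for t
  proof -
    obtain e where e: "e \<in> P" "t \<in> opt_weights P e" using opt_weights_exists[OF assms] t by blast
    have "t \<notin> opt_weights P e'" if "e' \<in> P" "e' \<noteq> e" for e'
    proof
      assume "t \<in> opt_weights P e'"
      then have "phi t e = phi t e'" using e that by (auto simp: opt_weights_def intro: antisym)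
      then show False using t e that by (auto simp: N_def)
    qed
    then have "(\<Sum>e\<in>P. indicat_real (opt_weights P e) t) = (\<Sum>e'\<in>P. if e' = e then 1 else 0)"
      using e by (intro sum.cong) (auto simp: indicator_def)
    then show ?thesis using e assms by simp
  qed
  then have "((\<lambda>t. 1::real) has_integral (\<Sum>e\<in>P. interval_length (opt_weights P e))) {0..1::real}"
    by (intro has_integral_spike_finite[OF finN _ int]) simp
  moreover have "((\<lambda>t. 1::real) has_integral 1) {0..1::real}"
    using has_integral_const_real[of "1::real" 0 1] by simp
  ultimately show ?thesis using has_integral_unique by blast
qed

lemma opt_weights_two_points:
  assumes "finite P" "interval_length (opt_weights P e) \<noteq> 0"
  obtains s t where "s < t" "s \<in> opt_weights P e" "t \<in> opt_weights P e" "0 < s" "t < 1"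
proof -
  obtain a b where ab: "opt_weights P e = {a..b}" using opt_weights_interval[OF assms(1)] by blast
  have l: "a < b" using assms(2) by (auto simp: ab interval_length_interval split: if_splits)
  then have "a \<in> opt_weights P e" "b \<in> opt_weights P e" by (auto simp: ab)
  then have *: "0 \<le> a" "b \<le> 1" by (auto simp: opt_weights_def)
  show ?thesis
    by (rule that[of "(2*a+b)/3" "(a+2*b)/3"]) (use * l in \<open>auto simp: ab field_simps\<close>)
qed

lemma interval_length_opt_weights_pos:
  assumes "finite P" "s \<in> opt_weights P e" "t \<in> opt_weights P e" "s \<noteq> t"
  shows "interval_length (opt_weights P e) > 0"
proof -
  obtain a b where ab: "opt_weights P e = {a..b}" using opt_weights_interval[OF assms(1)] by blast
  show ?thesis using assms(2-) by (auto simp: ab interval_length_interval)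
qed

lemma interval_length_opt_weights_nonneg: "finite P \<Longrightarrow> interval_length (opt_weights P e) \<ge> 0"
  using opt_weights_interval[of P e] by (auto simp: interval_length_interval)

text \<open>An optimum at s may be optimal at s alone. But if t is so close to s that it avoids
  every closed set \<open>opt_weights P e\<close> not containing s, then a point optimal at t is
  optimal at s as well.\<close>

lemma opt_weights_exists_long:
  assumes "finite P" "P \<noteq> {}" "s \<in> {0..1}"
  shows "\<exists>e\<in>P. s \<in> opt_weights P e \<and> interval_length (opt_weights P e) > 0"
proof -
  define K where "K = (\<Union>e\<in>{e\<in>P. s \<notin> opt_weights P e}. opt_weights P e)"
  have "closed (opt_weights P e)" for e
    using opt_weights_interval[OF assms(1), of e] by auto
  then have "closed K" unfolding K_def using assms(1) by (intro closed_UN) auto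
  moreover have "s \<notin> K" by (auto simp: K_def)
  ultimately obtain \<delta> where d: "\<delta> > 0" "ball s \<delta> \<subseteq> - K"
    by (meson Compl_iff open_Compl open_contains_ball)
  \<comment> \<open>Half of \<open>\<delta>\<close>, to the left only if s = 1, and cut off at the
    ends of [0, 1].\<close>
  define t where "t = (if s < 1 then min 1 (s + \<delta>/2) else max 0 (s - \<delta>/2))"
  have t: "t \<in> {0..1}" "t \<noteq> s" "t \<in> ball s \<delta>"
    using assms(3) d(1) by (auto simp: t_def dist_real_def min_def max_def split: if_splits)
  obtain e where e: "e \<in> P" "t \<in> opt_weights P e" using opt_weights_exists[OF assms(1,2) t(1)] by blast
  have "s \<in> opt_weights P e" using e t(3) d(2) by (auto simp: K_def)
  then show ?thesis using interval_length_opt_weights_pos[OF assms(1) _ e(2)] t(2) e(1) by metis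
qed

section \<open>Cones of optimal weights and their measure\<close>

lemma inner_hull_le:
  assumes "\<And>z. z \<in> P \<Longrightarrow> inner w z \<le> B" "z \<in> convex hull P"
  shows "inner w z \<le> B"
proof -
  have "convex hull P \<subseteq> {z. inner w z \<le> B}"
    by (rule hull_minimal) (use assms in \<open>auto simp: convex_halfspace_le\<close>)
  then show ?thesis using assms(2) by blast
qed

lemma opt_weights_hull:
  assumes "t \<in> opt_weights P e" "z \<in> convex hull P"
  shows "phi t z \<le> phi t e"
  using inner_hull_le[of P "(1-t,t)" "phi t e" z] assms by (auto simp: opt_weights_def phi_inner)

lemma cone_of_opt_weights:
  assumes "finite P" "e \<in> P"
  shows "{w. 0 \<le> fst w \<and> 0 \<le> snd w \<and> inner w e = (SUP z \<in> convex hull P. inner w z)} =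
    {w. 0 \<le> fst w \<and> 0 \<le> snd w \<and> (\<forall>z\<in>P. inner w z \<le> inner w e)}"
proof -
  have "inner w e = (SUP z \<in> convex hull P. inner w z) \<longleftrightarrow> (\<forall>z\<in>P. inner w z \<le> inner w e)" for w
  proof
    assume *: "inner w e = (SUP z \<in> convex hull P. inner w z)"
    have "bdd_above ((\<lambda>z. inner w z) ` (convex hull P))"
      using inner_hull_le[of P w "Max (inner w ` P)"] assms by (intro bdd_aboveI2) auto
    then show "\<forall>z\<in>P. inner w z \<le> inner w e"
      unfolding * by (auto intro!: cSUP_upper hull_inc)
  next
    assume "\<forall>z\<in>P. inner w z \<le> inner w e"
    then have "\<And>z. z \<in> convex hull P \<Longrightarrow> inner w z \<le> inner w e"
      using inner_hull_le[of P w "inner w e"] by blast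
    then show "inner w e = (SUP z \<in> convex hull P. inner w z)"
      using assms(2) by (intro cSup_eq_maximum[symmetric]) (auto intro: hull_inc)
  qed
  then show ?thesis by simp
qed

text \<open>If the optimal weights are {a..b}, the cone is bounded by the rays through (1 - a, a)
  and (1 - b, b). Their angles witness the description in \<open>cone_measure\<close>, and every
  other pair of angles describing the cone yields the same number b - a.\<close>

lemma cone_measure_eq:
  assumes fin: "finite P" and e: "e \<in> P" and ne: "opt_weights P e \<noteq> {}"
  shows "cone_measure {w. 0 \<le> fst w \<and> 0 \<le> snd w \<and> inner w e = (SUP z \<in> convex hull P. inner w z)}
    = interval_length (opt_weights P e)"
proof -
  define C where "C = {w::real\<times>real. 0 \<le> fst w \<and> 0 \<le> snd w \<and> (\<forall>z\<in>P. inner w z \<le> inner w e)}"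
  define K where "K = (\<lambda>\<alpha> \<beta>. {(x::real, y::real). 0 \<le> x \<and> 0 \<le> y \<and> y * cos \<alpha> \<le> x * sin \<alpha> \<and> y * cos \<beta> \<ge> x * sin \<beta>})"
  define q where "q = (\<lambda>\<alpha>::real. sin \<alpha> / (sin \<alpha> + cos \<alpha>))"
  obtain a b where ab: "opt_weights P e = {a..b}" using opt_weights_interval[OF fin] by blast
  have abl: "a \<le> b" using ne ab by auto
  have "a \<in> opt_weights P e" "b \<in> opt_weights P e" using abl by (auto simp: ab)
  then have ab01: "0 \<le> a" "b \<le> 1" by (auto simp: opt_weights_def)
  have Ct: "(1 - t, t) \<in> C \<longleftrightarrow> t \<in> {a..b}" for t
    unfolding ab[symmetric] by (auto simp: C_def opt_weights_def phi_inner)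
  have pos: "sin \<alpha> + cos \<alpha> > 0" "sin \<alpha> \<ge> 0" "cos \<alpha> \<ge> 0" if "0 \<le> \<alpha>" "\<alpha> \<le> pi/2" for \<alpha> :: real
  proof -
    show s: "sin \<alpha> \<ge> 0" and c: "cos \<alpha> \<ge> 0" using that by (auto intro!: sin_ge_zero cos_ge_zero)
    have "sin \<alpha> + cos \<alpha> \<noteq> 0"
    proof
      assume "sin \<alpha> + cos \<alpha> = 0"
      then have "sin \<alpha> = 0" "cos \<alpha> = 0" using s c by linarith+
      then show False using sin_cos_squared_add[of \<alpha>] by simp
    qed
    then show "sin \<alpha> + cos \<alpha> > 0" using s c by linarith
  qed
  have Kt: "(1 - t, t) \<in> K \<alpha> \<beta> \<longleftrightarrow> t \<in> {q \<beta>..q \<alpha>}"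
    if "0 \<le> \<beta>" "\<beta> \<le> \<alpha>" "\<alpha> \<le> pi/2" for t \<alpha> \<beta>
  proof -
    note pa = pos[of \<alpha>] and pb = pos[of \<beta>]
    have 1: "t * cos \<alpha> \<le> (1 - t) * sin \<alpha> \<longleftrightarrow> t \<le> q \<alpha>"
      using pa that by (simp add: q_def field_simps)
    have 2: "t * cos \<beta> \<ge> (1 - t) * sin \<beta> \<longleftrightarrow> t \<ge> q \<beta>"
      using pb that by (simp add: q_def field_simps)
    have "0 \<le> q \<beta>" "q \<alpha> \<le> 1" using pa pb that by (auto simp: q_def)
    then show ?thesis using 1 2 by (auto simp: K_def)
  qed
  \<comment> \<open>The angle of (1 - t, t) after scaling to the unit circle.\<close>
  have angle: "\<exists>\<alpha>. 0 \<le> \<alpha> \<and> \<alpha> \<le> pi/2 \<and> (\<exists>r>0. 1 - t = r * cos \<alpha> \<and> t = r * sin \<alpha>)"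
    if "0 \<le> t" "t \<le> 1" for t :: real
  proof -
    define r where "r = sqrt ((1-t)^2 + t^2)"
    have "(1-t)^2 + t^2 \<noteq> 0" by (auto simp: sum_power2_eq_zero_iff)
    then have r: "r > 0" unfolding r_def by (simp add: order_less_le)
    have "((1-t)/r)^2 + (t/r)^2 = ((1-t)^2 + t^2) / r^2" by (simp add: power_divide add_divide_distrib)
    also have "\<dots> = 1" using r by (auto simp: r_def)
    finally have "((1-t)/r)^2 + (t/r)^2 = 1" .
    moreover have "(1-t)/r \<ge> 0" "t/r \<ge> 0" using that r by auto
    ultimately obtain \<alpha> where "0 \<le> \<alpha>" "\<alpha> \<le> pi/2" "(1-t)/r = cos \<alpha>" "t/r = sin \<alpha>"
      using sincos_total_pi_half[of "(1-t)/r" "t/r"] by metis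
    then show ?thesis using r by (intro exI[of _ \<alpha>]) (auto simp: field_simps intro!: exI[of _ r])
  qed
  obtain \<alpha> ra where al: "0 \<le> \<alpha>" "\<alpha> \<le> pi/2" "ra > 0" "1 - b = ra * cos \<alpha>" "b = ra * sin \<alpha>"
    using angle[of b] ab01 abl by auto
  obtain \<beta> rb where be: "0 \<le> \<beta>" "\<beta> \<le> pi/2" "rb > 0" "1 - a = rb * cos \<beta>" "a = rb * sin \<beta>"
    using angle[of a] ab01 abl by auto
  \<comment> \<open>The cross product of the two bounding rays equals b - a, and its sign orders the
    angles.\<close>
  have "ra * rb * sin (\<alpha> - \<beta>) = b * (1 - a) - (1 - b) * a"
    unfolding sin_diff al(4) be(4) by (simp add: al(5) be(5) algebra_simps)
  also have "\<dots> = b - a" by (simp add: algebra_simps)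
  finally have "ra * rb * sin (\<alpha> - \<beta>) \<ge> 0" using abl by simp
  moreover have "ra * rb > 0" using al(3) be(3) by simp
  ultimately have "sin (\<alpha> - \<beta>) \<ge> 0" by (simp add: zero_le_mult_iff)
  moreover have "sin (\<alpha> - \<beta>) = - sin (\<beta> - \<alpha>)" using sin_minus[of "\<beta> - \<alpha>"] by simp
  ultimately have ba: "\<beta> \<le> \<alpha>"
    using sin_gt_zero[of "\<beta> - \<alpha>"] al(1) be(2) pi_gt_zero by linarith
  have qa: "q \<alpha> = b"
  proof -
    have "ra * (sin \<alpha> + cos \<alpha>) = 1" using al by (simp add: algebra_simps)
    then have "sin \<alpha> + cos \<alpha> = 1 / ra" using al(3) by (simp add: field_simps)
    then show ?thesis using al by (simp add: q_def)
  qed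
  have qb: "q \<beta> = a"
  proof -
    have "rb * (sin \<beta> + cos \<beta>) = 1" using be by (simp add: algebra_simps)
    then have "sin \<beta> + cos \<beta> = 1 / rb" using be(3) by (simp add: field_simps)
    then show ?thesis using be by (simp add: q_def)
  qed
  \<comment> \<open>Both cones are invariant under scaling, so membership is decided on the segment
    x + y = 1; only the origin needs a separate look.\<close>
  have Cscale: "(x, y) \<in> C \<longleftrightarrow> (1 - y/(x+y), y/(x+y)) \<in> C" if "x \<ge> 0" "y \<ge> 0" "x + y > 0" for x y
  proof -
    have "1 - y/(x+y) = x / (x+y)" using that by (simp add: field_simps)
    then have *: "inner (1 - y/(x+y), y/(x+y)) z = inner (x,y) z / (x+y)" for z :: "real\<times>real"
      using that by (cases z) (simp add: add_divide_distrib)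
    show ?thesis using that unfolding C_def mem_Collect_eq * by (simp add: divide_le_cancel)
  qed
  have Kscale: "(x, y) \<in> K \<alpha> \<beta> \<longleftrightarrow> (1 - y/(x+y), y/(x+y)) \<in> K \<alpha> \<beta>" if "x \<ge> 0" "y \<ge> 0" "x + y > 0" for x y
  proof -
    have "1 - y/(x+y) = x / (x+y)" using that by (simp add: field_simps)
    then show ?thesis using that by (simp add: K_def divide_le_cancel)
  qed
  have CK: "C = K \<alpha> \<beta>"
  proof -
    have "(x, y) \<in> C \<longleftrightarrow> (x, y) \<in> K \<alpha> \<beta>" for x y
    proof (cases "x \<ge> 0 \<and> y \<ge> 0")
      case True
      show ?thesis
      proof (cases "x + y > 0")
        case pos: True
        then show ?thesis using Cscale Kscale True Ct Kt[OF be(1) ba al(2)] qa qb by simp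
      next
        case False
        then have "x = 0" "y = 0" using True by auto
        then show ?thesis by (simp add: C_def K_def inner_prod_def)
      qed
    qed (auto simp: C_def K_def)
    then show ?thesis by auto
  qed
  have "cone_measure C = b - a"
    unfolding cone_measure_def
  proof (rule the_equality)
    show "\<exists>\<alpha> \<beta>. 0 \<le> \<beta> \<and> \<beta> \<le> \<alpha> \<and> \<alpha> \<le> pi / 2 \<and>
      C = {(x, y). 0 \<le> x \<and> 0 \<le> y \<and> y * cos \<alpha> \<le> x * sin \<alpha> \<and> y * cos \<beta> \<ge> x * sin \<beta>} \<and>
      b - a = sin \<alpha> / (sin \<alpha> + cos \<alpha>) - sin \<beta> / (sin \<beta> + cos \<beta>)"
      using al(2) be(1) ba CK qa qb unfolding K_def q_def
      by (intro exI[of _ \<alpha>] exI[of _ \<beta>]) simp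
  next
    fix v
    assume "\<exists>\<alpha> \<beta>. 0 \<le> \<beta> \<and> \<beta> \<le> \<alpha> \<and> \<alpha> \<le> pi / 2 \<and>
      C = {(x, y). 0 \<le> x \<and> 0 \<le> y \<and> y * cos \<alpha> \<le> x * sin \<alpha> \<and> y * cos \<beta> \<ge> x * sin \<beta>} \<and>
      v = sin \<alpha> / (sin \<alpha> + cos \<alpha>) - sin \<beta> / (sin \<beta> + cos \<beta>)"
    then obtain \<alpha>' \<beta>' where "0 \<le> \<beta>' \<and> \<beta>' \<le> \<alpha>' \<and> \<alpha>' \<le> pi / 2 \<and>
      C = {(x, y). 0 \<le> x \<and> 0 \<le> y \<and> y * cos \<alpha>' \<le> x * sin \<alpha>' \<and> y * cos \<beta>' \<ge> x * sin \<beta>'} \<and>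
      v = sin \<alpha>' / (sin \<alpha>' + cos \<alpha>') - sin \<beta>' / (sin \<beta>' + cos \<beta>')"
      by (elim exE) (rule that)
    then have *: "0 \<le> \<beta>'" "\<beta>' \<le> \<alpha>'" "\<alpha>' \<le> pi / 2" "C = K \<alpha>' \<beta>'" "v = q \<alpha>' - q \<beta>'"
      by (simp_all add: K_def q_def)
    \<comment> \<open>The segment x + y = 1 recovers both quotients from the cone, whatever angles
      were chosen.\<close>
    have "t \<in> {a..b} \<longleftrightarrow> t \<in> {q \<beta>'..q \<alpha>'}" for t
      using Ct[of t] Kt[OF *(1-3), of t] *(4) by simp
    then have "{a..b} = {q \<beta>'..q \<alpha>'}" by (rule set_eqI)
    then show "v = b - a" using abl *(5) by (auto simp: Icc_eq_Icc)
  qed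
  then show ?thesis unfolding cone_of_opt_weights[OF fin e] C_def ab using abl by (simp add: interval_length_interval)
qed

text \<open>Separating the hull from the open quadrant above an undominated point.\<close>
lemma opt_weights_nonempty:
  assumes "finite P" "e \<in> P"
    and max: "\<not> (\<exists>z \<in> convex hull P. z \<noteq> e \<and> fst e \<le> fst z \<and> snd e \<le> snd z)"
  shows "opt_weights P e \<noteq> {}"
proof -
  define Q where "Q = {fst e<..} \<times> {snd e<..}"
  have "convex Q" unfolding Q_def by (intro convex_Times) auto
  moreover have "convex hull P \<inter> Q = {}" using max by (force simp: Q_def)
  moreover have "Q \<noteq> {}" unfolding Q_def by simp
  ultimately obtain a B where a: "a \<noteq> 0" "\<forall>x\<in>convex hull P. inner a x \<le> B" "\<forall>x\<in>Q. inner a x \<ge> B"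
    using separating_hyperplane_sets[of "convex hull P" Q] assms(2) convex_convex_hull
    by (metis convex_hull_eq_empty empty_iff)
  obtain a1 a2 where a12: "a = (a1, a2)" by (cases a)
  have Q: "B \<le> a1 * (fst e + s) + a2 * (snd e + t)" if "s > 0" "t > 0" for s t
    using a(3)[rule_format, of "(fst e + s, snd e + t)"] that by (simp add: Q_def a12)
  define k where "k = B - a1 * fst e - a2 * snd e"
  have Q': "k \<le> a1 * s + a2 * t" if "s > 0" "t > 0" for s t
    using Q[OF that] by (simp add: algebra_simps k_def)
  \<comment> \<open>The quadrant is unbounded: with a negative coefficient, a long shift in that
    direction would push the functional below \<open>k\<close>.\<close>
  have a1: "a1 \<ge> 0"
  proof (rule ccontr)
    assume "\<not> a1 \<ge> 0"
    then have "a1 * ((\<bar>k\<bar> + \<bar>a2\<bar> + 1)/(-a1)) = - (\<bar>k\<bar> + \<bar>a2\<bar> + 1)" "(\<bar>k\<bar> + \<bar>a2\<bar> + 1)/(-a1) > 0"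
      by (auto simp: field_simps intro!: divide_pos_pos)
    with Q'[of "(\<bar>k\<bar> + \<bar>a2\<bar> + 1)/(-a1)" 1] show False by simp
  qed
  have a2: "a2 \<ge> 0"
  proof (rule ccontr)
    assume "\<not> a2 \<ge> 0"
    then have "a2 * ((\<bar>k\<bar> + \<bar>a1\<bar> + 1)/(-a2)) = - (\<bar>k\<bar> + \<bar>a1\<bar> + 1)" "(\<bar>k\<bar> + \<bar>a1\<bar> + 1)/(-a2) > 0"
      by (auto simp: field_simps intro!: divide_pos_pos)
    with Q'[of 1 "(\<bar>k\<bar> + \<bar>a1\<bar> + 1)/(-a2)"] show False by simp
  qed
  have s: "a1 + a2 > 0" using a1 a2 a(1) by (auto simp: a12 zero_prod_def)
  have "k \<le> 0"
  proof (rule ccontr)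
    assume "\<not> k \<le> 0"
    then have "k/(2*(a1+a2)) > 0" using s by simp
    from Q'[OF this this] have "k \<le> (a1 + a2) * (k/(2*(a1+a2)))" by (simp only: distrib_right)
    moreover have "c * (k/(2*c)) = k/2" if "c > 0" for c :: real using that by (simp add: field_simps)
    ultimately have "k \<le> k/2" using s by (metis (no_types))
    then show False using \<open>\<not> k \<le> 0\<close> by simp
  qed
  then have e: "inner a z \<le> inner a e" if "z \<in> P" for z
    using a(2) hull_inc[OF that, of convex] by (cases e) (force simp: k_def a12)
  have *: "(1 - a2/(a1+a2), a2/(a1+a2)) = (1/(a1+a2)) *\<^sub>R a"
    using s by (simp add: a12 field_simps)
  have "a2/(a1+a2) \<in> opt_weights P e"
    using a1 a2 s e by (auto simp: opt_weights_def phi_inner * divide_right_mono)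
  then show ?thesis by blast
qed

text \<open>A hull point competing with e has to match it for two different weights, and
  \<open>phi_eq_twice\<close> then identifies the two.\<close>

lemma opt_weights_extreme:
  assumes "finite P" "e \<in> P" "interval_length (opt_weights P e) \<noteq> 0"
  shows "e extreme_point_of (convex hull P)"
    and "\<not> (\<exists>z \<in> convex hull P. z \<noteq> e \<and> fst e \<le> fst z \<and> snd e \<le> snd z)"
proof -
  obtain s t where st: "s < t" "s \<in> opt_weights P e" "t \<in> opt_weights P e" "0 < s" "t < 1"
    using opt_weights_two_points[OF assms(1,3)] .
  show "e extreme_point_of (convex hull P)"
    unfolding extreme_point_of_def
  proof (intro conjI ballI notI)
    show "e \<in> convex hull P" using assms(2) by (rule hull_inc)
  next
    fix a b assume a: "a \<in> convex hull P" and b: "b \<in> convex hull P" and "e \<in> open_segment a b"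
    then obtain u where u: "0 < u" "u < 1" "e = (1 - u) *\<^sub>R a + u *\<^sub>R b" and ne: "a \<noteq> b"
      by (auto simp: in_segment)
    have "phi r a = phi r e" if r: "r \<in> opt_weights P e" for r
    proof -
      have 1: "phi r a \<le> phi r e" "phi r b \<le> phi r e" using opt_weights_hull[OF r] a b by auto
      have 2: "phi r e = (1-u) * phi r a + u * phi r b" unfolding u(3) by (simp add: phi_def algebra_simps)
      have "(1 - u) * (phi r e - phi r a) + u * (phi r e - phi r b) = 0" using 2 by (simp add: algebra_simps)
      moreover have "u * (phi r e - phi r b) \<ge> 0" using 1 u by simp
      moreover have "(1-u) * (phi r e - phi r a) \<ge> 0" using 1 u by simp
      ultimately have "(1-u) * (phi r e - phi r a) = 0" by linarith
      then show ?thesis using u by simp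
    qed
    then have "a = e" using phi_eq_twice[of s a e t] st by simp
    with u(3) have "u *\<^sub>R a = u *\<^sub>R b" by (simp add: algebra_simps)
    then show False using u(1) ne by simp
  qed
  show "\<not> (\<exists>z \<in> convex hull P. z \<noteq> e \<and> fst e \<le> fst z \<and> snd e \<le> snd z)"
  proof
    assume "\<exists>z \<in> convex hull P. z \<noteq> e \<and> fst e \<le> fst z \<and> snd e \<le> snd z"
    then obtain z where z: "z \<in> convex hull P" "z \<noteq> e" "fst e \<le> fst z" "snd e \<le> snd z" by blast
    have "phi r z = phi r e" if r: "r \<in> opt_weights P e" for r
    proof -
      have "0 \<le> r" "r \<le> 1" using r by (auto simp: opt_weights_def)
      then have "phi r e \<le> phi r z" unfolding phi_def using z by (intro add_mono mult_left_mono) auto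
      then show ?thesis using opt_weights_hull[OF r z(1)] by simp
    qed
    then have "z = e" using phi_eq_twice[of s z e t] st by simp
    then show False using z by simp
  qed
qed

section \<open>Modular semilattices\<close>

text \<open>Meet and rank are parameters because the application has explicit ones: intersection and
  length of intervals. The lemmas below identify \<open>smeet\<close>, \<open>srank\<close> and
  \<open>cdist\<close>, which are defined from the order alone, with them. Modularity sits in the
  rank equation of \<open>join_ex\<close>.\<close>

locale modular_semilattice =
  fixes S :: "'b set" and le :: "'b \<Rightarrow> 'b \<Rightarrow> bool" and rk :: "'b \<Rightarrow> nat"
    and mt :: "'b \<Rightarrow> 'b \<Rightarrow> 'b" and bt :: 'b
  assumes refl: "x \<in> S \<Longrightarrow> le x x"
    and antisym: "\<lbrakk>x \<in> S; y \<in> S; le x y; le y x\<rbrakk> \<Longrightarrow> x = y"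
    and trans: "\<lbrakk>x \<in> S; y \<in> S; z \<in> S; le x y; le y z\<rbrakk> \<Longrightarrow> le x z"
    and mt_in: "\<lbrakk>x \<in> S; y \<in> S\<rbrakk> \<Longrightarrow> mt x y \<in> S"
    and mt_le: "\<lbrakk>x \<in> S; y \<in> S\<rbrakk> \<Longrightarrow> le (mt x y) x" "\<lbrakk>x \<in> S; y \<in> S\<rbrakk> \<Longrightarrow> le (mt x y) y"
    and mt_greatest: "\<lbrakk>x \<in> S; y \<in> S; w \<in> S; le w x; le w y\<rbrakk> \<Longrightarrow> le w (mt x y)"
    and join_ex: "\<lbrakk>x \<in> S; y \<in> S; u \<in> S; le x u; le y u\<rbrakk> \<Longrightarrow>
      \<exists>j\<in>S. le x j \<and> le y j \<and> (\<forall>w\<in>S. le x w \<longrightarrow> le y w \<longrightarrow> le j w) \<and>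
        rk j + rk (mt x y) = rk x + rk y"
    and triple: "\<lbrakk>x \<in> S; y \<in> S; z \<in> S; a \<in> S; b \<in> S; c \<in> S;
      le x a; le y a; le y b; le z b; le x c; le z c\<rbrakk> \<Longrightarrow> \<exists>u\<in>S. le x u \<and> le y u \<and> le z u"
    and rk_less: "\<lbrakk>x \<in> S; y \<in> S; le x y; x \<noteq> y\<rbrakk> \<Longrightarrow> rk x < rk y"
    and rk_step: "\<lbrakk>x \<in> S; y \<in> S; le x y; x \<noteq> y\<rbrakk> \<Longrightarrow> \<exists>z\<in>S. le x z \<and> le z y \<and> rk z = Suc (rk x)"
    and bt_in: "bt \<in> S" and bt_le: "x \<in> S \<Longrightarrow> le bt x" and rk_bt: "rk bt = 0"
begin

lemma rk_mono: "\<lbrakk>x \<in> S; y \<in> S; le x y\<rbrakk> \<Longrightarrow> rk x \<le> rk y"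
  using rk_less[of x y] by (cases "x = y") auto

lemma rk_eqD: "\<lbrakk>x \<in> S; y \<in> S; le x y; rk y \<le> rk x\<rbrakk> \<Longrightarrow> x = y"
  using rk_less[of x y] by force

lemma smeet_eq: "\<lbrakk>x \<in> S; y \<in> S\<rbrakk> \<Longrightarrow> smeet S le x y = mt x y"
  unfolding smeet_def
  by (rule the_equality) (auto intro: mt_in mt_le mt_greatest antisym)

lemma mt_commute: "\<lbrakk>x \<in> S; y \<in> S\<rbrakk> \<Longrightarrow> mt x y = mt y x"
  by (intro antisym mt_greatest mt_in mt_le)

lemma chain_ex:
  assumes "x \<in> S" "y \<in> S" "le x y" "n = rk y - rk x"
  shows "\<exists>c :: nat \<Rightarrow> 'b. c 0 = x \<and> c n = y \<and> (\<forall>i\<le>n. c i \<in> S) \<and>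
    (\<forall>i<n. le (c i) (c (Suc i)) \<and> rk (c (Suc i)) = Suc (rk (c i)))"
  using assms
proof (induction n arbitrary: x)
  case 0
  then have "x = y" using rk_eqD by simp
  then show ?case using 0 by (intro exI[of _ "\<lambda>_. x"]) auto
next
  case (Suc n)
  then obtain z where z: "z \<in> S" "le x z" "le z y" "rk z = Suc (rk x)"
    using rk_step[of x y] by fastforce
  moreover have "n = rk y - rk z" using z(4) Suc.prems(4) by simp
  ultimately obtain c where "c 0 = z" "c n = y" "\<forall>i\<le>n. c i \<in> S"
    "\<forall>i<n. le (c i) (c (Suc i)) \<and> rk (c (Suc i)) = Suc (rk (c i))"
    using Suc.IH[of z] Suc.prems(2) by blast
  then show ?case using z Suc.prems
    by (intro exI[of _ "\<lambda>i. case i of 0 \<Rightarrow> x | Suc j \<Rightarrow> c j"]) (auto split: nat.splits)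
qed

text \<open>A chain climbing from the bottom by single ranks attains the supremum, and strict growth
  of \<open>rk\<close> bounds every other chain.\<close>

lemma srank_eq:
  assumes x: "x \<in> S"
  shows "srank S le x = rk x"
  unfolding srank_def
proof (rule cSup_eq_maximum)
  obtain c :: "nat \<Rightarrow> 'b" where c: "c 0 = bt" "c (rk x) = x" "\<forall>i\<le>rk x. c i \<in> S"
    "\<forall>i<rk x. le (c i) (c (Suc i)) \<and> rk (c (Suc i)) = Suc (rk (c i))"
    using chain_ex[OF bt_in x bt_le[OF x], of "rk x"] rk_bt by auto
  then have "\<forall>i<rk x. slt le (c i) (c (Suc i))" unfolding slt_def by (metis n_not_Suc_n)
  then show "rk x \<in> {n. \<exists>c :: nat \<Rightarrow> 'b. (\<forall>i\<le>n. c i \<in> S) \<and>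
      (\<forall>i<n. slt le (c i) (c (Suc i))) \<and> c n = x}" using c by blast
next
  fix n assume "n \<in> {n. \<exists>c :: nat \<Rightarrow> 'b. (\<forall>i\<le>n. c i \<in> S) \<and>
      (\<forall>i<n. slt le (c i) (c (Suc i))) \<and> c n = x}"
  then obtain c where c: "\<forall>i\<le>n. c i \<in> S" "\<forall>i<n. slt le (c i) (c (Suc i))" "c n = x" by blast
  have "i \<le> n \<Longrightarrow> i \<le> rk (c i)" for i
  proof (induction i)
    case (Suc i)
    then have "rk (c i) < rk (c (Suc i))" using c by (intro rk_less) (auto simp: slt_def)
    then show ?case using Suc by simp
  qed simp
  then show "n \<le> rk x" using c(3) by blast
qed

lemma scover_iff: "scover S le a b \<longleftrightarrow> a \<in> S \<and> b \<in> S \<and> le a b \<and> rk b = Suc (rk a)"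
proof
  assume *: "scover S le a b"
  then have ab: "a \<in> S" "b \<in> S" "le a b" "a \<noteq> b" by (auto simp: scover_def slt_def)
  then obtain z where z: "z \<in> S" "le a z" "le z b" "rk z = Suc (rk a)" using rk_step by blast
  then have "z = b" using * by (auto simp: scover_def slt_def)
  then show "a \<in> S \<and> b \<in> S \<and> le a b \<and> rk b = Suc (rk a)" using ab z by simp
next
  assume *: "a \<in> S \<and> b \<in> S \<and> le a b \<and> rk b = Suc (rk a)"
  have False if "c \<in> S" "slt le a c" "slt le c b" for c
    using rk_less[of a c] rk_less[of c b] that * by (auto simp: slt_def)
  then show "scover S le a b" using * unfolding scover_def slt_def by auto
qed

abbreviation hasse :: "('b \<times> 'b) set" where
  "hasse \<equiv> {(a, b). scover S le a b \<or> scover S le b a}"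

lemma hasse_pow_up:
  assumes "x \<in> S" "y \<in> S" "le x y"
  shows "(x, y) \<in> hasse ^^ (rk y - rk x)" "(y, x) \<in> hasse ^^ (rk y - rk x)"
proof -
  obtain c where c: "c 0 = x" "c (rk y - rk x) = y" "\<forall>i\<le>rk y - rk x. c i \<in> S"
    "\<forall>i<rk y - rk x. le (c i) (c (Suc i)) \<and> rk (c (Suc i)) = Suc (rk (c i))"
    using chain_ex[OF assms HOL.refl] by blast
  then show "(x, y) \<in> hasse ^^ (rk y - rk x)"
    unfolding relpow_fun_conv by (intro exI[of _ c]) (auto simp: scover_iff)
  show "(y, x) \<in> hasse ^^ (rk y - rk x)"
    unfolding relpow_fun_conv
  proof (intro exI[of _ "\<lambda>i. c (rk y - rk x - i)"] conjI allI impI)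
    fix i assume "i < rk y - rk x"
    then have "rk y - rk x - i = Suc (rk y - rk x - Suc i)" by simp
    then show "(c (rk y - rk x - i), c (rk y - rk x - Suc i)) \<in> hasse"
      using c(3,4) by (auto simp: scover_iff)
  qed (use c in auto)
qed

text \<open>The two meets have their join below u and their own meet below that of p and q, and the
  modular rank identity links the four ranks. Equality leaves no slack in either comparison, so u is
  the join of its two parts; this will describe I(p, q).\<close>

lemma join_rank_le:
  assumes "p \<in> S" "q \<in> S" "u \<in> S"
  shows "rk (mt u p) + rk (mt u q) \<le> rk u + rk (mt p q)"
    and "rk (mt u p) + rk (mt u q) = rk u + rk (mt p q) \<Longrightarrow>
      le (mt p q) u \<and> (\<forall>w\<in>S. le (mt u p) w \<longrightarrow> le (mt u q) w \<longrightarrow> le u w)"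
proof -
  let ?a = "mt u p" and ?b = "mt u q"
  have S: "?a \<in> S" "?b \<in> S" "mt ?a ?b \<in> S" "mt p q \<in> S" using assms by (auto intro: mt_in)
  obtain j where j: "j \<in> S" "le ?a j" "le ?b j" "\<forall>w\<in>S. le ?a w \<longrightarrow> le ?b w \<longrightarrow> le j w"
    "rk j + rk (mt ?a ?b) = rk ?a + rk ?b"
    using join_ex[OF S(1,2) assms(3)] assms mt_le by blast
  have ju: "le j u" using j(4) assms mt_le by blast
  have "le (mt ?a ?b) p" "le (mt ?a ?b) q" "le (mt ?a ?b) u"
    using S assms mt_le by (meson trans)+
  then have m: "le (mt ?a ?b) (mt p q)" using S assms mt_greatest by blast
  have r: "rk j \<le> rk u" "rk (mt ?a ?b) \<le> rk (mt p q)"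
    using rk_mono S assms j ju m by blast+
  then show "rk ?a + rk ?b \<le> rk u + rk (mt p q)" using j(5) by linarith
  assume "rk ?a + rk ?b = rk u + rk (mt p q)"
  then have "rk u \<le> rk j" "rk (mt p q) \<le> rk (mt ?a ?b)" using r j(5) by linarith+
  then have "j = u" "mt ?a ?b = mt p q" using rk_eqD S assms j ju m by blast+
  then show "le (mt p q) u \<and> (\<forall>w\<in>S. le ?a w \<longrightarrow> le ?b w \<longrightarrow> le u w)"
    using j(4) \<open>le (mt ?a ?b) u\<close> by simp
qed

lemma rk_mt_le: "p \<in> S \<Longrightarrow> q \<in> S \<Longrightarrow> rk (mt p q) \<le> rk p \<and> rk (mt p q) \<le> rk q"
  by (auto intro!: rk_mono mt_le mt_in)

text \<open>The quantity rk p + rk q - 2 rk (mt p q) obeys the triangle inequality by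
  \<open>join_rank_le\<close>, and it is 1 on covering pairs.\<close>

lemma hasse_pow_ge:
  assumes "(p, q) \<in> hasse ^^ n" "p \<in> S"
  shows "q \<in> S \<and> rk p + rk q \<le> n + 2 * rk (mt p q)"
  using assms(1)
proof (induction n arbitrary: q)
  case 0
  then have "q = p" by simp
  moreover have "mt p p = p"
    using assms(2) by (intro antisym mt_greatest mt_in mt_le refl)
  ultimately show ?case using assms(2) by simp
next
  case (Suc n)
  then obtain u where "(p, u) \<in> hasse ^^ n" and e: "(u, q) \<in> hasse" by auto
  with Suc.IH have u: "u \<in> S" "rk p + rk u \<le> n + 2 * rk (mt p u)" by auto
  have q: "q \<in> S" using e by (auto simp: scover_iff)
  have t: "rk (mt u p) + rk (mt u q) \<le> rk u + rk (mt p q)" using join_rank_le(1) assms q u by blast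
  have c: "mt p u = mt u p" using mt_commute assms u by blast
  have "rk u + rk q \<le> 1 + 2 * rk (mt u q)"
  proof (cases "scover S le u q")
    case True
    then have "rk u \<le> rk (mt u q)" using u q by (intro rk_mono mt_in mt_greatest refl) (auto simp: scover_iff)
    then show ?thesis using True by (simp add: scover_iff)
  next
    case False
    then have *: "scover S le q u" using e by simp
    then have "rk q \<le> rk (mt u q)" using u q by (intro rk_mono mt_in mt_greatest refl) (auto simp: scover_iff)
    then show ?thesis using * by (simp add: scover_iff)
  qed
  then show ?case using t u q unfolding c by simp
qed

text \<open>A shortest path goes down to the meet and up again. The integers avoid truncated
  subtraction.\<close>

lemma cdist_eq:
  assumes "p \<in> S" "q \<in> S"
  shows "int (cdist S le p q) = int (rk p) + int (rk q) - 2 * int (rk (mt p q))"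
proof -
  define m where "m = mt p q"
  have m: "m \<in> S" "le m p" "le m q" unfolding m_def using assms by (auto intro: mt_in mt_le)
  have r: "rk m \<le> rk p" "rk m \<le> rk q" using m assms rk_mono by auto
  have "(p, q) \<in> hasse ^^ ((rk p - rk m) + (rk q - rk m))"
    using hasse_pow_up(2)[OF m(1) assms(1) m(2)] hasse_pow_up(1)[OF m(1) assms(2) m(3)]
    unfolding relpow_add by blast
  then have "cdist S le p q = (rk p - rk m) + (rk q - rk m)"
    unfolding cdist_def
  proof (rule Least_equality)
    fix n assume "(p, q) \<in> hasse ^^ n"
    then show "rk p - rk m + (rk q - rk m) \<le> n"
      using hasse_pow_ge[OF _ assms(1), of q n] r unfolding m_def by linarith
  qed
  then show ?thesis using r by (simp add: m_def)
qed

lemma cint_iff: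
  assumes "p \<in> S" "q \<in> S"
  shows "u \<in> cint S le p q \<longleftrightarrow> u \<in> S \<and> rk (mt u p) + rk (mt u q) = rk u + rk (mt p q)"
proof -
  have "cdist S le p u + cdist S le u q = cdist S le p q \<longleftrightarrow>
    rk (mt u p) + rk (mt u q) = rk u + rk (mt p q)" if "u \<in> S"
  proof -
    have "cdist S le p u + cdist S le u q = cdist S le p q \<longleftrightarrow>
      int (cdist S le p u) + int (cdist S le u q) = int (cdist S le p q)" by linarith
    also have "\<dots> \<longleftrightarrow> rk (mt u p) + rk (mt u q) = rk u + rk (mt p q)"
      using assms that mt_commute[of p u] by (simp add: cdist_eq) linarith
    finally show ?thesis .
  qed
  then show ?thesis by (auto simp: cint_def)
qed

text \<open>Since v and w meet exactly in \<open>mt p q\<close>, their join has the largest rank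
  that \<open>join_rank_le\<close> permits, which leaves no room for its parts to exceed v and
  w.\<close>

lemma cint_join:
  assumes "p \<in> S" "q \<in> S" "v \<in> S" "w \<in> S" "le (mt p q) v" "le v p" "le (mt p q) w" "le w q"
    and ub: "x \<in> S" "le v x" "le w x"
  obtains u where "u \<in> cint S le p q" "mt u p = v" "mt u q = w"
proof -
  let ?m = "mt p q"
  have m: "?m \<in> S" using assms mt_in by blast
  obtain u where u: "u \<in> S" "le v u" "le w u" "rk u + rk (mt v w) = rk v + rk w"
    using join_ex[OF assms(3,4) ub] by blast
  have S: "mt v w \<in> S" "mt u p \<in> S" "mt u q \<in> S" using assms u mt_in by blast+
  have "le (mt v w) p" "le (mt v w) q" using assms S mt_le by (meson trans)+
  then have "rk (mt v w) \<le> rk ?m" using S m assms mt_greatest rk_mono by blast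
  moreover have "rk ?m \<le> rk (mt v w)" using S m assms mt_greatest rk_mono by blast
  ultimately have r: "rk u + rk ?m = rk v + rk w" using u(4) by simp
  have v: "le v (mt u p)" and w: "le w (mt u q)" using assms u mt_greatest by blast+
  have rr: "rk v \<le> rk (mt u p)" "rk w \<le> rk (mt u q)" using v w S assms rk_mono by blast+
  have "rk (mt u p) + rk (mt u q) \<le> rk u + rk ?m" using join_rank_le(1) assms u by blast
  then have e: "rk v = rk (mt u p)" "rk w = rk (mt u q)" using rr r by linarith+
  then have "mt u p = v" "mt u q = w" using rk_eqD v w S assms by (metis order_refl)+
  moreover have "u \<in> cint S le p q" using cint_iff[OF assms(1,2)] u r e by simp
  ultimately show ?thesis using that by blast
qed

text \<open>The upper bound required by \<open>cint_join\<close> comes from the triple condition: u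
  bounds the meet of v, v' together with w, u' bounds that meet together with w', and q bounds w and
  w'.\<close>

lemma cint_exchange:
  assumes p: "p \<in> S" and q: "q \<in> S" and v: "v \<in> S" and w: "w \<in> S" and v': "v' \<in> S" and w': "w' \<in> S"
    and le: "le v p" "le v' p" "le w q" "le w' q"
      "le (mt p q) v" "le (mt p q) w" "le (mt p q) v'" "le (mt p q) w'"
    and u: "u \<in> S" and u': "u' \<in> S" and ub: "le v u" "le w u" "le v' u'" "le w' u'"
  shows "\<exists>j\<in>cint S le p q. \<exists>jw\<in>S. mt j p = mt v v' \<and> mt j q = jw \<and> le w jw \<and> le w' jw \<and>
      rk jw + rk (mt w w') = rk w + rk w'"
proof -
  have mS: "mt v v' \<in> S" "mt p q \<in> S" using v v' p q by (auto intro: mt_in)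
  have ml: "le (mt v v') v" "le (mt v v') v'" using v v' by (auto intro: mt_le)
  have mu: "le (mt v v') u" "le (mt v v') u'" "le (mt v v') p"
    using trans[OF mS(1) v u ml(1) ub(1)] trans[OF mS(1) v' u' ml(2) ub(3)] trans[OF mS(1) v p ml(1) le(1)] by auto
  obtain x where x: "x \<in> S" "le (mt v v') x" "le w x" "le w' x"
    using triple[OF mS(1) w w' u q u' mu(1) ub(2) le(3,4) mu(2) ub(4)] by auto
  obtain jw where jw: "jw \<in> S" "le w jw" "le w' jw" "\<forall>z\<in>S. le w z \<longrightarrow> le w' z \<longrightarrow> le jw z"
    "rk jw + rk (mt w w') = rk w + rk w'" using join_ex[OF w w' q le(3,4)] by auto
  have "le jw q" "le jw x" using jw(4) x le q by auto
  moreover have "le (mt p q) jw" using trans[OF mS(2) w jw(1) le(6) jw(2)] .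
  moreover have "le (mt p q) (mt v v')" using mt_greatest[OF v v' mS(2) le(5,7)] .
  ultimately obtain j where "j \<in> cint S le p q" "mt j p = mt v v'" "mt j q = jw"
    using cint_join[OF p q mS(1) jw(1)] mu(3) x(1,2) by metis
  then show ?thesis using jw by blast
qed

section \<open>Vectors, support and coefficients of a fixed pair p, q\<close>

context
  fixes p q assumes p: "p \<in> S" and q: "q \<in> S"
begin

lemma mt_pq: "mt p q \<in> S" "le (mt p q) p" "le (mt p q) q" "mt p p = p" "mt q q = q" "mt q p = mt p q"
  using p q mt_in mt_le mt_commute by (auto intro!: antisym[of "mt _ _"] mt_greatest refl)

lemma cintD:
  assumes "u \<in> cint S le p q"
  shows "u \<in> S" "le (mt p q) u" "rk (mt u p) + rk (mt u q) = rk u + rk (mt p q)"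
    "w \<in> S \<Longrightarrow> le (mt u p) w \<Longrightarrow> le (mt u q) w \<Longrightarrow> le u w"
proof -
  show u: "u \<in> S" and r: "rk (mt u p) + rk (mt u q) = rk u + rk (mt p q)"
    using assms cint_iff[OF p q] by auto
  show "le (mt p q) u" "w \<in> S \<Longrightarrow> le (mt u p) w \<Longrightarrow> le (mt u q) w \<Longrightarrow> le u w"
    using join_rank_le(2)[OF p q u r] by auto
qed

lemma ends_in_cint: "p \<in> cint S le p q" "q \<in> cint S le p q"
  using cint_iff[OF p q] p q mt_pq by auto

abbreviation rv :: "'b \<Rightarrow> real \<times> real" where "rv u \<equiv> rvec S le u p q"

abbreviation pts :: "(real \<times> real) set" where "pts \<equiv> rv ` cint S le p q"

lemma rv_eq: "u \<in> S \<Longrightarrow> rv u = (real (rk (mt u p)) - real (rk (mt p q)), real (rk (mt u q)) - real (rk (mt p q)))"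
  unfolding rvec_def using p q by (simp add: smeet_eq srank_eq mt_in)

text \<open>I(p, q) may be infinite, but its vectors are integral and confined to a box given by the
  ranks of p and q.\<close>

lemma finite_pts: "finite pts"
proof (rule finite_subset)
  show "pts \<subseteq> (\<lambda>(i, j). (real i - real (rk (mt p q)), real j - real (rk (mt p q)))) ` ({..rk p} \<times> {..rk q})"
  proof
    fix e assume "e \<in> pts"
    then obtain u where "u \<in> S" "e = rv u" using cintD by blast
    moreover then have "rk (mt u p) \<le> rk p" "rk (mt u q) \<le> rk q" using rk_mt_le p q by blast+
    ultimately show "e \<in> (\<lambda>(i, j). (real i - real (rk (mt p q)), real j - real (rk (mt p q)))) ` ({..rk p} \<times> {..rk q})"
      by (intro image_eqI[of _ _ "(rk (mt u p), rk (mt u q))"]) (auto simp: rv_eq)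
  qed
qed auto

lemma pts_ne: "pts \<noteq> {}" using ends_in_cint by blast

text \<open>If two elements share an extreme vector, exchanging meets and joins of their components
  yields two elements whose vectors average to it; by extremality these coincide with it.\<close>
lemma rv_inj:
  assumes u: "u \<in> cint S le p q" and u': "u' \<in> cint S le p q" and e: "rv u = rv u'"
    and pos: "interval_length (opt_weights pts (rv u)) \<noteq> 0"
  shows "u = u'"
proof -
  define v w v' w' where vw: "v = mt u p" "w = mt u q" "v' = mt u' p" "w' = mt u' q"
  note uS = cintD(1)[OF u] and u'S = cintD(1)[OF u']
  have S: "v \<in> S" "w \<in> S" "v' \<in> S" "w' \<in> S" using uS u'S p q by (auto simp: vw intro: mt_in)
  have le: "le v p" "le w q" "le v' p" "le w' q" "le v u" "le w u" "le v' u'" "le w' u'"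
    using uS u'S p q by (auto simp: vw intro: mt_le)
  have m: "le (mt p q) v" "le (mt p q) w" "le (mt p q) v'" "le (mt p q) w'"
    unfolding vw using uS u'S p q mt_pq cintD(2)[OF u] cintD(2)[OF u'] by (auto intro: mt_greatest)
  have rr: "rk v = rk v'" "rk w = rk w'" using e rv_eq[OF uS] rv_eq[OF u'S] by (auto simp: vw)
  obtain j1 jw where j1: "j1 \<in> cint S le p q" "mt j1 p = mt v v'" "mt j1 q = jw" "le w jw" "le w' jw" "jw \<in> S"
    "rk jw + rk (mt w w') = rk w + rk w'"
    using cint_exchange[OF p q S(1,2,3,4) le(1,3,2,4) m uS u'S le(5-8)] by blast
  have mpq: "le (mt q p) v" "le (mt q p) w" "le (mt q p) v'" "le (mt q p) w'"
    using m mt_pq(6) by auto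
  \<comment> \<open>The same exchange with p and q swapped: \<open>j1\<close> takes the meet of the
    p-parts and the join of the q-parts, \<open>j2\<close> the reverse.\<close>
  obtain j2 jv where j2: "j2 \<in> cint S le q p" "mt j2 q = mt w w'" "mt j2 p = jv" "le v jv" "le v' jv" "jv \<in> S"
    "rk jv + rk (mt v v') = rk v + rk v'"
    using cint_exchange[OF q p S(2,1,4,3) le(2,4,1,3) mpq(2,1,4,3) uS u'S le(6,5,8,7)] by blast
  have j2': "j2 \<in> cint S le p q"
    using j2(1) cint_iff[OF p q] cint_iff[OF q p] mt_pq(6) by (simp add: add.commute)
  have sum: "phi t (rv j1) + phi t (rv j2) = 2 * phi t (rv u)" for t
  proof -
    have "real (rk jw) + real (rk (mt w w')) = 2 * real (rk w)" using j1(7) rr by linarith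
    moreover have "real (rk jv) + real (rk (mt v v')) = 2 * real (rk v)" using j2(7) rr by linarith
    ultimately have "rv j1 + rv j2 = 2 *\<^sub>R rv u"
      using cintD(1)[OF j1(1)] cintD(1)[OF j2'] uS j1 j2 by (simp add: rv_eq vw)
    moreover have "phi t (rv j1) + phi t (rv j2) = phi t (rv j1 + rv j2)"
      by (simp add: phi_def algebra_simps)
    moreover have "phi t (2 *\<^sub>R rv u) = 2 * phi t (rv u)" by (simp add: phi_def algebra_simps)
    ultimately show ?thesis by simp
  qed
  have "phi t (rv j1) = phi t (rv u)" if "t \<in> opt_weights pts (rv u)" for t
  proof -
    have "phi t (rv j1) \<le> phi t (rv u)" "phi t (rv j2) \<le> phi t (rv u)"
      using that j1(1) j2' by (auto simp: opt_weights_def)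
    then show ?thesis using sum[of t] by linarith
  qed
  then have "rv j1 = rv u"
    using opt_weights_two_points[OF finite_pts pos] phi_eq_twice by (metis less_irrefl)
  then have "rk (mt v v') = rk v" "rk jw = rk w"
    using rv_eq[OF uS] rv_eq[OF cintD(1)[OF j1(1)]] j1 by (auto simp: vw)
  then have "mt v v' = v" "mt v v' = v'" "w = jw" "w' = jw"
    using rr S j1 by (auto intro!: rk_eqD mt_in mt_le)
  then have "v = v'" "w = w'" by auto
  then have "le u u'" "le u' u"
    using cintD(4)[OF u u'S] cintD(4)[OF u' uS] le by (auto simp: vw)
  then show ?thesis using antisym uS u'S by blast
qed

lemma cone_measure_rv:
  assumes "u \<in> cint S le p q" "opt_weights pts (rv u) \<noteq> {}"
  shows "cone_measure (Ccone S le u p q) = interval_length (opt_weights pts (rv u))"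
  unfolding Ccone_def convI_def using assms by (intro cone_measure_eq finite_pts) auto

definition support :: "'b set" where
  "support = {u \<in> Eset S le p q. cone_measure (Ccone S le u p q) \<noteq> 0}"

lemma support_eq: "support = {u \<in> cint S le p q. interval_length (opt_weights pts (rv u)) \<noteq> 0}"
proof (intro set_eqI iffI)
  fix u assume "u \<in> support"
  then have u: "u \<in> cint S le p q" "cone_measure (Ccone S le u p q) \<noteq> 0"
    "\<not> (\<exists>z \<in> convex hull pts. z \<noteq> rv u \<and> fst (rv u) \<le> fst z \<and> snd (rv u) \<le> snd z)"
    by (auto simp: support_def Eset_def convI_def)
  \<comment> \<open>Without an optimal weight the cone would be {0}, which no pair of angles
    describes, and \<open>cone_measure\<close> would be undetermined. Maximality rules this
    out.\<close>
  have "opt_weights pts (rv u) \<noteq> {}" using opt_weights_nonempty[OF finite_pts _ u(3)] u(1) by blast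
  then show "u \<in> {u \<in> cint S le p q. interval_length (opt_weights pts (rv u)) \<noteq> 0}"
    using cone_measure_rv u by simp
next
  fix u assume "u \<in> {u \<in> cint S le p q. interval_length (opt_weights pts (rv u)) \<noteq> 0}"
  then have u: "u \<in> cint S le p q" "rv u \<in> pts" "interval_length (opt_weights pts (rv u)) \<noteq> 0" by auto
  have "opt_weights pts (rv u) \<noteq> {}" using u by (auto simp: interval_length_def)
  then show "u \<in> support"
    using u opt_weights_extreme[OF finite_pts u(2,3)] cone_measure_rv[OF u(1)]
    by (simp add: support_def Eset_def convI_def)
qed

lemma support_coeff:
  assumes "u \<in> support"
  shows "u \<in> cint S le p q" "cone_measure (Ccone S le u p q) = interval_length (opt_weights pts (rv u))"
    "cone_measure (Ccone S le u p q) > 0"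
proof -
  show u: "u \<in> cint S le p q" using assms by (simp add: support_eq)
  show e: "cone_measure (Ccone S le u p q) = interval_length (opt_weights pts (rv u))"
    using assms by (intro cone_measure_rv u) (auto simp: support_eq interval_length_def)
  show "cone_measure (Ccone S le u p q) > 0"
    using assms interval_length_opt_weights_nonneg[OF finite_pts, of "rv u"] unfolding e
    by (simp add: support_eq less_le)
qed

lemma support_inj: "inj_on rv support"
  by (intro inj_onI rv_inj) (auto simp: support_eq)

text \<open>The semilattice may be infinite, and a sum over an infinite index set would be 0 by
  convention; injectivity bounds the support by the finite set \<open>pts\<close>.\<close>

lemma finite_support: "finite support"
  by (rule inj_on_finite[OF support_inj _ finite_pts]) (auto simp: support_eq)

text \<open>Lengths are summed over vectors, coefficients over elements. \<open>support_inj\<close>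
  matches the two, and the remaining vectors have length 0.\<close>

lemma support_sum: "(\<Sum>u\<in>support. cone_measure (Ccone S le u p q)) = 1"
proof -
  have "(\<Sum>u\<in>support. cone_measure (Ccone S le u p q)) = (\<Sum>u\<in>support. interval_length (opt_weights pts (rv u)))"
    using support_coeff by (intro sum.cong) auto
  also have "\<dots> = (\<Sum>e\<in>rv ` support. interval_length (opt_weights pts e))"
    by (simp add: sum.reindex[OF support_inj])
  also have "\<dots> = (\<Sum>e\<in>pts. interval_length (opt_weights pts e))"
    by (rule sum.mono_neutral_left[OF finite_pts]) (auto simp: support_eq)
  also have "\<dots> = 1" by (rule sum_interval_length_opt_weights[OF finite_pts pts_ne])
  finally show ?thesis .
qed

text \<open>For the weight t = 0 only the part along p counts, and p itself attains its maximum; an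
  optimal u therefore has all of p as its part. \<open>opt_weights_exists_long\<close> finds such a
  u with positive coefficient. The weight t = 1 does the same for q.\<close>

lemma support_above: "\<exists>u\<in>support. le p u" "\<exists>u\<in>support. le q u"
proof -
  obtain u where u: "u \<in> support" "0 \<in> opt_weights pts (rv u)"
    using opt_weights_exists_long[OF finite_pts pts_ne, of 0] by (force simp: support_eq)
  have "phi 0 (rv p) \<le> phi 0 (rv u)" using u(2) ends_in_cint by (auto simp: opt_weights_def)
  moreover have uS: "u \<in> S" using support_coeff(1) u cintD by blast
  ultimately have "rk p \<le> rk (mt u p)" using p mt_pq by (simp add: phi_def rv_eq)
  then have "mt u p = p" using uS p rk_eqD mt_in mt_le by simp
  then show "\<exists>u\<in>support. le p u" using u mt_le uS p by metis
next
  obtain u where u: "u \<in> support" "1 \<in> opt_weights pts (rv u)"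
    using opt_weights_exists_long[OF finite_pts pts_ne, of 1] by (force simp: support_eq)
  have "phi 1 (rv q) \<le> phi 1 (rv u)" using u(2) ends_in_cint by (auto simp: opt_weights_def)
  moreover have uS: "u \<in> S" using support_coeff(1) u cintD by blast
  ultimately have "rk q \<le> rk (mt u q)" using q mt_pq by (simp add: phi_def rv_eq)
  then have "mt u q = q" using uS q rk_eqD mt_in mt_le by simp
  then show "\<exists>u\<in>support. le q u" using u mt_le uS q by metis
qed

end

end

section \<open>Metric and order of an oriented modular graph\<close>

locale oriented_modular =
  fixes V :: "'a set" and E Or :: "'a \<Rightarrow> 'a \<Rightarrow> bool"
  assumes oriented_modular: "oriented_modular_graph V E Or"
begin

abbreviation d :: "'a \<Rightarrow> 'a \<Rightarrow> nat" where "d \<equiv> gdist E"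
abbreviation prec :: "'a \<Rightarrow> 'a \<Rightarrow> bool" (infix "\<preceq>" 50) where "x \<preceq> y \<equiv> opreceq Or x y"
abbreviation sqprec :: "'a \<Rightarrow> 'a \<Rightarrow> bool" (infix "\<sqsubseteq>" 50) where "x \<sqsubseteq> y \<equiv> osqsub Or x y"

lemma graph: "graph V E" and orientation: "orientation E Or"
  using oriented_modular by (simp_all add: oriented_modular_graph_def modular_graph_def admissible_def)

lemma E_V: "E x y \<Longrightarrow> x \<in> V" "E x y \<Longrightarrow> y \<in> V"
  and E_irrefl: "\<not> E x x" and E_sym: "E x y \<Longrightarrow> E y x"
  and connected_V: "x \<in> V \<Longrightarrow> y \<in> V \<Longrightarrow> (x, y) \<in> (edges E)\<^sup>*"
  using graph by (auto simp: graph_def)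

lemma Or_E: "Or x y \<Longrightarrow> E x y" and Or_total: "E x y \<Longrightarrow> Or x y \<or> Or y x"
  and Or_asym: "Or x y \<Longrightarrow> \<not> Or y x"
  using orientation by (auto simp: orientation_def)

lemma square:
  assumes "E a b" "E b c" "E c e" "E e a" "a \<noteq> c" "b \<noteq> e" "Or a b"
  shows "Or e c"
proof -
  have "distinct [a, b, c, e]" using assms E_irrefl by auto
  then have "four_cycle E a b c e" using assms by (simp add: four_cycle_def)
  then show ?thesis
    using oriented_modular assms unfolding oriented_modular_graph_def admissible_def by blast
qed

lemma d_path: "x \<in> V \<Longrightarrow> y \<in> V \<Longrightarrow> (x, y) \<in> edges E ^^ d x y"
  unfolding gdist_def using rtrancl_imp_relpow[OF connected_V] by (rule LeastI_ex)

lemma d_le: "(x, y) \<in> edges E ^^ n \<Longrightarrow> d x y \<le> n"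
  unfolding gdist_def by (rule Least_le)

lemma edges_pow_sym: "(x, y) \<in> edges E ^^ n \<Longrightarrow> (y, x) \<in> edges E ^^ n"
proof (induction n arbitrary: y)
  case (Suc n)
  then obtain z where "(x, z) \<in> edges E ^^ n" "E z y" by (auto simp: edges_def)
  moreover then have "(y, z) \<in> edges E" using E_sym by (simp add: edges_def)
  ultimately show ?case using Suc.IH relpow_Suc_I2[of y z "edges E" x n] by blast
qed simp

lemma d_comm: "d x y = d y x"
proof -
  have "(x, y) \<in> edges E ^^ n \<longleftrightarrow> (y, x) \<in> edges E ^^ n" for n using edges_pow_sym by blast
  then show ?thesis unfolding gdist_def by simp
qed

lemma d_tri: "x \<in> V \<Longrightarrow> y \<in> V \<Longrightarrow> z \<in> V \<Longrightarrow> d x z \<le> d x y + d y z"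
  by (intro d_le) (auto simp: relpow_add intro: d_path)

lemma d_self [simp]: "d x x = 0"
  using d_le[of x x 0] by simp

lemma d_zero: "x \<in> V \<Longrightarrow> y \<in> V \<Longrightarrow> d x y = 0 \<longleftrightarrow> x = y"
  using d_path[of x y] by auto

lemma d_step:
  assumes "x \<in> V" "y \<in> V" "d x y = Suc n"
  obtains z where "E x z" "d z y = n" "z \<in> V"
proof -
  have "(x, y) \<in> edges E ^^ Suc n" using d_path[OF assms(1,2)] assms(3) by simp
  then obtain z where z: "E x z" "(z, y) \<in> edges E ^^ n"
    using relpow_Suc_D2[of x y n "edges E"] by (auto simp: edges_def)
  have "d x y \<le> d x z + d z y" using d_tri assms E_V z by blast
  moreover have "d x z \<le> 1" using z by (intro d_le) (auto simp: edges_def)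
  moreover have "d z y \<le> n" using z d_le by blast
  ultimately have "d z y = n" using assms(3) by simp
  then show ?thesis using that z E_V by blast
qed

lemma d_edge: "E x y \<Longrightarrow> d x y = 1"
proof -
  assume e: "E x y"
  have "d x y \<le> 1" using e by (intro d_le) (auto simp: edges_def)
  moreover have "d x y \<noteq> 0" using d_zero e E_V E_irrefl by metis
  ultimately show ?thesis by simp
qed

lemma d_one: "x \<in> V \<Longrightarrow> y \<in> V \<Longrightarrow> d x y = 1 \<Longrightarrow> E x y"
  using d_step[of x y 0] d_zero by (metis One_nat_def)

lemma median:
  assumes "x \<in> V" "y \<in> V" "z \<in> V"
  obtains m where "m \<in> V" "d x m + d m y = d x y" "d y m + d m z = d y z" "d x m + d m z = d x z"
proof -
  have "gint V E x y \<inter> gint V E y z \<inter> gint V E z x \<noteq> {}"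
    using oriented_modular assms unfolding oriented_modular_graph_def modular_graph_def by blast
  then obtain m where "m \<in> V" "d x m + d m y = d x y" "d y m + d m z = d y z" "d z m + d m x = d z x"
    unfolding gint_def by blast
  then show ?thesis using that by (simp add: d_comm add.commute)
qed

text \<open>The median of an edge and a third vertex is one of the two ends, so a modular graph is
  bipartite.\<close>

lemma edge_dist:
  assumes "E x y" "z \<in> V"
  shows "d x z = Suc (d y z) \<or> d y z = Suc (d x z)"
proof -
  have V: "x \<in> V" "y \<in> V" using assms E_V by auto
  obtain m where m: "m \<in> V" "d x m + d m y = d x y" "d y m + d m z = d y z" "d x m + d m z = d x z"
    using median[OF V assms(2)] .
  have xy: "d x y = 1" using d_edge assms by simp
  then have "d x m = 0 \<or> d m y = 0" using m(2) by linarith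
  then have "m = x \<or> m = y" using d_zero m(1) V by auto
  then show ?thesis using m(3,4) xy d_comm[of x y] by auto
qed

text \<open>The common neighbour is the median of x, y, z; x and y are at distance two because an
  edge between them would contradict \<open>edge_dist\<close>.\<close>

lemma quadrangle:
  assumes "E w x" "E w y" "x \<noteq> y" "z \<in> V" "d w z = Suc n" "d x z = n" "d y z = n"
  obtains u where "E x u" "E y u" "Suc (d u z) = n" "u \<in> V"
proof -
  have V: "w \<in> V" "x \<in> V" "y \<in> V" using assms E_V by auto
  have "d x y \<noteq> 1" using edge_dist[OF d_one[OF V(2,3)] assms(4)] assms(6,7) by auto
  moreover have "d x y \<noteq> 0" using d_zero V assms(3) by simp
  moreover have "d x y \<le> 2" using d_tri[OF V(2,1,3)] d_edge[OF assms(1)] d_edge[OF assms(2)] d_comm[of x w] by simp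
  ultimately have xy: "d x y = 2" by linarith
  obtain u where u: "u \<in> V" "d x u + d u y = d x y" "d y u + d u z = d y z" "d x u + d u z = d x z"
    using median[OF V(2,3) assms(4)] .
  then have "d x u = d y u" using assms(6,7) by linarith
  then have 1: "d x u = 1" "d y u = 1" using u(2) xy d_comm[of u y] by linarith+
  then show ?thesis using that[of u] d_one[OF V(2) u(1)] d_one[OF V(3) u(1)] u assms(6) by simp
qed

section \<open>Directed paths as geodesics\<close>

lemma Or_pow_E: "(x, y) \<in> edges Or ^^ n \<Longrightarrow> (x, y) \<in> edges E ^^ n"
  by (induction n arbitrary: y) (auto simp: edges_def dest: Or_E)

text \<open>Let the given path leave q through v. The quadrangle condition gives a common neighbour
  t of v and u nearer to p; by induction v points to t, and the 4-cycle q, v, t, u transfers the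
  orientations to the path through u.\<close>

lemma dir_neighbour:
  assumes "(q, p) \<in> edges Or ^^ n" "q \<in> V" "p \<in> V" "d q p = n" "E q u" "Suc (d u p) = n"
  shows "Or q u \<and> (u, p) \<in> edges Or ^^ (n - 1)"
  using assms
proof (induction n arbitrary: q u)
  case (Suc k)
  obtain v where v: "Or q v" "(v, p) \<in> edges Or ^^ k"
    using relpow_Suc_D2[OF Suc.prems(1)] by (auto simp: edges_def)
  have Eqv: "E q v" and vV: "v \<in> V" using v Or_E E_V by blast+
  have dv: "d v p = k" using edge_dist[OF Eqv Suc.prems(3)] Suc.prems(4) d_le[OF Or_pow_E[OF v(2)]] by simp
  show ?case
  proof (cases "v = u")
    case True then show ?thesis using v by simp
  next
    case False
    have du: "d u p = k" using Suc.prems(6) by simp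
    obtain t where t: "E v t" "E u t" "Suc (d t p) = k" "t \<in> V"
      using quadrangle[OF Eqv Suc.prems(5) False Suc.prems(3,4) dv du] .
    have IH: "Or v t" "(t, p) \<in> edges Or ^^ (k - 1)"
      using Suc.IH[OF v(2) vV Suc.prems(3) dv t(1,3)] by auto
    have "q \<noteq> t" using Suc.prems(4) t(3) by auto
    have "Or u t" using square[OF Eqv t(1) E_sym[OF t(2)] E_sym[OF Suc.prems(5)] \<open>q \<noteq> t\<close> False v(1)] .
    moreover have "Or q u"
      using square[OF t(1) E_sym[OF t(2)] E_sym[OF Suc.prems(5)] Eqv False _ IH(1)] \<open>q \<noteq> t\<close> by metis
    moreover have "(u, p) \<in> edges Or ^^ Suc (k - 1)"
      using \<open>Or u t\<close> IH(2) by (intro relpow_Suc_I2) (auto simp: edges_def)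
    ultimately show ?thesis using t(3) by auto
  qed
qed simp

text \<open>If q were nearer to p than its successor v, \<open>dir_neighbour\<close> at v would
  orient the edge from v to q, against \<open>Or q v\<close>. So every directed step counts.\<close>

lemma dir_dist: "(q, p) \<in> edges Or ^^ n \<Longrightarrow> q \<in> V \<Longrightarrow> p \<in> V \<and> d q p = n"
proof (induction n arbitrary: q)
  case (Suc k)
  obtain v where v: "Or q v" "(v, p) \<in> edges Or ^^ k"
    using relpow_Suc_D2[OF Suc.prems(1)] by (auto simp: edges_def)
  have Eqv: "E q v" and vV: "v \<in> V" using v Or_E E_V by blast+
  have IH: "p \<in> V" "d v p = k" using Suc.IH[OF v(2) vV] by auto
  have "Suc (d q p) \<noteq> k"
    using dir_neighbour[OF v(2) vV IH E_sym[OF Eqv]] Or_asym v by blast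
  then show ?case using edge_dist[OF Eqv IH(1)] IH by auto
qed simp

lemma prec_path: "p \<preceq> q \<Longrightarrow> q \<in> V \<Longrightarrow> (q, p) \<in> edges Or ^^ d p q"
proof -
  assume "p \<preceq> q" "q \<in> V"
  then obtain n where n: "(q, p) \<in> edges Or ^^ n" unfolding opreceq_def using rtrancl_imp_relpow by blast
  then show ?thesis using dir_dist[OF n \<open>q \<in> V\<close>] d_comm[of p q] by simp
qed

lemma prec_refl [simp]: "p \<preceq> p" by (simp add: opreceq_def)

lemma prec_trans: "p \<preceq> q \<Longrightarrow> q \<preceq> r \<Longrightarrow> p \<preceq> r" unfolding opreceq_def by simp

lemma Or_prec: "Or q p \<Longrightarrow> p \<preceq> q" by (auto simp: opreceq_def edges_def)

lemma prec_V: "p \<preceq> q \<Longrightarrow> q \<in> V \<Longrightarrow> p \<in> V"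
proof -
  assume "p \<preceq> q" "q \<in> V"
  then obtain n where n: "(q, p) \<in> edges Or ^^ n" unfolding opreceq_def using rtrancl_imp_relpow by blast
  then show ?thesis using dir_dist[OF n \<open>q \<in> V\<close>] by simp
qed

lemma prec_V': "p \<preceq> q \<Longrightarrow> p \<in> V \<Longrightarrow> q \<in> V"
  unfolding opreceq_def by (erule converse_rtranclE) (auto simp: edges_def dest: Or_E E_V)

lemma prec_add:
  assumes "p \<preceq> z" "z \<preceq> q" "q \<in> V"
  shows "d p z + d z q = d p q"
proof -
  have z: "z \<in> V" using prec_V assms by blast
  have "(q, p) \<in> edges Or ^^ (d z q + d p z)"
    unfolding relpow_add using prec_path[OF assms(2,3)] prec_path[OF assms(1) z] by blast
  then show ?thesis using dir_dist assms(3) d_comm by (metis add.commute)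
qed

lemma prec_antisym: "p \<preceq> q \<Longrightarrow> q \<preceq> p \<Longrightarrow> p \<in> V \<Longrightarrow> p = q"
  using prec_add[of p q p] prec_V[of q p] d_zero[of p q] by simp

text \<open>By \<open>dir_neighbour\<close> the first step from q on any geodesic towards p is
  directed; iterating reaches z.\<close>

lemma prec_interval:
  assumes "p \<preceq> q" "q \<in> V" "z \<in> V" "d p z + d z q = d p q"
  shows "p \<preceq> z \<and> z \<preceq> q"
  using assms
proof (induction "d q z" arbitrary: q)
  case 0
  then have "q = z" using d_zero by simp
  then show ?case using 0 by simp
next
  case (Suc n)
  have p: "p \<in> V" using Suc.prems prec_V by blast
  obtain u where u: "E q u" "d u z = n" "u \<in> V" using d_step[OF Suc.prems(2,3) Suc.hyps(2)[symmetric]] .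
  have "d u p \<le> d u z + d z p" using d_tri u p Suc.prems by blast
  then have "Suc (d u p) \<le> d q p" using Suc.prems(4) Suc.hyps(2) u(2) d_comm by (metis add.commute add_Suc not_less_eq_eq)
  then have du: "Suc (d u p) = d q p" using edge_dist[OF u(1) p] by auto
  have *: "Or q u \<and> (u, p) \<in> edges Or ^^ (d q p - 1)"
    using dir_neighbour[OF _ Suc.prems(2) p HOL.refl u(1) du] prec_path[OF Suc.prems(1,2)] d_comm[of p q] by simp
  then have pu: "p \<preceq> u" unfolding opreceq_def using relpow_imp_rtrancl by blast
  have "d p z + d z u = d p u"
    using Suc.prems(4) Suc.hyps(2) du u(2) d_comm[of z q] d_comm[of z u] d_comm[of p u] d_comm[of p q] by linarith
  then have "p \<preceq> z \<and> z \<preceq> u" using Suc.hyps(1)[OF _ pu u(3) Suc.prems(3)] u(2) by simp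
  then show ?case using * Or_prec prec_trans by blast
qed

lemma prec_one: "p \<preceq> q \<Longrightarrow> q \<in> V \<Longrightarrow> d p q = 1 \<Longrightarrow> Or q p"
  using prec_path[of p q] by (simp add: edges_def)

lemma prec_d_eq: "p \<preceq> q \<Longrightarrow> q \<in> V \<Longrightarrow> d p q = 0 \<longleftrightarrow> p = q"
  using d_zero[of p q] prec_V[of p q] by simp

lemma prec_step:
  assumes "p \<preceq> q" "q \<in> V" "p \<noteq> q"
  obtains a where "Or a p" "a \<preceq> q" "a \<in> V" "Suc (d a q) = d p q"
proof -
  have p: "p \<in> V" using assms prec_V by blast
  then obtain n where n: "d p q = Suc n" using assms prec_d_eq by (metis not0_implies_Suc)
  obtain a where a: "E p a" "d a q = n" "a \<in> V" using d_step[OF p assms(2) n] .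
  then have "p \<preceq> a \<and> a \<preceq> q" using prec_interval[OF assms(1,2) a(3)] a(2) n d_edge[OF a(1)] by linarith
  then show ?thesis using that[of a] prec_one[of p a] d_edge[OF a(1)] a n by simp
qed

text \<open>The quadrangle condition supplies the next rung of a ladder of 4-cycles between the two
  facing edges, and admissibility carries the orientation across each cell.\<close>

lemma ladder:
  assumes "E z s" "E m r" "d z m = b" "d s r = b" "d z r = Suc b" "d s m = Suc b" "Or z s"
  shows "Or m r"
  using assms
proof (induction b arbitrary: z s)
  case 0
  then have "z = m" "s = r" using d_zero E_V by blast+
  then show ?case using 0 by simp
next
  case (Suc b)
  have V: "z \<in> V" "s \<in> V" "m \<in> V" "r \<in> V" using Suc.prems E_V by blast+
  obtain z1 where z1: "E z z1" "d z1 m = b" "z1 \<in> V" using d_step[OF V(1,3) Suc.prems(3)] .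
  have "d z1 r \<le> d z1 m + d m r" using d_tri z1 V by blast
  then have z1r: "d z1 r = Suc b" using edge_dist[OF z1(1) V(4)] Suc.prems(5) z1(2) d_edge[OF Suc.prems(2)] by auto
  have ne: "s \<noteq> z1" using Suc.prems(6) z1 by auto
  obtain t where t: "E s t" "E z1 t" "Suc (d t r) = Suc b" "t \<in> V"
    using quadrangle[OF Suc.prems(1) z1(1) ne V(4) Suc.prems(5,4) z1r] .
  have "z \<noteq> t" using Suc.prems(5) t by auto
  then have "Or z1 t"
    using square[OF Suc.prems(1) t(1) E_sym[OF t(2)] E_sym[OF z1(1)] _ ne] Suc.prems(7) by blast
  moreover have "d t m = Suc b"
    using edge_dist[OF t(1) V(3)] edge_dist[OF t(2) V(3)] Suc.prems(6) z1(2) by linarith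
  ultimately show ?case using Suc.IH[OF t(2) Suc.prems(2) z1(2) _ z1r] t(3) by simp
qed

text \<open>The medians t of m, m', z and t' of m, m', z' form a metric rectangle with m and m'. If
  t differs from m, the first edge from t down towards m faces, across a ladder, an edge from m' to
  a vertex r. The ladder makes m' the upper end of that edge, although r lies in [m', t'].\<close>

lemma median_below_unique:
  assumes V: "z \<in> V" "z' \<in> V"
    and le: "m \<preceq> z" "m \<preceq> z'" "m' \<preceq> z" "m' \<preceq> z'"
    and eq: "d m z + d m z' = d z z'" "d m' z + d m' z' = d z z'"
  shows "m = m'"
proof -
  have mV: "m \<in> V" "m' \<in> V" using le V prec_V by blast+
  obtain t where t: "t \<in> V" "d m t + d t m' = d m m'" "d m' t + d t z = d m' z" "d m t + d t z = d m z"
    using median[OF mV V(1)] .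
  obtain t' where t': "t' \<in> V" "d m t' + d t' m' = d m m'" "d m' t' + d t' z' = d m' z'" "d m t' + d t' z' = d m z'"
    using median[OF mV V(2)] .
  have lt: "m \<preceq> t" "m' \<preceq> t" "m \<preceq> t'" "m' \<preceq> t'"
    using prec_interval le V t t' by blast+
  have "d z z' \<le> d z t + d t t' + d t' z'" using d_tri[OF V(1) t(1) V(2)] d_tri[OF t(1) t'(1) V(2)] by linarith
  moreover have "d t t' \<le> d t m + d m t'" "d t t' \<le> d t m' + d m' t'" using d_tri t t' mV by blast+
  ultimately have tt: "d t t' = d m t + d m t'" "d t t' = d m' t + d m' t'"
    using eq t t' d_comm[of z t] d_comm[of t m] d_comm[of t m'] by linarith+
  have ab: "d m t = d m' t'" "d m t' = d m' t"
    using tt t(2) t'(2) d_comm[of t m'] d_comm[of t' m'] by linarith+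
  show ?thesis
  proof (cases "d t m")
    case 0
    then have "t = m" "t' = m'" using ab(1) d_zero d_comm t t' mV by metis+
    then show ?thesis using lt prec_antisym mV by blast
  next
    case (Suc a)
    obtain s where s: "E t s" "d s m = a" "s \<in> V" using d_step[OF t(1) mV(1) Suc] .
    have "d m s + d s t = d m t" using s Suc d_edge[OF s(1)] d_comm[of m s] d_comm[of m t] d_comm[of s t] by simp
    then have "s \<preceq> t" using prec_interval lt t s by blast
    then have Ots: "Or t s" using prec_one t d_edge[OF s(1)] d_comm[of s t] by simp
    have "d t t' \<le> d t s + d s t'" "d s t' \<le> d s m + d m t'" using d_tri t t' s mV by blast+
    then have st': "d s t' = a + d m t'" using tt(1) Suc s(2) d_edge[OF s(1)] d_comm[of m t] by linarith
    have "d m m' \<le> d m s + d s m'" "d s m' \<le> d s t + d t m'" using d_tri t s mV by blast+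
    then have sm': "d s m' = Suc (d t m')"
      using t(2) Suc s(2) d_edge[OF s(1)] d_comm[of m s] d_comm[of s t] d_comm[of m t] by linarith
    obtain r where r: "r \<in> V" "d s r + d r t' = d s t'" "d t' r + d r m' = d t' m'" "d s r + d r m' = d s m'"
      using median[OF s(3) t'(1) mV(2)] .
    have r1: "d r m' = 1" "d s r = d t m'" "d r t' = a"
      using r st' sm' ab Suc d_comm[of r t'] d_comm[of t' m'] d_comm[of m t] d_comm[of m' t] by linarith+
    have Emr: "E m' r" using d_one r r1 mV d_comm by metis
    have "m' \<preceq> r \<and> r \<preceq> t'" using prec_interval[OF lt(4) t'(1) r(1)] r(3)
      d_comm[of m' r] d_comm[of t' m'] d_comm[of r t'] by simp
    then have "Or r m'" using prec_one r r1 d_comm[of r m'] by simp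
    have "d t t' \<le> d t r + d r t'" "d t r \<le> d t s + d s r" using d_tri t t' s r by blast+
    then have "d t r = Suc (d t m')"
      using tt(1) r1 d_edge[OF s(1)] Suc ab d_comm[of m t] d_comm[of m' t] by linarith
    then have "Or m' r" using ladder[OF s(1) Emr HOL.refl r1(2) _ sm' Ots] by simp
    then show ?thesis using \<open>Or r m'\<close> Or_asym by blast
  qed
qed

text \<open>For a lower bound x, the median of x, z, z' lies above x, below z and z', and on a
  geodesic from z to z'. By uniqueness it is the same vertex for every x, hence the greatest lower
  bound.\<close>

lemma meet_ex:
  assumes "z \<in> V" "z' \<in> V" "w \<preceq> z" "w \<preceq> z'"
  shows "\<exists>m. m \<preceq> z \<and> m \<preceq> z' \<and> d m z + d m z' = d z z' \<and> (\<forall>x. x \<preceq> z \<longrightarrow> x \<preceq> z' \<longrightarrow> x \<preceq> m)"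
proof -
  have *: "\<exists>m. m \<preceq> z \<and> m \<preceq> z' \<and> d m z + d m z' = d z z' \<and> x \<preceq> m" if x: "x \<preceq> z" "x \<preceq> z'" for x
  proof -
    have xV: "x \<in> V" using x assms prec_V by blast
    obtain m where m: "m \<in> V" "d x m + d m z = d x z" "d z m + d m z' = d z z'" "d x m + d m z' = d x z'"
      using median[OF xV assms(1,2)] .
    have "x \<preceq> m \<and> m \<preceq> z" "x \<preceq> m \<and> m \<preceq> z'" using prec_interval m x assms by blast+
    then show ?thesis using m(3) d_comm[of z m] by auto
  qed
  obtain m where m: "m \<preceq> z" "m \<preceq> z'" "d m z + d m z' = d z z'" using *[OF assms(3,4)] by blast
  have "x \<preceq> m" if "x \<preceq> z" "x \<preceq> z'" for x
  proof -
    obtain m' where m': "m' \<preceq> z" "m' \<preceq> z'" "d m' z + d m' z' = d z z'" "x \<preceq> m'" using *[OF \<open>x \<preceq> z\<close> \<open>x \<preceq> z'\<close>] by blast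
    have "m = m'" by (rule median_below_unique[OF assms(1,2) m(1,2) m'(1,2) m(3) m'(3)])
    then show ?thesis using m'(4) by simp
  qed
  then show ?thesis using m by blast
qed

text \<open>Meaningful for pairs with a common lower bound (for \<open>join\<close>, a common upper
  bound). The distance clause keeps the metric position of the median available for rank
  counts.\<close>

definition meet :: "'a \<Rightarrow> 'a \<Rightarrow> 'a" where
  "meet z z' = (SOME m. m \<preceq> z \<and> m \<preceq> z' \<and> d m z + d m z' = d z z' \<and> (\<forall>x. x \<preceq> z \<longrightarrow> x \<preceq> z' \<longrightarrow> x \<preceq> m))"

definition join :: "'a \<Rightarrow> 'a \<Rightarrow> 'a" where
  "join z z' = (SOME m. z \<preceq> m \<and> z' \<preceq> m \<and> d z m + d z' m = d z z' \<and> (\<forall>x. z \<preceq> x \<longrightarrow> z' \<preceq> x \<longrightarrow> m \<preceq> x))"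

text \<open>Admissibility does not distinguish the two directions of an edge, so statements about
  meets, lower ends and ascending steps transfer to joins, upper ends and descending steps.\<close>

lemma dual: "oriented_modular V E (\<lambda>x y. Or y x)"
proof -
  have "orientation E (\<lambda>x y. Or y x)"
    unfolding orientation_def using Or_E Or_total Or_asym E_sym by blast
  moreover have "Or x3 x4" if "four_cycle E x1 x2 x3 x4" "Or x2 x1" for x1 x2 x3 x4
    using that square[of x2 x1 x4 x3] E_sym by (auto simp: four_cycle_def)
  ultimately show ?thesis
    using oriented_modular unfolding oriented_modular_def oriented_modular_graph_def admissible_def by blast
qed

lemma prec_dual: "opreceq (\<lambda>x y. Or y x) p q \<longleftrightarrow> q \<preceq> p"
proof -
  have "edges (\<lambda>x y. Or y x) = (edges Or)\<inverse>" by (auto simp: edges_def)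
  then show ?thesis unfolding opreceq_def by (simp add: rtrancl_converse)
qed

lemma join_ex:
  assumes "z \<in> V" "z' \<in> V" "z \<preceq> w" "z' \<preceq> w"
  shows "\<exists>m. z \<preceq> m \<and> z' \<preceq> m \<and> d z m + d z' m = d z z' \<and> (\<forall>x. z \<preceq> x \<longrightarrow> z' \<preceq> x \<longrightarrow> m \<preceq> x)"
proof -
  have "\<exists>m. z \<preceq> m \<and> z' \<preceq> m \<and> d m z + d m z' = d z z' \<and> (\<forall>x. z \<preceq> x \<longrightarrow> z' \<preceq> x \<longrightarrow> m \<preceq> x)"
    using oriented_modular.meet_ex[OF dual assms(1,2), of w, unfolded prec_dual, OF assms(3,4)] .
  then obtain m where "z \<preceq> m" "z' \<preceq> m" "d m z + d m z' = d z z'" "\<forall>x. z \<preceq> x \<longrightarrow> z' \<preceq> x \<longrightarrow> m \<preceq> x" by blast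
  then show ?thesis using d_comm[of m z] d_comm[of m z'] by auto
qed

context
  fixes z z' assumes V: "z \<in> V" "z' \<in> V"
begin

lemma meet:
  assumes "w \<preceq> z" "w \<preceq> z'"
  shows "meet z z' \<preceq> z" "meet z z' \<preceq> z'" "d (meet z z') z + d (meet z z') z' = d z z'"
    "x \<preceq> z \<Longrightarrow> x \<preceq> z' \<Longrightarrow> x \<preceq> meet z z'" "meet z z' \<in> V" "w \<preceq> meet z z'"
proof -
  note * = someI_ex[OF meet_ex[OF V assms], folded meet_def]
  then show m: "meet z z' \<preceq> z" "meet z z' \<preceq> z'" "d (meet z z') z + d (meet z z') z' = d z z'"
    and g: "\<And>x. x \<preceq> z \<Longrightarrow> x \<preceq> z' \<Longrightarrow> x \<preceq> meet z z'" by blast+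
  show "meet z z' \<in> V" using m(1) V prec_V by blast
  show "w \<preceq> meet z z'" using g assms by blast
qed

lemma join:
  assumes "z \<preceq> w" "z' \<preceq> w"
  shows "z \<preceq> join z z'" "z' \<preceq> join z z'" "d z (join z z') + d z' (join z z') = d z z'"
    "z \<preceq> x \<Longrightarrow> z' \<preceq> x \<Longrightarrow> join z z' \<preceq> x" "join z z' \<in> V" "join z z' \<preceq> w"
proof -
  note * = someI_ex[OF join_ex[OF V assms], folded join_def]
  then show m: "z \<preceq> join z z'" "z' \<preceq> join z z'" "d z (join z z') + d z' (join z z') = d z z'"
    and g: "\<And>x. z \<preceq> x \<Longrightarrow> z' \<preceq> x \<Longrightarrow> join z z' \<preceq> x" by blast+
  show "join z z' \<in> V" using m(1) V prec_V' by blast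
  show "join z z' \<preceq> w" using g assms by blast
qed

text \<open>Meet and join both lie on geodesics from z to z'; equating the two expressions for d z
  z' gives the identity.\<close>

lemma modular_rank:
  assumes "w \<preceq> z" "w \<preceq> z'" "z \<preceq> u" "z' \<preceq> u"
  shows "d w (meet z z') + d w (join z z') = d w z + d w z'"
proof -
  note m = meet[OF assms(1,2)] and j = join[OF assms(3,4)]
  show ?thesis
    using prec_add[OF m(6,1) V(1)] prec_add[OF m(6,2) V(2)] m(3) j(3)
      prec_add[OF assms(1) j(1,5)] prec_add[OF assms(2) j(2,5)] by linarith
qed

end

text \<open>Induction on the total rank over X. If c is not an atom, an atom e below c takes its
  place and yields a bound of a, b, e; then the base moves up to e, with the joins of a and b with e
  in place of a and b. Three distinct atoms are settled by the median of their pairwise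
  joins.\<close>

lemma triple_join:
  assumes "X \<in> V" "X \<preceq> a" "X \<preceq> b" "X \<preceq> c" "a \<preceq> ab" "b \<preceq> ab" "a \<preceq> ac" "c \<preceq> ac" "b \<preceq> bc" "c \<preceq> bc"
  shows "\<exists>u. a \<preceq> u \<and> b \<preceq> u \<and> c \<preceq> u"
  using assms
proof (induction "d X a + d X b + d X c" arbitrary: X a b c ab ac bc rule: less_induct)
  case less
  note prems = less.prems
  have reduce: "\<exists>u. a' \<preceq> u \<and> b' \<preceq> u \<and> c' \<preceq> u"
    if "d X a' + d X b' + d X c' = d X a + d X b + d X c" and two: "d X c' \<ge> 2"
      and le: "X \<preceq> a'" "X \<preceq> b'" "X \<preceq> c'"
      and ab: "a' \<preceq> ab'" "b' \<preceq> ab'" and ac: "a' \<preceq> ac'" "c' \<preceq> ac'" and bc: "b' \<preceq> bc'" "c' \<preceq> bc'"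
    for a' b' c' ab' ac' bc'
  proof -
    have V: "a' \<in> V" "b' \<in> V" "c' \<in> V" using prec_V' le prems(1) by blast+
    have "X \<noteq> c'" using two by auto
    then obtain e where e: "Or e X" "e \<preceq> c'" "e \<in> V" "Suc (d e c') = d X c'"
      using prec_step[OF le(3) V(3)] by blast
    have Xe: "X \<preceq> e" and de: "d X e = 1" using e Or_prec d_edge Or_E d_comm by metis+
    have "d X a' + d X b' + d X e < d X a + d X b + d X c" using that(1) two de by linarith
    then obtain w where w: "a' \<preceq> w" "b' \<preceq> w" "e \<preceq> w"
      using less.hyps[of X a' b' e ab' ac' bc'] prems(1) le Xe ab ac bc e(2) prec_trans by blast
    note ja = join[OF V(1) e(3) w(1,3)] and jb = join[OF V(2) e(3) w(2,3)]
    \<comment> \<open>Joining with an atom costs at most one step, and moving the base from X to e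
      gains it back.\<close>
    have bound: "d e (join y e) \<le> d X y"
      if "d y (join y e) + d e (join y e) = d y e" "X \<preceq> y" "y \<preceq> join y e" "e \<preceq> join y e"
        "join y e \<in> V" "y \<in> V" for y
    proof -
      have "d y e \<le> d y X + d X e" using d_tri prems(1) e(3) that by blast
      moreover have "d X y + d y (join y e) = d X (join y e)" "d X e + d e (join y e) = d X (join y e)"
        using prec_add that Xe by blast+
      ultimately show ?thesis using that(1) de d_comm[of y X] by linarith
    qed
    have "d e (join a' e) \<le> d X a'" "d e (join b' e) \<le> d X b'"
      using bound ja jb le V by blast+
    then have "d e (join a' e) + d e (join b' e) + d e c' < d X a + d X b + d X c"
      using that(1) e(4) by linarith
    moreover have "join a' e \<preceq> ac'" "join b' e \<preceq> bc'" using ja(4) jb(4) ac bc e(2) prec_trans by blast+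
    ultimately obtain u where "join a' e \<preceq> u" "join b' e \<preceq> u" "c' \<preceq> u"
      using less.hyps[of e "join a' e" "join b' e" c' w ac' bc'] e(2,3) ja(2,6) jb(2,6) ac(2) bc(2) by blast
    then show ?thesis using ja(1) jb(1) prec_trans by blast
  qed
  have V: "a \<in> V" "b \<in> V" "c \<in> V" using prec_V' prems by blast+
  consider "d X a \<ge> 2" | "d X b \<ge> 2" | "d X c \<ge> 2" | "a = b \<or> a = c \<or> b = c"
    | "X = a \<or> X = b \<or> X = c" | "d X a = 1" "d X b = 1" "d X c = 1" "a \<noteq> b" "a \<noteq> c" "b \<noteq> c"
    using d_zero prems(1) V by (metis One_nat_def Suc_1 less_2_cases not_le)
  then show ?case
  proof cases
    case 1 then show ?thesis using reduce[of c b a bc ac ab] prems by (simp add: add_ac) blast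
  next
    case 2 then show ?thesis using reduce[of a c b ac ab bc] prems by (simp add: add_ac) blast
  next
    case 3 then show ?thesis using reduce[of a b c ab ac bc] prems by simp
  next
    case 4 then show ?thesis using prems by blast
  next
    case 5 then show ?thesis using prems prec_trans by blast
  next
    case 6
    have rank2: "d y (join y y') = 1 \<and> d y' (join y y') = 1"
      if "X \<preceq> y" "X \<preceq> y'" "y \<noteq> y'" "d X y = 1" "d X y' = 1" "y \<in> V" "y' \<in> V" "y \<preceq> u" "y' \<preceq> u" for y y' u
    proof -
      note j = join[OF that(6,7,8,9)]
      have "d y y' \<le> d y X + d X y'" using d_tri that prems(1) by blast
      moreover have "d y y' \<noteq> 0" using d_zero that by blast
      moreover have "d X y + d y (join y y') = d X (join y y')" "d X y' + d y' (join y y') = d X (join y y')"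
        using prec_add that j by blast+
      ultimately show ?thesis using j(3) that d_comm[of y X] by linarith
    qed
    note Jab = join[OF V(1,2) prems(5,6)] and Jac = join[OF V(1,3) prems(7,8)] and Jbc = join[OF V(2,3) prems(9,10)]
    have rab: "d a (join a b) = 1" "d b (join a b) = 1" using rank2[OF prems(2,3) 6(4) 6(1,2) V(1,2) prems(5,6)] by auto
    have rac: "d a (join a c) = 1" "d c (join a c) = 1" using rank2[OF prems(2,4) 6(5) 6(1,3) V(1,3) prems(7,8)] by auto
    have rbc: "d b (join b c) = 1" "d c (join b c) = 1" using rank2[OF prems(3,4) 6(6) 6(2,3) V(2,3) prems(9,10)] by auto
    have O: "Or (join a b) a" "Or (join a b) b" "Or (join a c) a" "Or (join a c) c" "Or (join b c) b" "Or (join b c) c"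
      using prec_one Jab Jac Jbc rab rac rbc by blast+
    show ?thesis
    proof (cases "join a b = join a c \<or> join a b = join b c \<or> join a c = join b c")
      case True
      then show ?thesis using Jab Jac Jbc by metis
    next
      case False
      then have dist: "join a b \<noteq> join a c" "join a b \<noteq> join b c" "join a c \<noteq> join b c" by auto
      have two: "d x y = 2" if "Or x z" "Or y z" "x \<noteq> y" for x y z
      proof -
        have E: "E z x" "E z y" "x \<in> V" "y \<in> V" using that Or_E E_V E_sym by blast+
        have "d z y = 1" using d_edge E by blast
        then show ?thesis using edge_dist[OF E(1,4)] d_zero[OF E(3,4)] that(3) by simp
      qed
      have t2: "d (join a b) (join a c) = 2" "d (join a c) (join b c) = 2" "d (join a b) (join b c) = 2"
        using two O False by blast+
      \<comment> \<open>Pairwise distances two make the median adjacent to all three joins.\<close>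
      obtain t where t: "t \<in> V" "d (join a b) t + d t (join a c) = d (join a b) (join a c)"
        "d (join a c) t + d t (join b c) = d (join a c) (join b c)"
        "d (join a b) t + d t (join b c) = d (join a b) (join b c)"
        using median[OF Jab(5) Jac(5) Jbc(5)] .
      have d1: "d t (join a b) = 1" "d t (join a c) = 1" "d t (join b c) = 1"
        using t(2,3,4) d_comm[of t "join a b"] d_comm[of t "join a c"] unfolding t2 by linarith+
      have Et: "E t (join a b)" "E t (join a c)" "E t (join b c)"
        using d1 d_one t(1) Jab(5) Jac(5) Jbc(5) by blast+
      have up: "Or t y" if "Or x z" "Or y z" "x \<noteq> y" "t \<noteq> z" "E t x" "E t y" for x y z
        using square[of x z y t] that Or_E E_sym by metis
      \<comment> \<open>The vertex t cannot be both a and b. If it is not a, the 4-cycle through a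
        orients two joins below t; otherwise the 4-cycle through b does.\<close>
      show ?thesis
      proof (cases "t = a")
        case False
        then have "Or t (join a b)" "Or t (join a c)"
          using up[OF O(1,3)] up[OF O(3,1)] Et dist by metis+
        then have "join a b \<preceq> t" "join a c \<preceq> t" using Or_prec by blast+
        then show ?thesis using Jab(1,2) Jac(2) prec_trans[of _ _ t] by blast
      next
        case True
        then have "t \<noteq> b" using 6 by simp
        then have "Or t (join a b)" "Or t (join b c)"
          using up[OF O(2,5)] up[OF O(5,2)] Et dist by metis+
        then have "join a b \<preceq> t" "join b c \<preceq> t" using Or_prec by blast+
        then show ?thesis using Jab(1,2) Jbc(2) prec_trans[of _ _ t] by blast
      qed
    qed
  qed
qed

lemma triple_meet:
  assumes "X \<in> V" "a \<preceq> X" "b \<preceq> X" "c \<preceq> X" "ab \<preceq> a" "ab \<preceq> b" "ac \<preceq> a" "ac \<preceq> c" "bc \<preceq> b" "bc \<preceq> c"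
  shows "\<exists>u. u \<preceq> a \<and> u \<preceq> b \<and> u \<preceq> c"
proof -
  note * = oriented_modular.triple_join[OF dual, of X a b c ab ac bc]
  show ?thesis using * assms unfolding prec_dual by simp
qed

end

section \<open>Complemented intervals\<close>

context oriented_modular
begin

text \<open>The single equation d z z' = d p q encodes both complement conditions: it puts p as well
  as q on geodesics from z to z'. Unlike the form with atoms, it is visibly invariant under reversal
  of the orientation.\<close>

definition complemented :: "'a \<Rightarrow> 'a \<Rightarrow> bool" where
  "complemented p q \<longleftrightarrow> p \<preceq> q \<and> (\<forall>z. p \<preceq> z \<longrightarrow> z \<preceq> q \<longrightarrow> (\<exists>z'. p \<preceq> z' \<and> z' \<preceq> q \<and> d z z' = d p q))"

text \<open>Asks only that the top be the join of the atoms. It turns out to be equivalent to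
  \<open>osqsub\<close> and \<open>complemented\<close>, and is the form that passes easily to
  joins.\<close>

definition atom_generated :: "'a \<Rightarrow> 'a \<Rightarrow> bool" where
  "atom_generated p q \<longleftrightarrow> p \<preceq> q \<and>
    (\<forall>w. p \<preceq> w \<longrightarrow> w \<preceq> q \<longrightarrow> (\<forall>a. Or a p \<longrightarrow> a \<preceq> q \<longrightarrow> a \<preceq> w) \<longrightarrow> w = q)"

lemma ointerval_iff: "z \<in> ointerval Or p q \<longleftrightarrow> p \<preceq> z \<and> z \<preceq> q"
  by (simp add: ointerval_def)

lemma atoms_iff:
  assumes "p \<in> V"
  shows "a \<in> atoms_of Or p q \<longleftrightarrow> Or a p \<and> a \<preceq> q"
proof
  assume a: "a \<in> atoms_of Or p q"
  then have *: "p \<preceq> a" "a \<preceq> q" "a \<noteq> p"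
    and m: "\<And>w. p \<preceq> w \<Longrightarrow> w \<preceq> q \<Longrightarrow> w \<noteq> p \<Longrightarrow> w \<preceq> a \<Longrightarrow> w = a"
    unfolding atoms_of_def by (auto simp: ointerval_iff)
  have aV: "a \<in> V" using prec_V'[OF *(1) assms] .
  obtain b where b: "Or b p" "b \<preceq> a" "b \<in> V" using prec_step[OF *(1) aV *(3)[symmetric]] .
  have "b \<noteq> p" using b(1) Or_E E_irrefl by blast
  then have "b = a" using m[of b] Or_prec[OF b(1)] prec_trans[OF b(2) *(2)] b(2) by blast
  then show "Or a p \<and> a \<preceq> q" using b * by simp
next
  assume a: "Or a p \<and> a \<preceq> q"
  then have pa: "p \<preceq> a" "d p a = 1" "a \<noteq> p" "a \<in> V"
    using Or_prec d_edge[OF Or_E, of a p] d_comm[of a p] Or_E E_irrefl E_V(1)[OF Or_E, of a p] by auto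
  have "w = a" if w: "p \<preceq> w" "w \<preceq> a" "w \<noteq> p" for w
  proof -
    have "d p w + d w a = 1" using prec_add[OF w(1,2) pa(4)] pa(2) by simp
    moreover have "d p w \<noteq> 0" using prec_d_eq[OF w(1) prec_V[OF w(2) pa(4)]] w(3) by simp
    ultimately show ?thesis using prec_d_eq[OF w(2) pa(4)] by simp
  qed
  then show "a \<in> atoms_of Or p q"
    using a pa unfolding atoms_of_def by (auto simp: ointerval_iff)
qed

lemma osqsub_atom_generated:
  assumes "p \<in> V" "p \<sqsubseteq> q"
  shows "atom_generated p q"
  unfolding atom_generated_def
proof (intro conjI allI impI)
  show pq: "p \<preceq> q" using assms by (simp add: osqsub_def)
  fix w assume w: "p \<preceq> w" "w \<preceq> q" "\<forall>a. Or a p \<longrightarrow> a \<preceq> q \<longrightarrow> a \<preceq> w"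
  obtain A where A: "A \<subseteq> atoms_of Or p q" "is_join_in Or p q A q"
    using assms(2) pq ointerval_iff[of q p q] unfolding osqsub_def by auto
  have "\<forall>a\<in>A. a \<preceq> w" using A(1) w(3) atoms_iff[OF assms(1)] by blast
  moreover have "w \<in> ointerval Or p q" using w(1,2) by (simp add: ointerval_iff)
  ultimately have "q \<preceq> w" using A(2) unfolding is_join_in_def by simp
  then show "w = q" using prec_antisym[OF w(2)] prec_V'[OF w(1) assms(1)] by blast
qed

text \<open>A complement of z is an element z' of largest rank that is independent of z,
  independence being the equation d z z' = d p z + d p z'. An atom not below the join of z and z'
  could be added to z' without losing independence, so that join contains all atoms and is
  q.\<close>

lemma atom_generated_complemented:
  assumes p: "p \<in> V" and T: "atom_generated p q"
  shows "complemented p q"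
  unfolding complemented_def
proof (intro conjI allI impI)
  show pq: "p \<preceq> q" using T by (simp add: atom_generated_def)
  have q: "q \<in> V" using prec_V'[OF pq p] .
  fix z assume z: "p \<preceq> z" "z \<preceq> q"
  have zV: "z \<in> V" using prec_V'[OF z(1) p] .
  let ?P = "\<lambda>z'. p \<preceq> z' \<and> z' \<preceq> q \<and> d z z' = d p z + d p z'"
  have "?P p" using pq d_comm[of z p] by simp
  moreover have "\<forall>z'. ?P z' \<longrightarrow> d p z' < Suc (d p q)"
    using prec_add q by (metis le_add1 less_Suc_eq_le)
  ultimately obtain z' where P: "?P z'" and max: "\<And>y. ?P y \<Longrightarrow> d p y \<le> d p z'"
    using ex_has_greatest_nat[of ?P p "d p" "Suc (d p q)"] by blast
  have z'V: "z' \<in> V" using prec_V' P p by blast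
  have z': "p \<preceq> z'" "z' \<preceq> q" using P by auto
  note J = join[OF zV z'V z(2) z'(2)]
  define j where "j = join z z'"
  note J = J[folded j_def]
  have pj: "p \<preceq> j" using prec_trans[OF z(1) J(1)] .
  have rj: "d p j = d p z + d p z'"
    using prec_add[OF z(1) J(1,5)] prec_add[OF z'(1) J(2,5)] J(3) P by linarith
  have "a \<preceq> j" if a: "Or a p" "a \<preceq> q" for a
  proof (rule ccontr)
    assume na: "\<not> a \<preceq> j"
    have pa: "p \<preceq> a" "d p a = 1" "a \<in> V"
      using a Or_prec d_edge[OF Or_E, of a p] d_comm[of a p] E_V(1)[OF Or_E, of a p] by auto
    have indep: "d y (join y a) = 1" "d a (join y a) = d p y" if y: "p \<preceq> y" "y \<preceq> q" "\<not> a \<preceq> y" for y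
    proof -
      have yV: "y \<in> V" using prec_V'[OF y(1) p] .
      note M = meet[OF yV pa(3) y(1) pa(1)] and Jy = join[OF yV pa(3) y(2) a(2)]
      have "d p (meet y a) + d (meet y a) a = 1" using prec_add[OF M(6,2) pa(3)] pa(2) by simp
      moreover have "meet y a \<noteq> a" using M(1) y(3) by auto
      then have "d (meet y a) a \<noteq> 0" using prec_d_eq[OF M(2) pa(3)] by simp
      ultimately have "d p (meet y a) = 0" by linarith
      then have "d p (join y a) = d p y + 1"
        using modular_rank[OF yV pa(3) y(1) pa(1) y(2) a(2)] pa(2) by simp
      then show "d y (join y a) = 1" "d a (join y a) = d p y"
        using prec_add[OF y(1) Jy(1,5)] prec_add[OF pa(1) Jy(2,5)] pa(2) by linarith+
    qed
    have naz: "\<not> a \<preceq> z'" using na prec_trans[of a z' j] J(2) by blast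
    define y where "y = join z' a"
    note Jy = join[OF z'V pa(3) z'(2) a(2), folded y_def]
    have py: "p \<preceq> y" using prec_trans[OF z'(1) Jy(1)] .
    have ry: "d p y = d p z' + 1"
      using prec_add[OF z'(1) Jy(1,5)] indep(1)[OF z'(1,2) naz] by (simp add: y_def)
    note Jw = join[OF J(5) pa(3) J(6) a(2)]
    have rw: "d p (join j a) = d p j + 1"
      using prec_add[OF pj Jw(1,5)] indep(1)[OF pj J(6) na] by simp
    note M = meet[OF zV Jy(5) z(1) py] and K = join[OF zV Jy(5) z(2) Jy(6)]
    \<comment> \<open>The join of z and y lies above j and a, so its rank is at least d p z + d p y;
      the rank identity leaves rank 0 for their meet.\<close>
    have "j \<preceq> join z y" using J(4)[OF K(1) prec_trans[OF Jy(1) K(2)]] .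
    then have "join j a \<preceq> join z y" using Jw(4) prec_trans[OF Jy(2) K(2)] by blast
    then have "d p (join j a) \<le> d p (join z y)"
      using prec_add[OF prec_trans[OF pj Jw(1)] _ K(5)] by fastforce
    moreover have "d p (meet z y) + d p (join z y) = d p z + d p y"
      using modular_rank[OF zV Jy(5) z(1) py z(2) Jy(6)] .
    ultimately have "d p (meet z y) = 0" using rw rj ry by linarith
    then have "d z y = d p z + d p y"
      using M(3) prec_add[OF M(6,1) zV] prec_add[OF M(6,2) Jy(5)] by linarith
    then show False using max[of y] py Jy(6) ry by simp
  qed
  then have "j = q" using T pj J(6) unfolding atom_generated_def by blast
  then show "\<exists>z'. p \<preceq> z' \<and> z' \<preceq> q \<and> d z z' = d p q" using P rj by auto
qed

text \<open>The routes from z to z' through p and through q have total length 2 d p q, and neither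
  is shorter than d z z'.\<close>

lemma complement_ranks:
  assumes "p \<preceq> z" "z \<preceq> q" "p \<preceq> z'" "z' \<preceq> q" "q \<in> V" "d z z' = d p q"
  shows "d p z + d p z' = d p q" "d z q + d z' q = d p q"
proof -
  have V: "p \<in> V" "z \<in> V" "z' \<in> V" using prec_V prec_trans assms by blast+
  have "d z z' \<le> d z p + d p z'" "d z z' \<le> d z q + d q z'"
    using d_tri[OF V(2,1,3)] d_tri[OF V(2) assms(5) V(3)] by auto
  then show "d p z + d p z' = d p q" "d z q + d z' q = d p q"
    using prec_add[OF assms(1,2,5)] prec_add[OF assms(3,4,5)] assms(6) d_comm[of z p] d_comm[of q z'] by linarith+
qed

text \<open>By modularity, a complement c of z in [p, q] gives the complement
  \<open>meet c r\<close> of z in [p, r].\<close>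

lemma complemented_lower:
  assumes p: "p \<in> V" and C: "complemented p q" and r: "p \<preceq> r" "r \<preceq> q"
  shows "complemented p r"
  unfolding complemented_def
proof (intro conjI allI impI)
  fix z assume z: "p \<preceq> z" "z \<preceq> r"
  have V: "r \<in> V" "z \<in> V" "q \<in> V" using prec_V'[OF r(1) p] prec_V'[OF z(1) p] prec_V'[OF r(2) prec_V'[OF r(1) p]] .
  have zq: "z \<preceq> q" using prec_trans[OF z(2) r(2)] .
  obtain c where c: "p \<preceq> c" "c \<preceq> q" "d z c = d p q" using C z(1) zq unfolding complemented_def by blast
  have cV: "c \<in> V" using prec_V'[OF c(1) p] .
  note R = complement_ranks[OF z(1) zq c(1,2) V(3) c(3)]
  note M = meet[OF cV V(1) c(1) r(1)] and J = join[OF cV V(1) c(2) r(2)]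
  note Jz = join[OF V(2) cV zq c(2)]
  have "d z (join z c) + d (join z c) q = d z q" "d c (join z c) + d (join z c) q = d c q"
    using prec_add[OF Jz(1,6) V(3)] prec_add[OF Jz(2,6) V(3)] by auto
  then have "d (join z c) q = 0" using R c(3) Jz(3) by linarith
  then have "join z c = q" using prec_d_eq[OF Jz(6) V(3)] by simp
  moreover have "join z c \<preceq> join c r" using Jz(4)[OF prec_trans[OF z(2) J(2)] J(1)] .
  ultimately have Jq: "join c r = q" using prec_antisym[OF J(6) _ J(5)] by simp
  have m: "d p (meet c r) + d p q = d p c + d p r"
    using modular_rank[OF cV V(1) c(1) r(1) c(2) r(2)] Jq by simp
  then have s: "d p z + d p (meet c r) = d p r" using R by linarith
  have "d z c \<le> d z (meet c r) + d (meet c r) c" using d_tri[OF V(2) M(5) cV] .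
  moreover have "d z (meet c r) \<le> d z p + d p (meet c r)" using d_tri[OF V(2) p M(5)] .
  ultimately have "d z (meet c r) = d p r"
    using s c(3) R(1) prec_add[OF M(6,1) cV] d_comm[of z p] by linarith
  then show "\<exists>z'. p \<preceq> z' \<and> z' \<preceq> r \<and> d z z' = d p r" using M(6,2) by blast
qed (rule r)

lemma complemented_dual: "oriented_modular.complemented E (\<lambda>x y. Or y x) q p \<longleftrightarrow> complemented p q"
  unfolding complemented_def oriented_modular.complemented_def[OF dual] prec_dual by (auto simp: d_comm[of q p])

lemma complemented_sub:
  assumes "q' \<in> V" "complemented p q" "p \<preceq> p'" "p' \<preceq> q'" "q' \<preceq> q"
  shows "complemented p' q'"
proof -
  have p: "p \<in> V" using prec_V[OF prec_trans[OF assms(3,4)] assms(1)] .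
  have *: "complemented p q'" using complemented_lower[OF p assms(2) prec_trans[OF assms(3,4)] assms(5)] .
  show ?thesis
    using oriented_modular.complemented_lower[OF dual, of q' p p', unfolded prec_dual complemented_dual, OF assms(1) * assms(4,3)] .
qed

text \<open>Let w be above all atoms below z and let c be a complement of \<open>meet z w\<close> in
  [p, z]. An atom below c would also be below \<open>meet z w\<close>, making the two closer than
  complements can be; so c = p and \<open>meet z w\<close> = z.\<close>

lemma complemented_osqsub:
  assumes p: "p \<in> V" and C: "complemented p q"
  shows "p \<sqsubseteq> q"
  unfolding osqsub_def
proof (intro conjI ballI)
  show pq: "p \<preceq> q" using C by (simp add: complemented_def)
  have q: "q \<in> V" using prec_V'[OF pq p] .
  fix z assume "z \<in> ointerval Or p q"
  then have z: "p \<preceq> z" "z \<preceq> q" by (auto simp: ointerval_iff)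
  have zV: "z \<in> V" using prec_V'[OF z(1) p] .
  have "z \<preceq> w" if w: "p \<preceq> w" "w \<preceq> q" "\<forall>a\<in>{a. Or a p \<and> a \<preceq> z}. a \<preceq> w" for w
  proof -
    have wV: "w \<in> V" using prec_V'[OF w(1) p] .
    note M = meet[OF zV wV z(1) w(1)]
    have "complemented p z" using complemented_lower[OF p C z] .
    then obtain c where c: "p \<preceq> c" "c \<preceq> z" "d (meet z w) c = d p z"
      using M(1,6) unfolding complemented_def by blast
    have cV: "c \<in> V" using prec_V'[OF c(1) p] .
    note R = complement_ranks[OF M(6,1) c(1,2) zV c(3)]
    have "c = p"
    proof (rule ccontr)
      assume "c \<noteq> p"
      then obtain a where a: "Or a p" "a \<preceq> c" "a \<in> V" "Suc (d a c) = d p c"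
        using prec_step[OF c(1) cV] by metis
      have "a \<preceq> z" using prec_trans[OF a(2) c(2)] .
      then have am: "a \<preceq> meet z w" using M(4) w(3) a(1) by blast
      have "d p a = 1" using d_edge[OF Or_E[OF a(1)]] d_comm[of a p] by simp
      moreover have "d p a + d a (meet z w) = d p (meet z w)" using prec_add[OF Or_prec[OF a(1)] am M(5)] .
      moreover have "d (meet z w) c \<le> d (meet z w) a + d a c" using d_tri[OF M(5) a(3) cV] .
      ultimately show False using a(4) R(1) c(3) d_comm[of "meet z w" a] by linarith
    qed
    then have "d (meet z w) z = 0" using R(1) prec_add[OF M(6,1) zV] by simp
    then have "meet z w = z" using prec_d_eq[OF M(1) zV] by simp
    then show ?thesis using M(2) by simp
  qed
  then show "\<exists>A\<subseteq>atoms_of Or p q. is_join_in Or p q A z"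
    using z by (intro exI[of _ "{a. Or a p \<and> a \<preceq> z}"])
      (auto simp: is_join_in_def ointerval_iff atoms_iff[OF p] intro: prec_trans)
qed

lemma osqsub_complemented: "p \<in> V \<Longrightarrow> p \<sqsubseteq> q \<longleftrightarrow> complemented p q"
  using complemented_osqsub atom_generated_complemented osqsub_atom_generated by blast

lemma osqsub_atom: "p \<in> V \<Longrightarrow> p \<sqsubseteq> q \<longleftrightarrow> atom_generated p q"
  using complemented_osqsub atom_generated_complemented osqsub_atom_generated by blast

lemma osqsub_prec: "p \<sqsubseteq> q \<Longrightarrow> p \<preceq> q" by (simp add: osqsub_def)

lemma osqsub_dual:
  assumes "p \<in> V"
  shows "osqsub (\<lambda>x y. Or y x) q p \<longleftrightarrow> p \<sqsubseteq> q"
proof (cases "p \<preceq> q")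
  case True
  then have "q \<in> V" using prec_V' assms by blast
  then show ?thesis using oriented_modular.osqsub_complemented[OF dual, of q p] osqsub_complemented[OF assms] complemented_dual by simp
next
  case False
  then show ?thesis by (auto simp: osqsub_def prec_dual)
qed

lemma osqsub_sub: "q' \<in> V \<Longrightarrow> p \<sqsubseteq> q \<Longrightarrow> p \<preceq> p' \<Longrightarrow> p' \<preceq> q' \<Longrightarrow> q' \<preceq> q \<Longrightarrow> p' \<sqsubseteq> q'"
  using complemented_sub[of q' p q p'] osqsub_complemented[of p q] osqsub_complemented[of p' q'] prec_V[of p' q'] prec_V[of p p'] by blast

lemma osqsub_refl: "p \<in> V \<Longrightarrow> p \<sqsubseteq> p"
  unfolding osqsub_complemented complemented_def by auto

text \<open>An element above all atoms of the larger interval is above the atoms of [y, z] and of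
  [y, z'], hence above z and z'.\<close>

lemma osqsub_join:
  assumes y: "y \<in> V" and s: "y \<sqsubseteq> z" "y \<sqsubseteq> z'" and u: "z \<preceq> u" "z' \<preceq> u"
  shows "y \<sqsubseteq> join z z'"
proof -
  have le: "y \<preceq> z" "y \<preceq> z'" using s osqsub_prec by auto
  have V: "z \<in> V" "z' \<in> V" using prec_V'[OF le(1) y] prec_V'[OF le(2) y] .
  note J = join[OF V u]
  have T: "atom_generated y z" "atom_generated y z'" using s osqsub_atom[OF y] by auto
  have "w = join z z'" if w: "y \<preceq> w" "w \<preceq> join z z'" "\<forall>a. Or a y \<longrightarrow> a \<preceq> join z z' \<longrightarrow> a \<preceq> w" for w
  proof -
    have wV: "w \<in> V" using prec_V'[OF w(1) y] .
    have "v \<preceq> w" if v: "y \<preceq> v" "v \<in> V" "v \<preceq> join z z'" "atom_generated y v" for v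
    proof -
      note M = meet[OF v(2) wV v(1) w(1)]
      have "\<forall>a. Or a y \<longrightarrow> a \<preceq> v \<longrightarrow> a \<preceq> meet v w"
        using M(4) w(3) prec_trans[OF _ v(3)] by blast
      then have "meet v w = v" using v(4) M(1,6) unfolding atom_generated_def by blast
      then show ?thesis using M(2) by simp
    qed
    then have "z \<preceq> w" "z' \<preceq> w" using le V T J(1,2) by blast+
    then show ?thesis using prec_antisym[OF w(2) J(4)] wV by blast
  qed
  then show ?thesis using prec_trans[OF le(1) J(1)] unfolding osqsub_atom[OF y] atom_generated_def by blast
qed

lemma meet_dual: "oriented_modular.join E (\<lambda>x y. Or y x) z z' = meet z z'" "oriented_modular.meet E (\<lambda>x y. Or y x) z z' = join z z'"
proof -
  have "d z m + d z' m = d m z + d m z'" for m using d_comm[of z m] d_comm[of z' m] by simp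
  then show "oriented_modular.join E (\<lambda>x y. Or y x) z z' = meet z z'" "oriented_modular.meet E (\<lambda>x y. Or y x) z z' = join z z'"
    unfolding oriented_modular.join_def[OF dual] meet_def oriented_modular.meet_def[OF dual] join_def prec_dual by simp_all
qed

lemma osqsub_meet:
  assumes y: "y \<in> V" and s: "z \<sqsubseteq> y" "z' \<sqsubseteq> y" and u: "u \<preceq> z" "u \<preceq> z'"
  shows "meet z z' \<sqsubseteq> y"
proof -
  have V: "z \<in> V" "z' \<in> V" using prec_V[OF osqsub_prec y] s by blast+
  have "meet z z' \<in> V" using meet[OF V u] by simp
  then show ?thesis
    using oriented_modular.osqsub_join[OF dual y, of z z' u] s u
    by (simp add: prec_dual osqsub_dual V meet_dual)
qed

end

section \<open>The semilattice of intervals around a vertex\<close>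

context oriented_modular
begin

lemma ointerval_subset:
  assumes "y \<preceq> z"
  shows "ointerval Or y z \<subseteq> ointerval Or y' z' \<longleftrightarrow> y' \<preceq> y \<and> z \<preceq> z'"
proof
  assume *: "ointerval Or y z \<subseteq> ointerval Or y' z'"
  have "y \<in> ointerval Or y z" "z \<in> ointerval Or y z" using assms by (auto simp: ointerval_iff)
  then have "y \<in> ointerval Or y' z'" "z \<in> ointerval Or y' z'" using * by blast+
  then show "y' \<preceq> y \<and> z \<preceq> z'" by (simp add: ointerval_iff)
next
  assume *: "y' \<preceq> y \<and> z \<preceq> z'"
  show "ointerval Or y z \<subseteq> ointerval Or y' z'"
  proof
    fix v assume "v \<in> ointerval Or y z"
    then have "y \<preceq> v" "v \<preceq> z" by (auto simp: ointerval_iff)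
    then show "v \<in> ointerval Or y' z'"
      using prec_trans[of y' y v] prec_trans[of v z z'] * by (simp add: ointerval_iff)
  qed
qed

text \<open>The ends can be recovered from the set, so the definite descriptions in
  \<open>gstar\<close> and \<open>irank\<close> are unique.\<close>

lemma ointerval_inject:
  assumes "y \<preceq> z" "y' \<preceq> z'" "y \<in> V" "ointerval Or y z = ointerval Or y' z'"
  shows "y' = y \<and> z' = z"
proof -
  have "y' \<preceq> y" "z \<preceq> z'" "y \<preceq> y'" "z' \<preceq> z"
    using ointerval_subset[OF assms(1), of y' z'] ointerval_subset[OF assms(2), of y z] assms(4) by auto
  then show ?thesis
    using prec_antisym[of y y'] prec_antisym[of z z'] assms(3) prec_V'[OF assms(1,3)] by simp
qed

lemma gstar_eq:
  assumes "y \<sqsubseteq> z" "y \<in> V"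
  shows "gstar Or g (ointerval Or y z) = (g y + g z) / 2"
  unfolding gstar_def
proof (rule the_equality)
  show "\<exists>y' z'. y' \<sqsubseteq> z' \<and> ointerval Or y z = ointerval Or y' z' \<and> (g y + g z) / 2 = (g y' + g z') / 2"
    using assms by blast
next
  fix v assume "\<exists>y' z'. y' \<sqsubseteq> z' \<and> ointerval Or y z = ointerval Or y' z' \<and> v = (g y' + g z') / 2"
  then obtain y' z' where *: "y' \<sqsubseteq> z'" "ointerval Or y z = ointerval Or y' z'" "v = (g y' + g z') / 2" by blast
  show "v = (g y + g z) / 2"
    using ointerval_inject[OF osqsub_prec[OF assms(1)] osqsub_prec[OF *(1)] assms(2) *(2)] *(3) by simp
qed

definition irank :: "'a set \<Rightarrow> nat" where
  "irank J = (THE n. \<exists>y z. y \<in> V \<and> y \<preceq> z \<and> J = ointerval Or y z \<and> n = d y z)"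

lemma irank_eq: "y \<in> V \<Longrightarrow> y \<preceq> z \<Longrightarrow> irank (ointerval Or y z) = d y z"
  unfolding irank_def by (rule the_equality) (auto dest: ointerval_inject)

lemma Istar_cases:
  assumes "J \<in> Istar Or X" "X \<in> V"
  obtains y z where "J = ointerval Or y z" "y \<sqsubseteq> z" "y \<preceq> X" "X \<preceq> z" "y \<preceq> z" "y \<in> V" "z \<in> V"
proof -
  obtain y z where *: "J = ointerval Or y z" "y \<sqsubseteq> z" "y \<preceq> X" "X \<preceq> z"
    using assms(1) unfolding Istar_def by blast
  then show ?thesis using that[of y z] osqsub_prec[OF *(2)] prec_V[OF *(3) assms(2)] prec_V'[OF *(4) assms(2)] by blast
qed

lemma IstarI: "y \<sqsubseteq> z \<Longrightarrow> y \<preceq> X \<Longrightarrow> X \<preceq> z \<Longrightarrow> ointerval Or y z \<in> Istar Or X"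
  unfolding Istar_def by blast

lemma ointerval_Int:
  assumes X: "X \<in> V" and le: "y \<preceq> X" "y' \<preceq> X" "X \<preceq> z" "X \<preceq> z'"
  shows "ointerval Or y z \<inter> ointerval Or y' z' = ointerval Or (join y y') (meet z z')"
proof -
  have V: "y \<in> V" "y' \<in> V" "z \<in> V" "z' \<in> V" using prec_V[OF _ X] prec_V'[OF _ X] le by blast+
  note J = join[OF V(1,2) le(1,2)] and M = meet[OF V(3,4) le(3,4)]
  have "y \<preceq> v \<and> y' \<preceq> v \<longleftrightarrow> join y y' \<preceq> v" for v
    using J(4)[of v] prec_trans[OF J(1), of v] prec_trans[OF J(2), of v] by blast
  moreover have "v \<preceq> z \<and> v \<preceq> z' \<longleftrightarrow> v \<preceq> meet z z'" for v
    using M(4)[of v] prec_trans[OF _ M(1), of v] prec_trans[OF _ M(2), of v] by blast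
  ultimately show ?thesis unfolding set_eq_iff Int_iff ointerval_iff by blast
qed

text \<open>An interval around X is a pair of a lower end below X and an upper end above X. Meets
  and joins act on the ends separately and the rank splits as d y X + d X z, so modularity comes
  from the graph. The relation \<sqsubseteq> between new ends follows from \<open>osqsub_sub\<close>
  whenever a common bound exists; for three pairwise bounded intervals it is assembled from mixed
  pairs of ends.\<close>

lemma Istar_modular_semilattice:
  assumes X: "X \<in> V"
  shows "modular_semilattice (Istar Or X) (\<subseteq>) irank (\<inter>) (ointerval Or X X)"
proof
  note cases = Istar_cases[OF _ X]
  have incl: "d y' y + d y z + d z z' = d y' z'"
    if "y' \<preceq> y" "y \<preceq> z" "z \<preceq> z'" "z' \<in> V" for y y' z z'
    using prec_add[OF that(1) prec_trans[OF that(2,3)] that(4)] prec_add[OF that(2,3,4)] by simp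
  fix J K assume J: "J \<in> Istar Or X" and K: "K \<in> Istar Or X"
  obtain y z where yz: "J = ointerval Or y z" "y \<sqsubseteq> z" "y \<preceq> X" "X \<preceq> z" "y \<preceq> z" "y \<in> V" "z \<in> V"
    using cases[OF J] .
  obtain y' z' where yz': "K = ointerval Or y' z'" "y' \<sqsubseteq> z'" "y' \<preceq> X" "X \<preceq> z'" "y' \<preceq> z'" "y' \<in> V" "z' \<in> V"
    using cases[OF K] .
  note Jy = join[OF yz(6) yz'(6) yz(3) yz'(3)] and Mz = meet[OF yz(7) yz'(7) yz(4) yz'(4)]
  have int: "J \<inter> K = ointerval Or (join y y') (meet z z')"
    unfolding yz(1) yz'(1) by (rule ointerval_Int[OF X yz(3) yz'(3) yz(4) yz'(4)])
  have "join y y' \<sqsubseteq> meet z z'"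
    by (rule osqsub_sub[OF Mz(5) yz(2) Jy(1) prec_trans[OF Jy(6) Mz(6)] Mz(1)])
  then show "J \<inter> K \<in> Istar Or X" unfolding int using Jy(6) Mz(6) by (rule IstarI)
  have rJ: "irank J = d y X + d X z" using irank_eq[OF yz(6,5)] prec_add[OF yz(3,4,7)] yz(1) by simp
  have rK: "irank K = d y' X + d X z'" using irank_eq[OF yz'(6,5)] prec_add[OF yz'(3,4,7)] yz'(1) by simp
  have rI: "irank (J \<inter> K) = d (join y y') X + d X (meet z z')"
    unfolding int using irank_eq[OF Jy(5) prec_trans[OF Jy(6) Mz(6)]] prec_add[OF Jy(6) Mz(6,5)] by simp
  {
    fix U assume U: "U \<in> Istar Or X" and sub: "J \<subseteq> U" "K \<subseteq> U"
    obtain a b where ab: "U = ointerval Or a b" "a \<sqsubseteq> b" "a \<preceq> X" "X \<preceq> b" "a \<preceq> b" "a \<in> V" "b \<in> V"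
      using cases[OF U] .
    have s: "a \<preceq> y" "z \<preceq> b" "a \<preceq> y'" "z' \<preceq> b"
      using sub ointerval_subset[OF yz(5)] ointerval_subset[OF yz'(5)] unfolding ab(1) yz(1) yz'(1) by auto
    note My = meet[OF yz(6) yz'(6) s(1,3)] and Jz = join[OF yz(7) yz'(7) s(2,4)]
    have le: "meet y y' \<preceq> X" "X \<preceq> join z z'" using prec_trans[OF My(1) yz(3)] prec_trans[OF yz(4) Jz(1)] .
    have mj: "meet y y' \<sqsubseteq> join z z'"
      by (rule osqsub_sub[OF Jz(5) ab(2) My(6) prec_trans[OF le] Jz(6)])
    let ?j = "ointerval Or (meet y y') (join z z')"
    have "?j \<in> Istar Or X" using mj le by (rule IstarI)
    moreover have "J \<subseteq> ?j" "K \<subseteq> ?j"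
      using ointerval_subset[OF yz(5)] ointerval_subset[OF yz'(5)] My(1,2) Jz(1,2) unfolding yz(1) yz'(1) by auto
    moreover have "?j \<subseteq> W" if W: "W \<in> Istar Or X" "J \<subseteq> W" "K \<subseteq> W" for W
    proof -
      obtain e f where ef: "W = ointerval Or e f" using cases[OF W(1)] by metis
      have "e \<preceq> y" "e \<preceq> y'" "z \<preceq> f" "z' \<preceq> f"
        using W(2,3) ointerval_subset[OF yz(5)] ointerval_subset[OF yz'(5)] unfolding ef yz(1) yz'(1) by auto
      then show ?thesis unfolding ef using My(4) Jz(4) ointerval_subset[OF prec_trans[OF le]] by simp
    qed
    moreover have "irank ?j + irank (J \<inter> K) = irank J + irank K"
    proof -
      have "irank ?j = d (meet y y') X + d X (join z z')"
        using irank_eq[OF My(5) prec_trans[OF le]] prec_add[OF le Jz(5)] by simp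
      moreover have "d X (meet z z') + d X (join z z') = d X z + d X z'"
        by (rule modular_rank[OF yz(7) yz'(7) yz(4) yz'(4) s(2,4)])
      moreover have "d (meet y y') X + d (join y y') X = d y X + d y' X"
        using modular_rank[OF yz(6) yz'(6) s(1,3) yz(3) yz'(3)] prec_add[OF My(6) le(1) X]
          prec_add[OF prec_trans[OF s(1) Jy(1)] Jy(6) X] prec_add[OF s(1) yz(3) X] prec_add[OF s(3) yz'(3) X]
        by linarith
      ultimately show ?thesis unfolding rJ rK rI by linarith
    qed
    ultimately show "\<exists>j\<in>Istar Or X. J \<subseteq> j \<and> K \<subseteq> j \<and> (\<forall>w\<in>Istar Or X. J \<subseteq> w \<longrightarrow> K \<subseteq> w \<longrightarrow> j \<subseteq> w) \<and>
        irank j + irank (J \<inter> K) = irank J + irank K"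
      by (intro bexI[of _ ?j] conjI ballI impI)
  }
  {
    fix L A B C assume L: "L \<in> Istar Or X" and A: "A \<in> Istar Or X" and B: "B \<in> Istar Or X" and C: "C \<in> Istar Or X"
      and sub: "J \<subseteq> A" "K \<subseteq> A" "K \<subseteq> B" "L \<subseteq> B" "J \<subseteq> C" "L \<subseteq> C"
    obtain y'' z'' where yz'': "L = ointerval Or y'' z''" "y'' \<sqsubseteq> z''" "y'' \<preceq> X" "X \<preceq> z''" "y'' \<preceq> z''" "y'' \<in> V" "z'' \<in> V"
      using cases[OF L] .
    \<comment> \<open>A common bound relates also the lower end of one interval to the upper end of
      the other, as \<open>osqsub_join\<close> and \<open>osqsub_meet\<close> require.\<close>
    have pair: "\<exists>lo hi. lo \<preceq> u \<and> lo \<preceq> u' \<and> v \<preceq> hi \<and> v' \<preceq> hi \<and> u \<sqsubseteq> v' \<and> u' \<sqsubseteq> v"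
      if D: "D \<in> Istar Or X" "ointerval Or u v \<subseteq> D" "ointerval Or u' v' \<subseteq> D"
        and "u \<preceq> v" "u' \<preceq> v'" "u \<preceq> X" "u' \<preceq> X" "X \<preceq> v" "X \<preceq> v'" "v \<in> V" "v' \<in> V" for D u v u' v'
    proof -
      obtain e f where ef: "D = ointerval Or e f" "e \<sqsubseteq> f" using cases[OF D(1)] by metis
      have s: "e \<preceq> u" "e \<preceq> u'" "v \<preceq> f" "v' \<preceq> f"
        using D(2,3) ointerval_subset[OF that(4)] ointerval_subset[OF that(5)] unfolding ef(1) by auto
      have "u \<sqsubseteq> v'" "u' \<sqsubseteq> v"
        using osqsub_sub[OF that(11) ef(2) s(1) prec_trans[OF that(6,9)] s(4)]
          osqsub_sub[OF that(10) ef(2) s(2) prec_trans[OF that(7,8)] s(3)] .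
      then show ?thesis using s by blast
    qed
    obtain l1 h1 where p1: "l1 \<preceq> y" "l1 \<preceq> y'" "z \<preceq> h1" "z' \<preceq> h1" "y \<sqsubseteq> z'" "y' \<sqsubseteq> z"
      using pair[of A y z y' z'] A sub(1,2) yz yz' by auto
    obtain l2 h2 where p2: "l2 \<preceq> y'" "l2 \<preceq> y''" "z' \<preceq> h2" "z'' \<preceq> h2" "y' \<sqsubseteq> z''" "y'' \<sqsubseteq> z'"
      using pair[of B y' z' y'' z''] B sub(3,4) yz'' yz' by auto
    obtain l3 h3 where p3: "l3 \<preceq> y" "l3 \<preceq> y''" "z \<preceq> h3" "z'' \<preceq> h3" "y \<sqsubseteq> z''" "y'' \<sqsubseteq> z"
      using pair[of C y z y'' z''] C sub(5,6) yz'' yz by auto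
    obtain up where up: "z \<preceq> up" "z' \<preceq> up" "z'' \<preceq> up"
      using triple_join[OF X yz(4) yz'(4) yz''(4) p1(3,4) p3(3,4) p2(3,4)] by blast
    obtain lo where lo: "lo \<preceq> y" "lo \<preceq> y'" "lo \<preceq> y''"
      using triple_meet[OF X yz(3) yz'(3) yz''(3) p1(1,2) p3(1,2) p2(1,2)] by blast
    define Z where "Z = join (join z z') z''"
    define Y where "Y = meet (meet y y') y''"
    note Z1 = join[OF yz(7) yz'(7) up(1,2)]
    note Z2 = join[OF Z1(5) yz''(7) Z1(6) up(3), folded Z_def]
    note Y1 = meet[OF yz(6) yz'(6) lo(1,2)]
    note Y2 = meet[OF Y1(5) yz''(6) Y1(6) lo(3), folded Y_def]
    have jj: "u \<sqsubseteq> Z" if "u \<in> V" "u \<sqsubseteq> z" "u \<sqsubseteq> z'" "u \<sqsubseteq> z''" for u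
      unfolding Z_def
      using osqsub_join[OF that(1) osqsub_join[OF that(1-3) up(1,2)] that(4) Z1(6) up(3)] .
    have "y \<sqsubseteq> Z" "y' \<sqsubseteq> Z" "y'' \<sqsubseteq> Z"
      using jj yz(2,6) yz'(2,6) yz''(2,6) p1 p2 p3 by blast+
    then have YZ: "Y \<sqsubseteq> Z"
      unfolding Y_def using osqsub_meet[OF Z2(5) osqsub_meet[OF Z2(5) _ _ lo(1,2)] _ Y1(6) lo(3)] by blast
    have le: "Y \<preceq> y" "Y \<preceq> y'" "Y \<preceq> y''" "z \<preceq> Z" "z' \<preceq> Z" "z'' \<preceq> Z"
      using prec_trans[OF Y2(1) Y1(1)] prec_trans[OF Y2(1) Y1(2)] Y2(2)
        prec_trans[OF Z1(1) Z2(1)] prec_trans[OF Z1(2) Z2(1)] Z2(2) .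
    have "ointerval Or Y Z \<in> Istar Or X"
      using YZ prec_trans[OF le(1) yz(3)] prec_trans[OF yz(4) le(4)] by (rule IstarI)
    moreover have "J \<subseteq> ointerval Or Y Z" "K \<subseteq> ointerval Or Y Z" "L \<subseteq> ointerval Or Y Z"
      unfolding yz(1) yz'(1) yz''(1) using le yz(5) yz'(5) yz''(5) by (simp_all add: ointerval_subset)
    ultimately show "\<exists>u\<in>Istar Or X. J \<subseteq> u \<and> K \<subseteq> u \<and> L \<subseteq> u" by blast
  }
  {
    assume sub: "J \<subseteq> K" and ne: "J \<noteq> K"
    have s: "y' \<preceq> y" "z \<preceq> z'"
      using sub ointerval_subset[OF yz(5)] unfolding yz(1) yz'(1) by auto
    have r: "irank J = d y z" "irank K = d y' y + d y z + d z z'"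
      using irank_eq[OF yz(6,5)] irank_eq[OF yz'(6,5)] incl[OF s(1) yz(5) s(2) yz'(7)] yz(1) yz'(1) by auto
    have "y \<noteq> y' \<or> z \<noteq> z'" using ne yz(1) yz'(1) by auto
    then have "d y' y \<noteq> 0 \<or> d z z' \<noteq> 0"
      using prec_d_eq[OF s(1) yz(6)] prec_d_eq[OF s(2) yz'(7)] by auto
    then show "irank J < irank K" unfolding r by linarith
    show "\<exists>M\<in>Istar Or X. J \<subseteq> M \<and> M \<subseteq> K \<and> irank M = Suc (irank J)"
    proof (cases "z = z'")
      case False
      obtain a where a: "Or a z" "a \<preceq> z'" "a \<in> V" using prec_step[OF s(2) yz'(7) False] by metis
      have za: "z \<preceq> a" "d z a = 1" using Or_prec[OF a(1)] d_edge[OF Or_E[OF a(1)]] d_comm[of z a] by auto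
      have ya: "y \<preceq> a" using prec_trans[OF yz(5) za(1)] .
      have "y \<sqsubseteq> a" using osqsub_sub[OF a(3) yz'(2) s(1) ya a(2)] .
      then have "ointerval Or y a \<in> Istar Or X" using yz(3) prec_trans[OF yz(4) za(1)] by (rule IstarI)
      moreover have "J \<subseteq> ointerval Or y a" "ointerval Or y a \<subseteq> K"
        unfolding yz(1) yz'(1) using ointerval_subset[OF yz(5)] ointerval_subset[OF ya] za(1) a(2) s(1) by auto
      moreover have "irank (ointerval Or y a) = Suc (irank J)"
        unfolding r irank_eq[OF yz(6) ya] using prec_add[OF yz(5) za(1) a(3)] za(2) by simp
      ultimately show ?thesis by blast
    next
      case True
      then have ne': "y' \<noteq> y" using ne yz(1) yz'(1) by auto
      obtain a where a: "Or y a" "y' \<preceq> a" "a \<in> V"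
        using oriented_modular.prec_step[OF dual, of y y', unfolded prec_dual, OF s(1) yz'(6) ne'[symmetric]] by metis
      have ay: "a \<preceq> y" "d a y = 1" using Or_prec[OF a(1)] d_edge[OF Or_E[OF a(1)]] d_comm[of a y] by auto
      have az: "a \<preceq> z" using prec_trans[OF ay(1) yz(5)] .
      have "a \<sqsubseteq> z" using osqsub_sub[OF yz(7) yz'(2) a(2) az s(2)] .
      then have "ointerval Or a z \<in> Istar Or X" using prec_trans[OF ay(1) yz(3)] yz(4) by (rule IstarI)
      moreover have "J \<subseteq> ointerval Or a z" "ointerval Or a z \<subseteq> K"
        unfolding yz(1) yz'(1) using ointerval_subset[OF yz(5)] ointerval_subset[OF az] ay(1) a(2) s(2) by auto
      moreover have "irank (ointerval Or a z) = Suc (irank J)"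
        unfolding r irank_eq[OF a(3) az] using prec_add[OF ay(1) yz(5,7)] ay(2) by simp
      ultimately show ?thesis by blast
    qed
  }
next
  show "ointerval Or X X \<in> Istar Or X" using osqsub_refl[OF X] by (intro IstarI) auto
  show "irank (ointerval Or X X) = 0" using irank_eq[OF X] by simp
  fix J assume "J \<in> Istar Or X"
  then obtain y z where "J = ointerval Or y z" "y \<preceq> X" "X \<preceq> z" using Istar_cases[OF _ X] by metis
  then show "ointerval Or X X \<subseteq> J" by (simp add: ointerval_subset)
qed auto

end

section \<open>Lowering a path at a local maximum\<close>

text \<open>\<open>n\<close> only bounds the total length from above, and the initial vertex need not satisfy \<open>P\<close>.\<close>
inductive walk :: "('a \<Rightarrow> 'a \<Rightarrow> bool) \<Rightarrow> ('a \<Rightarrow> 'a \<Rightarrow> nat) \<Rightarrow> ('a \<Rightarrow> bool) \<Rightarrow> nat \<Rightarrow> 'a \<Rightarrow> 'a \<Rightarrow> bool"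
  for R :: "'a \<Rightarrow> 'a \<Rightarrow> bool" and \<delta> :: "'a \<Rightarrow> 'a \<Rightarrow> nat" and P :: "'a \<Rightarrow> bool" where
  nil: "walk R \<delta> P n x x"
| step: "\<lbrakk>R x y; P y; walk R \<delta> P n y z; \<delta> x y + n \<le> m\<rbrakk> \<Longrightarrow> walk R \<delta> P m x z"

lemma walk_mono_length:
  assumes "walk R \<delta> P n x y" "n \<le> m"
  shows "walk R \<delta> P m x y"
  using assms(1)
proof cases
  case nil
  then show ?thesis by (simp add: walk.nil)
next
  case (step y' n')
  then show ?thesis using assms(2) walk.step[of R x y' P \<delta> n' y m] by simp
qed

lemma walk_append: "walk R \<delta> P n x y \<Longrightarrow> walk R \<delta> P m y w \<Longrightarrow> walk R \<delta> P (n + m) x w"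
proof (induction rule: walk.induct)
  case (nil n x)
  then show ?case by (rule walk_mono_length) simp
next
  case (step x y n z k)
  then show ?case using walk.step[of R x y P \<delta> "n + m" w "k + m"] by simp
qed

lemma walk_single: "R x y \<Longrightarrow> P y \<Longrightarrow> walk R \<delta> P (\<delta> x y) x y"
  by (rule walk.step[OF _ _ walk.nil[of R \<delta> P 0]]) auto

context oriented_modular
begin

definition nbr :: "'a \<Rightarrow> 'a \<Rightarrow> bool" where
  "nbr x y \<longleftrightarrow> x \<in> V \<and> y \<in> V \<and> (x \<sqsubseteq> y \<or> y \<sqsubseteq> x)"

lemma nbr_dual: "oriented_modular.nbr V (\<lambda>x y. Or y x) = nbr"
proof (intro ext)
  fix x y
  show "oriented_modular.nbr V (\<lambda>x y. Or y x) x y = nbr x y"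
    unfolding nbr_def oriented_modular.nbr_def[OF dual] using osqsub_dual[of x y] osqsub_dual[of y x] by auto
qed

lemma Istar_dual: "X \<in> V \<Longrightarrow> Istar (\<lambda>x y. Or y x) X = Istar Or X"
proof -
  assume X: "X \<in> V"
  have "ointerval (\<lambda>x y. Or y x) z y = ointerval Or y z" for y z
    unfolding ointerval_def prec_dual by blast
  then show ?thesis
    unfolding Istar_def prec_dual using osqsub_dual prec_V[OF _ X] by blast
qed

lemma gstar_dual:
  assumes "J \<in> Istar Or X" "X \<in> V"
  shows "gstar (\<lambda>x y. Or y x) g J = gstar Or g J"
proof -
  obtain y z where *: "J = ointerval Or y z" "y \<sqsubseteq> z" "y \<in> V" "z \<in> V" using Istar_cases[OF assms] by metis
  have "ointerval (\<lambda>x y. Or y x) z y = J" unfolding ointerval_def prec_dual *(1) by blast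
  moreover have "osqsub (\<lambda>x y. Or y x) z y" using osqsub_dual *(2,3) by simp
  ultimately have "gstar (\<lambda>x y. Or y x) g J = (g z + g y) / 2"
    using oriented_modular.gstar_eq[OF dual _ *(4), of y g] by simp
  then show ?thesis using gstar_eq[OF *(2,3), of g] *(1) by (simp add: add.commute)
qed

end

locale locally_submodular = oriented_modular V E Or for V :: "'a set" and E Or +
  fixes g :: "'a \<Rightarrow> ereal"
  assumes g_not_minf: "v \<in> V \<Longrightarrow> g v \<noteq> -\<infinity>"
    and submod: "X \<in> V \<Longrightarrow> submodular_on (Istar Or X) (\<subseteq>) (gstar Or g)"
begin

text \<open>Reversal swaps the ends of an interval but keeps its underlying set and its value, so
  both inequalities have the same terms.\<close>

lemma locally_submodular_dual: "locally_submodular V E (\<lambda>x y. Or y x) g"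
proof -
  have "submodular_on (Istar (\<lambda>x y. Or y x) X) (\<subseteq>) (gstar (\<lambda>x y. Or y x) g)" if X: "X \<in> V" for X
  proof -
    interpret modular_semilattice "Istar Or X" "(\<subseteq>)" irank "(\<inter>)" "ointerval Or X X"
      by (rule Istar_modular_semilattice[OF X])
    have "f p + f q \<ge> f (smeet (Istar Or X) (\<subseteq>) p q) +
        (\<Sum>u \<in> {u \<in> Eset (Istar Or X) (\<subseteq>) p q. cone_measure (Ccone (Istar Or X) (\<subseteq>) u p q) \<noteq> 0}.
          ereal (cone_measure (Ccone (Istar Or X) (\<subseteq>) u p q)) * f u)"
      if f: "f = gstar (\<lambda>x y. Or y x) g" and p: "p \<in> Istar Or X" and q: "q \<in> Istar Or X" for f p q
    proof -
      have e: "f u = gstar Or g u" if "u \<in> Istar Or X" for u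
        using gstar_dual[OF that X] f by simp
      have m: "smeet (Istar Or X) (\<subseteq>) p q \<in> Istar Or X" using smeet_eq[OF p q] mt_in[OF p q] by simp
      have "(\<Sum>u \<in> support p q. ereal (cone_measure (Ccone (Istar Or X) (\<subseteq>) u p q)) * f u) =
        (\<Sum>u \<in> support p q. ereal (cone_measure (Ccone (Istar Or X) (\<subseteq>) u p q)) * gstar Or g u)"
        using e cintD(1)[OF p q support_coeff(1)[OF p q]] by (intro sum.cong) auto
      then show ?thesis
        using submod[OF X] p q e[OF p] e[OF q] e[OF m]
        unfolding submodular_on_def support_def[OF p q] by simp
    qed
    then show ?thesis unfolding submodular_on_def Istar_dual[OF X] by blast
  qed
  then show ?thesis
    using dual g_not_minf by (intro locally_submodular.intro locally_submodular_axioms.intro) auto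
qed

abbreviation below :: "real \<Rightarrow> nat \<Rightarrow> 'a \<Rightarrow> 'a \<Rightarrow> bool" where
  "below c \<equiv> walk nbr d (\<lambda>v. g v < ereal c)"

lemma below_single: "nbr x y \<Longrightarrow> g y < ereal c \<Longrightarrow> below c (d x y) x y"
  by (rule walk_single)

lemma below_trans: "below c n x y \<Longrightarrow> below c m y z \<Longrightarrow> n + m = k \<Longrightarrow> below c k x z"
  using walk_append[of nbr d _ n x y m z] by simp

section \<open>Detours around a vertex of value c\<close>

context
  fixes X c assumes X: "X \<in> V" and gX: "g X = ereal c"
begin

interpretation S: modular_semilattice "Istar Or X" "(\<subseteq>)" irank "(\<inter>)" "ointerval Or X X"
  by (rule Istar_modular_semilattice[OF X])

text \<open>\<open>U1\<close> and \<open>U2\<close> collect intervals whose value may be lowered by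
  an end A or B. If no supported interval undercut the value explained in this way, submodularity
  would give (1 - m1)(c - a) + (1 - m2)(c - b) \<le> 0 for the total weights m1, m2 of
  \<open>U1\<close>, \<open>U2\<close>. But \<open>u0\<close> makes m2 < 1, and b < c.\<close>

lemma exceptional:
  assumes p: "p \<in> Istar Or X" and q: "q \<in> Istar Or X"
    and val: "gstar Or g p + gstar Or g q = ereal ((a + b + 2 * c) / 2)"
    and m: "gstar Or g (p \<inter> q) \<ge> ereal c"
    and ab: "a \<le> c" "b < c" and u0: "u0 \<in> S.support p q" "u0 \<notin> U2"
  obtains u r where "u \<in> S.support p q" "gstar Or g u = ereal r"
    "2 * r < 2 * c - (if u \<in> U1 then c - a else 0) - (if u \<in> U2 then c - b else 0)"
proof (rule ccontr)
  note elim = that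
  assume no: "\<not> thesis"
  define lam where "lam u = cone_measure (Ccone (Istar Or X) (\<subseteq>) u p q)" for u
  define i1 where "i1 u = (if u \<in> U1 then 1 else 0::real)" for u
  define i2 where "i2 u = (if u \<in> U2 then 1 else 0::real)" for u
  \<comment> \<open>The value explained by A and B alone: an end counts as c unless membership in
    \<open>U1\<close> or \<open>U2\<close> replaces it by a or b.\<close>
  define h where "h u = c - i1 u * ((c - a) / 2) - i2 u * ((c - b) / 2)" for u
  note fin = S.finite_support[OF p q] and sum1 = S.support_sum[OF p q, folded lam_def]
  have lam: "lam u > 0" if "u \<in> S.support p q" for u
    using S.support_coeff(3)[OF p q that] by (simp add: lam_def)
  have hle: "ereal (lam u * h u) \<le> ereal (lam u) * gstar Or g u" if u: "u \<in> S.support p q" for u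
  proof -
    have uI: "u \<in> Istar Or X" using S.cintD(1)[OF p q S.support_coeff(1)[OF p q u]] .
    obtain y z where yz: "u = ointerval Or y z" "y \<sqsubseteq> z" "y \<in> V" "z \<in> V" using Istar_cases[OF uI X] by metis
    have gu: "gstar Or g u = (g y + g z) / 2" unfolding yz(1) by (rule gstar_eq[OF yz(2,3)])
    have "ereal (h u) \<le> gstar Or g u"
    proof (cases "gstar Or g u")
      case (real r)
      then have "\<not> 2 * r < 2 * c - (if u \<in> U1 then c - a else 0) - (if u \<in> U2 then c - b else 0)"
        using no elim[of u r] u by blast
      then have "h u \<le> r" by (auto simp: h_def i1_def i2_def field_simps split: if_splits)
      then show ?thesis using real by simp
    next
      case MInf
      then have "g y = -\<infinity> \<or> g z = -\<infinity>" unfolding gu by (cases "g y"; cases "g z") auto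
      then show ?thesis using g_not_minf yz by auto
    qed simp
    then have "ereal (lam u) * ereal (h u) \<le> ereal (lam u) * gstar Or g u"
      using lam[OF u] by (intro ereal_mult_left_mono) auto
    then show ?thesis by simp
  qed
  have "gstar Or g (smeet (Istar Or X) (\<subseteq>) p q) + (\<Sum>u\<in>S.support p q. ereal (lam u) * gstar Or g u)
      \<le> gstar Or g p + gstar Or g q"
    using submod[OF X] p q unfolding submodular_on_def S.support_def[OF p q] lam_def by blast
  then have "gstar Or g (p \<inter> q) + (\<Sum>u\<in>S.support p q. ereal (lam u) * gstar Or g u)
      \<le> ereal ((a + b + 2 * c) / 2)"
    unfolding S.smeet_eq[OF p q] val .
  moreover have "ereal (\<Sum>u\<in>S.support p q. lam u * h u) \<le> (\<Sum>u\<in>S.support p q. ereal (lam u) * gstar Or g u)"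
    using sum_mono[of "S.support p q", OF hle] by simp
  then have "ereal c + ereal (\<Sum>u\<in>S.support p q. lam u * h u)
      \<le> gstar Or g (p \<inter> q) + (\<Sum>u\<in>S.support p q. ereal (lam u) * gstar Or g u)"
    by (rule add_mono[OF m])
  ultimately have "ereal c + ereal (\<Sum>u\<in>S.support p q. lam u * h u) \<le> ereal ((a + b + 2 * c) / 2)"
    by (rule order_trans[rotated])
  then have le: "c + (\<Sum>u\<in>S.support p q. lam u * h u) \<le> (a + b + 2 * c) / 2" by simp
  define m1 where "m1 = (\<Sum>u\<in>S.support p q. lam u * i1 u)"
  define m2 where "m2 = (\<Sum>u\<in>S.support p q. lam u * i2 u)"
  have "(\<Sum>u\<in>S.support p q. lam u * h u) =
    (\<Sum>u\<in>S.support p q. c * lam u - (lam u * i1 u) * ((c - a) / 2) - (lam u * i2 u) * ((c - b) / 2))"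
    by (intro sum.cong) (auto simp: h_def algebra_simps)
  also have "\<dots> = c - m1 * ((c - a) / 2) - m2 * ((c - b) / 2)"
    unfolding sum_subtractf sum_distrib_left[symmetric] sum_distrib_right[symmetric] sum1 m1_def m2_def by simp
  finally have "(1 - m1) * (c - a) + (1 - m2) * (c - b) \<le> 0" using le by (simp add: field_simps)
  moreover have "m1 \<le> 1"
    unfolding m1_def sum1[symmetric] by (intro sum_mono) (use lam in \<open>auto simp: i1_def less_imp_le\<close>)
  moreover have "m2 < 1"
    unfolding m2_def sum1[symmetric]
    by (rule sum_strict_mono_ex1[OF fin]) (use lam u0 in \<open>auto simp: i2_def less_imp_le\<close>)
  ultimately show False using ab
    by (smt (verit) mult_nonneg_nonneg mult_pos_pos)
qed

lemma finite_value: "v \<in> V \<Longrightarrow> g v \<le> ereal c \<Longrightarrow> \<exists>r. g v = ereal r"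
  using g_not_minf[of v] by (cases "g v") auto

lemma real_pair:
  assumes "y \<in> V" "z \<in> V" "(g y + g z) / 2 = ereal r"
  obtains s t where "g y = ereal s" "g z = ereal t" "s + t = 2 * r"
proof -
  obtain s t where "g y = ereal s" "g z = ereal t"
    using assms g_not_minf by (cases "g y"; cases "g z") auto
  then show ?thesis using that[of s t] assms(3) by (auto simp: field_simps)
qed

lemma nbrI: "x \<sqsubseteq> y \<Longrightarrow> y \<in> V \<Longrightarrow> nbr x y" "x \<sqsubseteq> y \<Longrightarrow> y \<in> V \<Longrightarrow> nbr y x"
  unfolding nbr_def using prec_V[OF osqsub_prec] by auto

text \<open>Submodularity is applied to [A, X] and [X, B], which meet in [X, X] of value c.
  Supported intervals lie in [A, B], and none is [A, B] itself unless A \<sqsubseteq> B. Hence an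
  exceptional [y, z] has an end below c other than A and B; it lies on a geodesic from A to B and
  splits the problem into shorter ones and single steps.\<close>

lemma below_up:
  assumes "A \<sqsubseteq> X" "X \<sqsubseteq> B" "g A \<le> ereal c" "g B < ereal c"
  shows "below c (d A B) A B"
  using assms
proof (induction "d A B" arbitrary: A B rule: less_induct)
  case less
  have AX: "A \<preceq> X" and XB: "X \<preceq> B" using less.prems osqsub_prec by auto
  have AV: "A \<in> V" and BV: "B \<in> V" using prec_V[OF AX X] prec_V'[OF XB X] .
  have AB: "A \<preceq> B" using prec_trans[OF AX XB] .
  have gA: "g A \<le> ereal c" and gB: "g B < ereal c" using less.prems by auto
  obtain a where a: "g A = ereal a" using finite_value[OF AV gA] by blast
  obtain b where b: "g B = ereal b" using finite_value[OF BV less_imp_le[OF gB]] by blast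
  define p where "p = ointerval Or A X"
  define q where "q = ointerval Or X B"
  have p: "p \<in> Istar Or X" unfolding p_def using less.prems(1) AX prec_refl by (rule IstarI)
  have q: "q \<in> Istar Or X" unfolding q_def using less.prems(2) prec_refl XB by (rule IstarI)
  have pq: "p \<inter> q = ointerval Or X X"
    unfolding p_def q_def ointerval_def using prec_trans[OF AX] prec_trans[OF _ XB] by blast
  have val: "gstar Or g p + gstar Or g q = ereal ((a + b + 2 * c) / 2)"
    unfolding p_def q_def gstar_eq[OF less.prems(1) AV] gstar_eq[OF less.prems(2) X] a b gX
    by (simp add: field_simps)
  have m: "gstar Or g (p \<inter> q) \<ge> ereal c"
    unfolding pq gstar_eq[OF osqsub_refl[OF X] X] gX by simp
  \<comment> \<open>An element of I(p, q) is the join of its intersections with p and q, and its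
    part inside [A, B] already contains both.\<close>
  have shape: "\<exists>y z. u = ointerval Or y z \<and> y \<sqsubseteq> z \<and> y \<preceq> X \<and> X \<preceq> z \<and> A \<preceq> y \<and> z \<preceq> B \<and> y \<in> V \<and> z \<in> V"
    if u: "u \<in> S.support p q" for u
  proof -
    have uc: "u \<in> cint (Istar Or X) (\<subseteq>) p q" using S.support_coeff(1)[OF p q u] .
    obtain y z where yz: "u = ointerval Or y z" "y \<sqsubseteq> z" "y \<preceq> X" "X \<preceq> z" "y \<preceq> z" "y \<in> V" "z \<in> V"
      using Istar_cases[OF S.cintD(1)[OF p q uc] X] .
    note J = join[OF yz(6) AV yz(3) AX] and M = meet[OF yz(7) BV yz(4) XB]
    have "join y A \<sqsubseteq> meet z B"
      by (rule osqsub_sub[OF M(5) yz(2) J(1) prec_trans[OF J(6) M(6)] M(1)])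
    then have w: "ointerval Or (join y A) (meet z B) \<in> Istar Or X" using J(6) M(6) by (rule IstarI)
    have "u \<inter> p \<subseteq> ointerval Or (join y A) (meet z B)"
      unfolding yz(1) p_def ointerval_def using J(4) prec_trans[OF _ M(6)] by blast
    moreover have "u \<inter> q \<subseteq> ointerval Or (join y A) (meet z B)"
      unfolding yz(1) q_def ointerval_def using M(4) prec_trans[OF J(6)] by blast
    ultimately have "u \<subseteq> ointerval Or (join y A) (meet z B)" by (rule S.cintD(4)[OF p q uc w])
    then have "join y A \<preceq> y" "z \<preceq> meet z B" unfolding yz(1) ointerval_subset[OF yz(5)] by auto
    then have "A \<preceq> y" "z \<preceq> B" using prec_trans[OF J(2)] prec_trans[OF _ M(2)] by blast+
    then show ?thesis using yz by blast
  qed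
  have pu: "p \<subseteq> ointerval Or y z \<longleftrightarrow> y = A" and qu: "q \<subseteq> ointerval Or y z \<longleftrightarrow> z = B"
    if "y \<preceq> X" "X \<preceq> z" "A \<preceq> y" "z \<preceq> B" for y z
    unfolding p_def q_def ointerval_subset[OF AX] ointerval_subset[OF XB]
    using that prec_antisym[OF that(3) _ AV] prec_antisym[OF _ that(4), of] BV by auto
  show ?case
  proof (cases "A \<sqsubseteq> B")
    case True
    then show ?thesis using below_single[of A B] nbrI(1)[OF True BV] gB by blast
  next
    case False
    obtain u0 where u0: "u0 \<in> S.support p q" "p \<subseteq> u0" using S.support_above(1)[OF p q] by blast
    \<comment> \<open>An interval containing both p and q would be [A, B], excluded in this
      case.\<close>
    have "\<not> q \<subseteq> u0"
    proof
      assume "q \<subseteq> u0"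
      then show False using shape[OF u0(1)] u0(2) pu qu False by metis
    qed
    then obtain u r where u: "u \<in> S.support p q" "gstar Or g u = ereal r"
      "2 * r < 2 * c - (if u \<in> {u. p \<subseteq> u} then c - a else 0) - (if u \<in> {u. q \<subseteq> u} then c - b else 0)"
      using exceptional[OF p q val m, of u0 "{u. q \<subseteq> u}" "{u. p \<subseteq> u}"] gA gB u0(1) unfolding a b by auto
    obtain y z where yz: "u = ointerval Or y z" "y \<sqsubseteq> z" "y \<preceq> X" "X \<preceq> z" "A \<preceq> y" "z \<preceq> B" "y \<in> V" "z \<in> V"
      using shape[OF u(1)] by blast
    obtain s t where st: "g y = ereal s" "g z = ereal t" "s + t = 2 * r"
      using real_pair[OF yz(7,8)] u(2) gstar_eq[OF yz(2,7), of g] unfolding yz(1) by metis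
    have bound: "s + t < 2 * c - (if y = A then c - a else 0) - (if z = B then c - b else 0)"
      using u(3) st(3) pu[OF yz(3-6)] qu[OF yz(3-6)] unfolding yz(1) by simp
    have "\<not> (y = A \<and> z = B)" using False yz(2) by blast
    have Ay: "A \<sqsubseteq> y" using osqsub_sub[OF yz(7) less.prems(1) prec_refl yz(5,3)] .
    have yX: "y \<sqsubseteq> X" using osqsub_sub[OF X less.prems(1) yz(5,3) prec_refl] .
    have zB: "z \<sqsubseteq> B" using osqsub_sub[OF BV less.prems(2) yz(4,6) prec_refl] .
    have Xz: "X \<sqsubseteq> z" using osqsub_sub[OF yz(8) less.prems(2) prec_refl yz(4,6)] .
    have Az: "A \<preceq> z" and yB: "y \<preceq> B" using prec_trans[OF AX yz(4)] prec_trans[OF yz(3) XB] .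
    have dA: "d A y + d y B = d A B" "d A z + d z B = d A B" "d A y + d y z = d A z"
      using prec_add[OF yz(5) yB BV] prec_add[OF Az yz(6) BV] prec_add[OF yz(5) osqsub_prec[OF yz(2)] yz(8)] .
    have wz: "below c (d z B) z B" using below_single[of z B] nbrI(1)[OF zB BV] gB by blast
    have wy: "below c (d A y) A y" if "s < c" using below_single[of A y] nbrI(1)[OF Ay yz(7)] st(1) that by simp
    \<comment> \<open>If z is low, the detour runs through z, or through y when z = B. If z is not
      low, \<open>bound\<close> forces y to be low and different from A.\<close>
    show ?thesis
    proof (cases "t < c")
      case tc: True
      have "below c (d A z) A z"
      proof (cases "z = B")
        case True
        then have yA: "y \<noteq> A" using \<open>\<not> (y = A \<and> z = B)\<close> by blast
        then have "s < c" using bound True st(2) b by simp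
        then have "below c (d A y) A y" by (rule wy)
        moreover have "below c (d y z) y z" using below_single[of y z] nbrI(1)[OF yz(2,8)] st(2) tc by simp
        ultimately show ?thesis using dA(3) by (rule below_trans)
      next
        case False
        then have "d z B \<noteq> 0" using prec_d_eq[OF yz(6) BV] by simp
        then have "d A z < d A B" using dA(2) by linarith
        then show ?thesis using less.hyps[of A z] less.prems(1) Xz gA st(2) tc by simp
      qed
      then show ?thesis using wz dA(2) by (rule below_trans)
    next
      case False
      have "s < c"
      proof (cases "y = A")
        case True
        then have "z \<noteq> B" using \<open>\<not> (y = A \<and> z = B)\<close> by blast
        then show ?thesis using bound True st(1) a False by simp
      next
        case neq: False
        then show ?thesis using bound False gB b by (auto split: if_splits)
      qed
      have "y \<noteq> A"
      proof
        assume "y = A"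
        then show False using bound st(1) a False \<open>\<not> (y = A \<and> z = B)\<close> by simp
      qed
      then have "d A y \<noteq> 0" using prec_d_eq[OF yz(5,7)] by simp
      then have "d y B < d A B" using dA(1) by linarith
      then have "below c (d y B) y B" using less.hyps[of y B] yX less.prems(2) gB st(1) \<open>s < c\<close> by simp
      with wy[OF \<open>s < c\<close>] show ?thesis using dA(1) by (rule below_trans)
    qed
  qed
qed

text \<open>Here the intervals [X, A] and [X, B] meet in [X, \<open>meet A B\<close>]. Unless
  \<open>meet A B\<close> is already low, supported intervals have the form [X, z] with z on a
  geodesic from A to B; as g X = c, an exceptional one has g z < c with z different from A and
  B.\<close>

lemma below_fork:
  assumes "X \<sqsubseteq> A" "X \<sqsubseteq> B" "g A \<le> ereal c" "g B < ereal c"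
  shows "below c (d A B) A B"
  using assms
proof (induction "d A B" arbitrary: A B rule: less_induct)
  case less
  have XA: "X \<preceq> A" and XB: "X \<preceq> B" using less.prems osqsub_prec by auto
  have AV: "A \<in> V" and BV: "B \<in> V" using prec_V'[OF XA X] prec_V'[OF XB X] .
  have gA: "g A \<le> ereal c" and gB: "g B < ereal c" using less.prems by auto
  obtain a where a: "g A = ereal a" using finite_value[OF AV gA] by blast
  obtain b where b: "g B = ereal b" using finite_value[OF BV less_imp_le[OF gB]] by blast
  define p where "p = ointerval Or X A"
  define q where "q = ointerval Or X B"
  have p: "p \<in> Istar Or X" unfolding p_def using less.prems(1) prec_refl XA by (rule IstarI)
  have q: "q \<in> Istar Or X" unfolding q_def using less.prems(2) prec_refl XB by (rule IstarI)
  note C = meet[OF AV BV XA XB]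
  let ?C = "meet A B"
  have pq: "p \<inter> q = ointerval Or X ?C"
    unfolding p_def q_def ointerval_def using C(4) prec_trans[OF _ C(1)] prec_trans[OF _ C(2)] by blast
  have XC: "X \<sqsubseteq> ?C" using osqsub_sub[OF C(5) less.prems(1) prec_refl C(6,1)] .
  have CA: "?C \<sqsubseteq> A" using osqsub_sub[OF AV less.prems(1) C(6,1) prec_refl] .
  have CB: "?C \<sqsubseteq> B" using osqsub_sub[OF BV less.prems(2) C(6,2) prec_refl] .
  \<comment> \<open>A low meet serves as the detour; otherwise its value supplies the lower bound on
    \<open>gstar\<close> at the intersection that \<open>exceptional\<close> requires.\<close>
  show ?case
  proof (cases "g ?C < ereal c")
    case True
    have "below c (d A ?C) A ?C" using below_single[of A ?C] nbrI(2)[OF CA AV] True by simp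
    moreover have "below c (d ?C B) ?C B" using below_single[of ?C B] nbrI(1)[OF CB BV] gB by simp
    ultimately show ?thesis using below_trans C(3) d_comm[of A ?C] by metis
  next
    case gC: False
    have val: "gstar Or g p + gstar Or g q = ereal ((a + b + 2 * c) / 2)"
      unfolding p_def q_def gstar_eq[OF less.prems(1) X] gstar_eq[OF less.prems(2) X] a b gX
      by (simp add: field_simps)
    have m: "gstar Or g (p \<inter> q) \<ge> ereal c"
      unfolding pq gstar_eq[OF XC X] gX using gC by (cases "g ?C") auto
    show ?thesis
    proof (cases "A \<preceq> B")
      case True
      have "A \<sqsubseteq> B" using osqsub_sub[OF BV less.prems(2) XA True prec_refl] .
      then show ?thesis using below_single[of A B] nbrI(1)[OF _ BV] gB by blast
    next
      case nAB: False
      obtain u0 where u0: "u0 \<in> S.support p q" "p \<subseteq> u0" using S.support_above(1)[OF p q] by blast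
      have "u0 \<notin> {q}"
        using u0(2) nAB unfolding p_def q_def ointerval_subset[OF XA] singleton_iff
        by (metis ointerval_subset[OF XA])
      then obtain u r where u: "u \<in> S.support p q" "gstar Or g u = ereal r"
        "2 * r < 2 * c - (if u \<in> {p} then c - a else 0) - (if u \<in> {q} then c - b else 0)"
        using exceptional[OF p q val m, of u0 "{q}" "{p}"] gA gB u0(1) unfolding a b by auto
      have uc: "u \<in> cint (Istar Or X) (\<subseteq>) p q" using S.support_coeff(1)[OF p q u(1)] .
      obtain y z where yz: "u = ointerval Or y z" "y \<sqsubseteq> z" "y \<preceq> X" "X \<preceq> z" "y \<preceq> z" "y \<in> V" "z \<in> V"
        using Istar_cases[OF S.cintD(1)[OF p q uc] X] .
      have Xz: "X \<sqsubseteq> z" using osqsub_sub[OF yz(7,2,3,4) prec_refl] .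
      have w: "ointerval Or X z \<in> Istar Or X" using Xz prec_refl yz(4) by (rule IstarI)
      have "u \<subseteq> ointerval Or X z"
        by (rule S.cintD(4)[OF p q uc w]) (auto simp: yz(1) p_def q_def ointerval_iff)
      then have "X \<preceq> y" unfolding yz(1) ointerval_subset[OF yz(5)] by simp
      then have yX: "y = X" using prec_antisym[OF yz(3) _ yz(6)] by simp
      note M1 = meet[OF yz(7) AV yz(4) XA] and M2 = meet[OF yz(7) BV yz(4) XB]
      have int: "u \<inter> p = ointerval Or X (meet z A)" "u \<inter> q = ointerval Or X (meet z B)"
        unfolding yz(1) yX p_def q_def ointerval_def
        using M1(4) prec_trans[OF _ M1(1)] prec_trans[OF _ M1(2)]
          M2(4) prec_trans[OF _ M2(1)] prec_trans[OF _ M2(2)] by blast+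
      \<comment> \<open>The rank equation characterising I(p, q), read in distances, places z on a
        geodesic from A to B.\<close>
      have "d X (meet z A) + d X (meet z B) = d X z + d X ?C"
        using S.cintD(3)[OF p q uc] unfolding int pq
        unfolding yz(1) yX irank_eq[OF X M1(6)] irank_eq[OF X M2(6)] irank_eq[OF X yz(4)] irank_eq[OF X C(6)] .
      then have dz: "d A z + d z B = d A B"
        using M1(3) M2(3) C(3) prec_add[OF M1(6,1) yz(7)] prec_add[OF M1(6,2) AV]
          prec_add[OF M2(6,1) yz(7)] prec_add[OF M2(6,2) BV] prec_add[OF C(6,1) AV] prec_add[OF C(6,2) BV]
          d_comm[of A z] by linarith
      obtain s t where st: "g y = ereal s" "g z = ereal t" "s + t = 2 * r"
        using real_pair[OF yz(6,7)] u(2) gstar_eq[OF yz(2,6), of g] unfolding yz(1) by metis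
      have sc: "s = c" using st(1) gX yX by simp
      have ac: "a \<le> c" and bc: "b < c" using gA gB a b by auto
      \<comment> \<open>For u = p or u = q the inequality for r would read c + a < c + a or c + b <
        c + b.\<close>
      have zA: "z \<noteq> A" using u(3) st a sc bc yX yz(1) by (auto simp: p_def split: if_splits)
      have zB: "z \<noteq> B" using u(3) st b sc ac yX yz(1) by (auto simp: q_def split: if_splits)
      have tc: "t < c" using u(3) st(3) sc ac bc by (auto split: if_splits)
      have "d A z \<noteq> 0" "d z B \<noteq> 0" using d_zero AV BV yz(7) zA zB by auto
      then have "d A z < d A B" "d z B < d A B" using dz by linarith+
      then have "below c (d A z) A z" "below c (d z B) z B"
        using less.hyps[of A z] less.hyps[of z B] less.prems Xz st(2) tc by auto
      then show ?thesis using dz by (rule below_trans)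
    qed
  qed
qed

end

text \<open>Reversing the orientation exchanges the two kinds of fork and turns descent into ascent,
  so four configurations reduce to two. The detour has length d A B, at most that of the replaced
  piece.\<close>

lemma below_local:
  assumes "g X = ereal c" "nbr A X" "nbr X B" "g A \<le> ereal c" "g B < ereal c"
  shows "below c (d A X + d X B) A B"
proof -
  have V: "A \<in> V" "X \<in> V" "B \<in> V" using assms unfolding nbr_def by auto
  interpret dl: locally_submodular V E "\<lambda>x y. Or y x" g by (rule locally_submodular_dual)
  consider "A \<sqsubseteq> X" "X \<sqsubseteq> B" | "X \<sqsubseteq> A" "X \<sqsubseteq> B" | "X \<sqsubseteq> A" "B \<sqsubseteq> X" | "A \<sqsubseteq> X" "B \<sqsubseteq> X"
    using assms unfolding nbr_def by blast
  then have "below c (d A B) A B"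
  proof cases
    case 1 then show ?thesis using below_up[OF V(2) assms(1)] assms by blast
  next
    case 2 then show ?thesis using below_fork[OF V(2) assms(1)] assms by blast
  next
    case 3
    then show ?thesis
      using dl.below_up[OF V(2) assms(1), of A B, unfolded nbr_dual] assms osqsub_dual V by blast
  next
    case 4
    then show ?thesis
      using dl.below_fork[OF V(2) assms(1), of A B, unfolded nbr_dual] assms osqsub_dual V by blast
  qed
  then show ?thesis using d_tri[OF V] by (rule walk_mono_length)
qed

text \<open>The walk is repaired from its far end: the tail after \<open>x1\<close> is already
  strictly below c, so if \<open>x1\<close> has value c its successor is strictly lower and
  \<open>below_local\<close> applies. This is why only the second neighbour is required to be
  strictly below c there.\<close>

lemma below_level:
  assumes "walk nbr d (\<lambda>v. g v \<le> ereal c) n x y" "g x \<le> ereal c" "g y < ereal c"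
  shows "below c n x y"
  using assms
proof (induction rule: walk.induct)
  case (nil n x)
  then show ?case by (simp add: walk.nil)
next
  case (step x x1 n y m)
  then have IH: "below c n x1 y" by blast
  show ?case
  proof (cases "g x1 < ereal c")
    case True
    then show ?thesis using walk.step[OF step.hyps(1) _ IH step.hyps(4)] by simp
  next
    case False
    then have gx1: "g x1 = ereal c" using step.hyps(2) by simp
    from IH show ?thesis
    proof (cases rule: walk.cases)
      case nil
      then show ?thesis using step.prems False by simp
    next
      case (step x2 k)
      have "below c (d x x1 + d x1 x2) x x2"
        using below_local[OF gx1 \<open>nbr x x1\<close> step(1) \<open>g x \<le> ereal c\<close> step(2)] .
      then have "below c (d x x1 + d x1 x2 + k) x y" using step(3) by (rule walk_append)
      moreover have "d x x1 + d x1 x2 + k \<le> m" using step(4) \<open>d x x1 + n \<le> m\<close> by linarith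
      ultimately show ?thesis by (rule walk_mono_length)
    qed
  qed
qed

end

section \<open>From local to global minimality\<close>

context locally_submodular
begin

text \<open>By the triangle inequality the walk never leaves the ball of radius L, so the two vertex
  conditions need to be compared only there. Finiteness of values on a ball thus acts on
  walks.\<close>

lemma walk_weaken:
  assumes "walk nbr d P n x y"
    and "x\<^sub>0 \<in> V" "d x\<^sub>0 x + n \<le> L" "\<And>v. v \<in> V \<Longrightarrow> d x\<^sub>0 v \<le> L \<Longrightarrow> P v \<Longrightarrow> Q v"
  shows "walk nbr d Q n x y"
  using assms
proof (induction rule: walk.induct)
  case (nil n x)
  show ?case by (rule walk.nil)
next
  case (step x y n z m)
  have V: "x \<in> V" "y \<in> V" using step.hyps(1) by (auto simp: nbr_def)
  have tri: "d x\<^sub>0 y \<le> d x\<^sub>0 x + d x y" using d_tri[OF step.prems(1) V] .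
  then have "walk nbr d Q n y z" using step.IH step.prems step.hyps(4) by simp
  moreover have "Q y" using step.prems(2,3) step.hyps(2,4) V(2) tri by simp
  ultimately show ?case using walk.step[of nbr x y Q d n z m] step.hyps by blast
qed

lemma finite_ball:
  assumes "\<forall>v\<in>V. finite {w. E v w}" "x \<in> V"
  shows "finite {v \<in> V. d x v \<le> n}"
proof (induction n)
  case 0
  have "{v \<in> V. d x v \<le> 0} \<subseteq> {x}" using d_zero[OF assms(2)] by auto
  then show ?case using finite_subset by blast
next
  case (Suc n)
  have "{v \<in> V. d x v \<le> Suc n} \<subseteq> {v \<in> V. d x v \<le> n} \<union> (\<Union>v\<in>{v \<in> V. d x v \<le> n}. {w. E v w})"
  proof
    fix v assume "v \<in> {v \<in> V. d x v \<le> Suc n}"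
    then have v: "v \<in> V" "d x v \<le> Suc n" by auto
    show "v \<in> {v \<in> V. d x v \<le> n} \<union> (\<Union>v\<in>{v \<in> V. d x v \<le> n}. {w. E v w})"
    proof (cases "d x v \<le> n")
      case False
      then have "d v x = Suc n" using v(2) d_comm[of v x] by simp
      then obtain u where u: "E v u" "d u x = n" "u \<in> V" using d_step[OF v(1) assms(2)] by metis
      then show ?thesis using E_sym[OF u(1)] d_comm[of u x] by auto
    qed (use v in auto)
  qed
  moreover have "finite \<dots>" using Suc assms(1) by auto
  ultimately show ?case by (rule finite_subset)
qed

text \<open>Local finiteness makes the ball finite, discreteness makes the set of values in [a, b]
  finite; counting values on a ball serves both alternatives.\<close>

lemma finite_levels:
  assumes "(\<forall>v\<in>V. finite {w. E v w}) \<or>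
      (\<exists>\<epsilon>::real>0. \<forall>v\<in>V. {t \<in> g ` V. g v - ereal \<epsilon> \<le> t \<and> t \<le> g v + ereal \<epsilon>} = {g v})"
    and x: "x \<in> V"
  shows "finite {t \<in> g ` {v \<in> V. d x v \<le> n}. ereal a \<le> t \<and> t \<le> ereal b}"
  using assms(1)
proof
  assume "\<forall>v\<in>V. finite {w. E v w}"
  then have "finite {v \<in> V. d x v \<le> n}" using x by (rule finite_ball)
  then show ?thesis by simp
next
  assume "\<exists>\<epsilon>::real>0. \<forall>v\<in>V. {t \<in> g ` V. g v - ereal \<epsilon> \<le> t \<and> t \<le> g v + ereal \<epsilon>} = {g v}"
  then obtain \<epsilon> :: real where e: "\<epsilon> > 0"
    "\<forall>v\<in>V. {t \<in> g ` V. g v - ereal \<epsilon> \<le> t \<and> t \<le> g v + ereal \<epsilon>} = {g v}" by blast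
  define T where "T = {r. ereal r \<in> g ` V \<and> a \<le> r \<and> r \<le> b}"
  \<comment> \<open>Numbers half-open cells of length \<open>\<epsilon>\<close>; distinct values of
    g never share a cell.\<close>
  define k where "k r = \<lfloor>(r - a) / \<epsilon>\<rfloor>" for r
  have "inj_on k T"
  proof (rule inj_onI)
    fix r s assume r: "r \<in> T" and s: "s \<in> T" and eq: "k r = k s"
    have "\<bar>(r - a) / \<epsilon> - (s - a) / \<epsilon>\<bar> < 1" using eq unfolding k_def by linarith
    then have "\<bar>(r - s) / \<epsilon>\<bar> < 1" by (simp add: diff_divide_distrib)
    then have "\<bar>r - s\<bar> < \<epsilon>" using e(1) by (simp add: abs_divide)
    moreover obtain v where v: "v \<in> V" "g v = ereal r" using r unfolding T_def by auto
    ultimately have "ereal s \<in> {t \<in> g ` V. g v - ereal \<epsilon> \<le> t \<and> t \<le> g v + ereal \<epsilon>}"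
      using s unfolding T_def by auto
    then have "ereal s = g v" using e(2) v(1) by blast
    then show "r = s" using v(2) by simp
  qed
  moreover have "k ` T \<subseteq> {0..\<lfloor>(b - a) / \<epsilon>\<rfloor>}"
    using e(1) by (auto simp: T_def k_def intro!: floor_mono divide_right_mono)
  ultimately have "finite T" using inj_on_finite finite_atLeastAtMost_int by blast
  moreover have "{t \<in> g ` {v \<in> V. d x v \<le> n}. ereal a \<le> t \<and> t \<le> ereal b} \<subseteq> ereal ` T"
  proof
    fix t assume t: "t \<in> {t \<in> g ` {v \<in> V. d x v \<le> n}. ereal a \<le> t \<and> t \<le> ereal b}"
    then obtain r where "t = ereal r" by (cases t) auto
    then show "t \<in> ereal ` T" using t unfolding T_def by auto
  qed
  ultimately show ?thesis using finite_subset by blast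
qed

lemma delta_path_walk:
  "delta_path Or S xs \<Longrightarrow> S \<subseteq> V \<Longrightarrow> \<exists>n. walk nbr d (\<lambda>v. v \<in> S) n (hd xs) (last xs)"
proof (induction xs)
  case Nil
  then show ?case by (simp add: delta_path_def)
next
  case (Cons a xs)
  show ?case
  proof (cases xs)
    case Nil
    then show ?thesis using walk.nil[of nbr d] by auto
  next
    case (Cons b ys)
    have dp: "set (a # xs) \<subseteq> S"
      "\<And>i. i < length xs \<Longrightarrow> (a # xs) ! i \<sqsubseteq> (a # xs) ! Suc i \<or> (a # xs) ! Suc i \<sqsubseteq> (a # xs) ! i"
      using Cons.prems(1) by (auto simp: delta_path_def)
    have "a \<sqsubseteq> b \<or> b \<sqsubseteq> a" using dp(2)[of 0] Cons by simp
    then have "nbr a b" using dp(1) Cons.prems(2) Cons by (auto simp: nbr_def)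
    moreover have "delta_path Or S xs"
      unfolding delta_path_def using dp(1) dp(2)[of "Suc _"] Cons by auto
    then obtain n where "walk nbr d (\<lambda>v. v \<in> S) n b (last xs)"
      using Cons.IH[OF _ Cons.prems(2)] Cons by auto
    ultimately have "walk nbr d (\<lambda>v. v \<in> S) (d a b + n) a (last xs)"
      using dp(1) Cons by (intro walk.step[of nbr a b _ d n]) auto
    then show ?thesis using Cons by auto
  qed
qed

lemma walk_bounded:
  "walk nbr d (\<lambda>v. v \<in> gdom V g) n x y \<Longrightarrow> \<exists>c. walk nbr d (\<lambda>v. g v \<le> ereal c) n x y"
proof (induction rule: walk.induct)
  case (nil n x)
  then show ?case using walk.nil by metis
next
  case (step x y n z m)
  then obtain c where c: "walk nbr d (\<lambda>v. g v \<le> ereal c) n y z" by blast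
  have "y \<in> V" "g y < \<infinity>" using step.hyps(2) by (auto simp: gdom_def)
  then obtain r where r: "g y = ereal r" using g_not_minf[of y] by (cases "g y") auto
  have "walk nbr d (\<lambda>v. g v \<le> ereal (max c r)) n y z"
    by (rule walk_weaken[OF c \<open>y \<in> V\<close> order_refl]) (auto simp: le_max_iff_disj)
  then have "walk nbr d (\<lambda>v. g v \<le> ereal (max c r)) m x z"
    using walk.step[of nbr x y "\<lambda>v. g v \<le> ereal (max c r)" d n z m] step.hyps(1,4) r by simp
  then show ?case by blast
qed

text \<open>Induction on the number of values in [a, c) taken on the ball. A walk strictly below c
  is bounded by the largest such value c', and [a, c') contains fewer values. At c = a, the strict
  walk would begin with a neighbour of x below g x.\<close>

lemma no_lower_walk:
  assumes x: "x \<in> V" and gx: "g x = ereal a" and y: "g y < ereal a"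
    and min: "\<And>v. nbr x v \<Longrightarrow> g x \<le> g v"
    and fin: "finite {t \<in> g ` {v \<in> V. d x v \<le> n}. ereal a \<le> t \<and> t \<le> ereal b}"
    and walk: "walk nbr d (\<lambda>v. g v \<le> ereal c) n x y" and c: "a \<le> c" "c \<le> b"
  shows False
  using walk c
proof (induction "card {t \<in> g ` {v \<in> V. d x v \<le> n}. ereal a \<le> t \<and> t < ereal c}" arbitrary: c rule: less_induct)
  case less
  let ?W = "\<lambda>c. {t \<in> g ` {v \<in> V. d x v \<le> n}. ereal a \<le> t \<and> t < ereal c}"
  have "g x \<le> ereal c" using gx less.prems(2) by simp
  moreover have "ereal a \<le> ereal c" using less.prems(2) by simp
  then have "g y < ereal c" using y by (rule less_le_trans[rotated])
  ultimately have low: "below c n x y" by (rule below_level[OF less.prems(1)])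
  show False
  proof (cases "a = c")
    case True
    from low show False
    proof cases
      case nil
      then show False using y gx by simp
    next
      case (step v k)
      then show False using min[OF step(1)] gx True by simp
    qed
  next
    case False
    then have ac: "a < c" using less.prems(2) by simp
    have fW: "finite (?W c)"
      by (rule finite_subset[OF _ fin]) (use less.prems(3) in \<open>auto intro: order_trans[OF less_imp_le]\<close>)
    \<comment> \<open>The vertex x contributes the value a, so the maximum exists and is at least
      a.\<close>
    have xW: "ereal a \<in> ?W c" using x gx ac by (auto intro!: image_eqI[of _ g x])
    have "Max (?W c) \<in> ?W c" using Max_in[OF fW] xW by blast
    moreover then obtain c' where c': "Max (?W c) = ereal c'" by (cases "Max (?W c)") auto
    ultimately have W: "ereal c' \<in> ?W c" by simp
    then have le: "a \<le> c'" "c' < c" by auto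
    have "walk nbr d (\<lambda>v. g v \<le> ereal c') n x y"
    proof (rule walk_weaken[OF low x])
      show "d x x + n \<le> n" by simp
      fix v assume v: "v \<in> V" "d x v \<le> n" "g v < ereal c"
      show "g v \<le> ereal c'"
      proof (cases "ereal a \<le> g v")
        case True
        then have "g v \<in> ?W c" using v by blast
        then show ?thesis using Max_ge[OF fW] c' by metis
      next
        case False
        then have "g v \<le> ereal a" by simp
        also have "\<dots> \<le> ereal c'" using le by simp
        finally show ?thesis .
      qed
    qed
    moreover have "card (?W c') < card (?W c)"
    proof (rule psubset_card_mono[OF fW])
      have "?W c' \<subseteq> ?W c" using le(2) by (auto intro: less_trans)
      moreover have "ereal c' \<notin> ?W c'" by simp
      ultimately show "?W c' \<subset> ?W c" using W by blast
    qed
    ultimately show False using less.hyps[of c'] le less.prems(3) by simp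
  qed
qed

end

theorem theorem4p6:
  fixes V :: "'a set" and E Or :: "'a \<Rightarrow> 'a \<Rightarrow> bool" and g :: "'a \<Rightarrow> ereal" and x :: 'a
  assumes "oriented_modular_graph V E Or"
    and "\<forall>v\<in>V. g v \<noteq> -\<infinity>"
    and "L_convex V Or g"
    and "(\<forall>v\<in>V. finite {w. E v w}) \<or>
         (\<exists>\<epsilon>::real>0. \<forall>v\<in>V. {t \<in> g ` V. g v - ereal \<epsilon> \<le> t \<and> t \<le> g v + ereal \<epsilon>} = {g v})"
    and "x \<in> gdom V g"
  shows "(\<forall>y\<in>V. g x \<le> g y) \<longleftrightarrow> (\<forall>y \<in> Fprime V Or x \<union> Iprime V Or x. g x \<le> g y)"
proof
  assume "\<forall>y\<in>V. g x \<le> g y"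
  then show "\<forall>y \<in> Fprime V Or x \<union> Iprime V Or x. g x \<le> g y"
    by (auto simp: Fprime_def Iprime_def)
next
  assume min: "\<forall>y \<in> Fprime V Or x \<union> Iprime V Or x. g x \<le> g y"
  interpret locally_submodular V E Or g
    using assms(1-3) by unfold_locales (auto simp: L_convex_def)
  have x: "x \<in> V" "g x < \<infinity>" using assms(5) by (auto simp: gdom_def)
  then obtain a where a: "g x = ereal a" using g_not_minf[of x] by (cases "g x") auto
  show "\<forall>y\<in>V. g x \<le> g y"
  proof (rule ccontr)
    assume "\<not> (\<forall>y\<in>V. g x \<le> g y)"
    then obtain y where y: "y \<in> V" "g y < g x" by auto
    then have "y \<in> gdom V g" "x \<noteq> y" using x by (auto simp: gdom_def)
    then obtain xs where xs: "delta_path Or (gdom V g) xs" "hd xs = x" "last xs = y"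
      using assms(3,5) unfolding L_convex_def delta_connected_def by blast
    obtain n where "walk nbr d (\<lambda>v. v \<in> gdom V g) n x y"
      using delta_path_walk[OF xs(1)] xs(2,3) by (auto simp: gdom_def)
    then obtain c where c: "walk nbr d (\<lambda>v. g v \<le> ereal c) n x y" using walk_bounded by blast
    \<comment> \<open>\<open>walk\<close> does not test its initial vertex, so the bound is raised
      to cover g x = a as well.\<close>
    have c': "walk nbr d (\<lambda>v. g v \<le> ereal (max a c)) n x y"
      by (rule walk_weaken[OF c x(1) order_refl]) (auto simp: le_max_iff_disj)
    have "g x \<le> g v" if "nbr x v" for v
      using min that by (auto simp: nbr_def Fprime_def Iprime_def)
    then show False
      using no_lower_walk[OF x(1) a _ _ finite_levels[OF assms(4) x(1), of n a "max a c"] c'] y(2) a by auto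
  qed
qed

end
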